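(* If $\Psi\in \mathrm{MAVal}_k(\mathbb{R}^n)$ is $\mathrm{SO}(n)$-equivariant, then $\Psi$ is a multiple of the $k$th Hessian measure, that is, there exists $c\in\mathbb{C}$ such that for $f\in\mathrm{Conv}(\mathbb{R}^n,\mathbb{R})\cap C^2(\mathbb{R}^n)$, \begin{align*} \Psi(f)[B]=c\int_{B}[D^2f(x)]_kd\mathrm{vol}_n(x)\quad\text{for all bounded Borel sets}~B\subset\mathbb{R}^n, \end{align*} where $[D^2f(x)]_k$ denotes the $k$th elementary symmetric polynomial in the eigenvalues of $D^2f(x)$.
   Context: $\mathrm{Conv}(\mathbb{R}^n,\mathbb{R})$ is the space of finite-valued convex functions on $\mathbb{R}^n$ (locally uniform convergence), $\mathcal{M}(\mathbb{R}^n)$ the complex Radon measures (weak*-topology). $\mathrm{MAVal}_k(\mathbb{R}^n)$ is the space of continuous valuations $\Psi:\mathrm{Conv}(\mathbb{R}^n,\mathbb{R})\to\mathcal{M}(\mathbb{R}^n)$ that are dually epi-translation invariant ($\Psi(f+l)=\Psi(f)$ for affine $l$), locally determined, translation equivariant ($\Psi(f(\cdot+x))[B]=\Psi(f)[B+x]$) and $k$-homogeneous. $\Psi$ is $\mathrm{SO}(n)$-equivariant if $\Psi(f\circ g)[g^{-1}B]=\Psi(f)[B]$ for all $g\in\mathrm{SO}(n)$, $f$, and bounded Borel $B$. *)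

theory Defs
  imports "HOL-Analysis.Analysis"
begin

text \<open>Euclidean space R^n is modelled as real^'n for a finite index type 'n.
  A complex Radon measure on R^n is modelled as a complex-valued set function,
  defined on bounded Borel sets (and normalised to 0 elsewhere), which is
  countably additive on bounded Borel sets.\<close>

definition bborel :: "('a::euclidean_space) set set" where
  "bborel = {B. bounded B \<and> B \<in> sets borel}"

definition cradon :: "('a::euclidean_space set \<Rightarrow> complex) \<Rightarrow> bool" where
  "cradon \<mu> \<longleftrightarrow>
     (\<forall>B. B \<notin> bborel \<longrightarrow> \<mu> B = 0) \<and>
     (\<forall>A::nat \<Rightarrow> 'a set. range A \<subseteq> bborel \<longrightarrow> disjoint_family A \<longrightarrow>
        bounded (\<Union>i. A i) \<longrightarrow> (\<lambda>i. \<mu> (A i)) sums \<mu> (\<Union>i. A i))"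

text \<open>Integral of a compactly supported continuous function against a complex
  Radon measure: write mu = h nu with nu a locally finite positive Borel measure
  and h locally nu-integrable; then the integral is the integral of phi*h w.r.t. nu.\<close>

definition cint :: "('a::euclidean_space set \<Rightarrow> complex) \<Rightarrow> ('a \<Rightarrow> complex) \<Rightarrow> complex" where
  "cint \<mu> \<phi> = (THE I. \<exists>(\<nu>::'a measure) (h::'a \<Rightarrow> complex).
      sets \<nu> = sets borel \<and>
      (\<forall>B\<in>bborel. emeasure \<nu> B < \<infinity> \<and> set_integrable \<nu> B h \<and> \<mu> B = (LINT x:B|\<nu>. h x)) \<and>
      integrable \<nu> (\<lambda>x. \<phi> x * h x) \<and> I = (LINT x|\<nu>. \<phi> x * h x))"

definition Cc :: "('a::euclidean_space \<Rightarrow> complex) set" where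
  "Cc = {\<phi>. continuous_on UNIV \<phi> \<and> bounded {x. \<phi> x \<noteq> 0}}"

definition weak_star_conv :: "(nat \<Rightarrow> ('a::euclidean_space set \<Rightarrow> complex)) \<Rightarrow> ('a set \<Rightarrow> complex) \<Rightarrow> bool" where
  "weak_star_conv \<mu>s \<mu> \<longleftrightarrow> (\<forall>\<phi>\<in>Cc. (\<lambda>j. cint (\<mu>s j) \<phi>) \<longlonglongrightarrow> cint \<mu> \<phi>)"

definition Conv :: "('a::euclidean_space \<Rightarrow> real) set" where
  "Conv = {f. convex_on UNIV f}"

definition loc_unif_conv :: "(nat \<Rightarrow> 'a::euclidean_space \<Rightarrow> real) \<Rightarrow> ('a \<Rightarrow> real) \<Rightarrow> bool" where
  "loc_unif_conv fs f \<longleftrightarrow> (\<forall>K. compact K \<longrightarrow> uniform_limit K fs f sequentially)"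

definition MAVal :: "nat \<Rightarrow> (('a::euclidean_space \<Rightarrow> real) \<Rightarrow> ('a set \<Rightarrow> complex)) \<Rightarrow> bool" where
  "MAVal k \<Psi> \<longleftrightarrow>
     \<comment> \<open>takes values in complex Radon measures\<close>
     (\<forall>f\<in>Conv. cradon (\<Psi> f)) \<and>
     \<comment> \<open>valuation\<close>
     (\<forall>f\<in>Conv. \<forall>h\<in>Conv. (\<lambda>x. min (f x) (h x)) \<in> Conv \<longrightarrow>
        (\<forall>B\<in>bborel. \<Psi> (\<lambda>x. max (f x) (h x)) B + \<Psi> (\<lambda>x. min (f x) (h x)) B = \<Psi> f B + \<Psi> h B)) \<and>
     \<comment> \<open>continuity (Conv is metrizable, so sequential continuity suffices)\<close>
     (\<forall>fs f. (\<forall>j. fs j \<in> Conv) \<longrightarrow> f \<in> Conv \<longrightarrow> loc_unif_conv fs f \<longrightarrow>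
        weak_star_conv (\<lambda>j. \<Psi> (fs j)) (\<Psi> f)) \<and>
     \<comment> \<open>dual epi-translation invariance\<close>
     (\<forall>f\<in>Conv. \<forall>a b. \<forall>B\<in>bborel. \<Psi> (\<lambda>x. f x + (a \<bullet> x + b)) B = \<Psi> f B) \<and>
     \<comment> \<open>locally determined\<close>
     (\<forall>f\<in>Conv. \<forall>h\<in>Conv. \<forall>U. open U \<longrightarrow> (\<forall>x\<in>U. f x = h x) \<longrightarrow>
        (\<forall>B\<in>bborel. B \<subseteq> U \<longrightarrow> \<Psi> f B = \<Psi> h B)) \<and>
     \<comment> \<open>translation equivariance\<close>
     (\<forall>f\<in>Conv. \<forall>y. \<forall>B\<in>bborel. \<Psi> (\<lambda>x. f (x + y)) B = \<Psi> f ((\<lambda>z. z + y) ` B)) \<and>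
     \<comment> \<open>k-homogeneity\<close>
     (\<forall>f\<in>Conv. \<forall>t::real. t > 0 \<longrightarrow> (\<forall>B\<in>bborel. \<Psi> (\<lambda>x. t * f x) B = complex_of_real (t ^ k) * \<Psi> f B))"

definition SOn :: "(real^'n^'n) set" where
  "SOn = {g. orthogonal_matrix g \<and> det g = 1}"

definition SO_equivariant :: "((real^'n \<Rightarrow> real) \<Rightarrow> ((real^'n) set \<Rightarrow> complex)) \<Rightarrow> bool" where
  "SO_equivariant \<Psi> \<longleftrightarrow>
     (\<forall>g\<in>SOn. \<forall>f\<in>Conv. \<forall>B\<in>bborel. \<Psi> (\<lambda>x. f (g *v x)) {x. g *v x \<in> B} = \<Psi> f B)"

definition C2_hessian :: "(real^'n \<Rightarrow> real) \<Rightarrow> (real^'n \<Rightarrow> real^'n^'n) \<Rightarrow> bool" where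
  "C2_hessian f H \<longleftrightarrow> (\<exists>G. (\<forall>x. (f has_derivative (\<lambda>v. G x \<bullet> v)) (at x)) \<and>
                            (\<forall>x. (G has_derivative (\<lambda>v. H x *v v)) (at x)) \<and>
                            continuous_on UNIV H)"

definition elem_sym :: "nat \<Rightarrow> ('n::finite \<Rightarrow> real) \<Rightarrow> real" where
  "elem_sym k d = (\<Sum>S\<in>{S. card S = k}. \<Prod>i\<in>S. d i)"

text \<open>k-th elementary symmetric polynomial of the eigenvalues (with multiplicity)
  of a real symmetric matrix A, read off from an orthogonal diagonalisation
  A = Q diag(d) Q^T.\<close>
definition sigma_eig :: "nat \<Rightarrow> real^'n^'n \<Rightarrow> real" where
  "sigma_eig k A = (THE s. \<exists>Q d. orthogonal_matrix Q \<and>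
       A = Q ** (\<chi> i j. if i = j then d i else 0) ** transpose Q \<and> s = elem_sym k d)"

end

theory Submission
  imports Defs
begin

text \<open>
  For a quadratic form \<open>q\<^sub>A\<close>, translation invariance gives \<open>\<Psi>(q\<^sub>A) = P(A) vol\<close>. The valuation property and the invariance
  under adding affine functions make the contributions of hinges \<open>max 0 (e \<bullet> x - s)\<close> additive and independent
  of the function to which they are added, and by locality such a contribution lives on the hyperplane
  \<open>e \<bullet> x = s\<close>. Writing a C2 ridge function \<open>g (e \<bullet> x)\<close> as a superposition of hinges with weights \<open>g''\<close>, one obtains
  \<open>\<Psi>(h + g (e \<bullet> x)) - \<Psi>(h) = g'' (e \<bullet> x) (\<Psi>(h + (e \<bullet> x)\<^sup>2 / 2) - \<Psi>(h))\<close>.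

  Hence \<open>P\<close> is affine in rank one directions. On diagonal matrices it is multiaffine, homogeneous of
  degree \<open>k\<close> and, by equivariance, symmetric, so that it is a multiple of the \<open>k\<close>th elementary symmetric
  polynomial; orthogonal diagonalisation gives \<open>P\<close> on all positive semidefinite matrices.

  The same formula propagates the density \<open>P(D\<^sup>2 f)\<close> from quadratic forms to convex functions that are
  a quadratic form plus a trigonometric polynomial. After a cutoff and the addition of a large multiple of the
  squared norm, a convex C2 function is locally a C2 limit of such functions, which are convex on the whole
  space, and continuity and locality apply. Both sides being affine in rank one directions, the added quadratic
  form is finally removed by extrapolation.
\<close>

text \<open>Continuity of \<open>\<Psi>\<close> sees only locally uniform convergence of convex
  functions that are finite on the whole space, while the density depends on second derivatives.
  Approximants of a C2 function must therefore converge together with their Hessians, stay convex on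
  all of R^n and be finite sums of ridge functions. Ordinary polynomials may lose convexity at
  infinity; trigonometric polynomials have a globally bounded Hessian, and the approximants share
  one bound, so that a single multiple of the squared norm makes the whole sequence convex. Building
  such a function ridge by ridge requires a larger shift, since every single cosine has to be made
  convex. That excess depends on the coefficients and need not stay bounded along the sequence; it
  is removed by affinity in rank one directions before the limit is taken. Equivariance enters
  through quadratic forms alone. Rotations do the work of all orthogonal matrices because a
  coordinate reflection commutes with diagonal matrices. The integral \<open>cint\<close> is a
  definite description, so a representation of complex measures and the independence of the integral
  from it come first.\<close>

section \<open>Integration against complex Radon measures\<close>

lemma bborelI: "bounded B \<Longrightarrow> B \<in> sets borel \<Longrightarrow> B \<in> bborel"
  and bborel_bounded: "B \<in> bborel \<Longrightarrow> bounded B"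
  and bborel_borel [measurable_dest]: "B \<in> bborel \<Longrightarrow> B \<in> sets borel"
  by (auto simp: bborel_def)

lemma bborel_empty [simp]: "{} \<in> bborel"
  and bborel_Un: "A \<in> bborel \<Longrightarrow> B \<in> bborel \<Longrightarrow> A \<union> B \<in> bborel"
  and bborel_Int: "A \<in> bborel \<Longrightarrow> B \<in> sets borel \<Longrightarrow> A \<inter> B \<in> bborel"
  and bborel_Diff: "A \<in> bborel \<Longrightarrow> B \<in> sets borel \<Longrightarrow> A - B \<in> bborel"
  by (auto simp: bborel_def)

lemma bborel_cball [simp]: "cball x r \<in> bborel"
  and bborel_ball [simp]: "ball x r \<in> bborel"
  by (auto simp: bborel_def)

lemma bborel_subset: "A \<subseteq> B \<Longrightarrow> A \<in> sets borel \<Longrightarrow> B \<in> bborel \<Longrightarrow> A \<in> bborel"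
  by (auto simp: bborel_def intro: bounded_subset)

lemma cradon_sums:
  assumes "cradon \<mu>" "\<And>i. A i \<in> bborel" "disjoint_family A" "bounded (\<Union>i::nat. A i)"
  shows "(\<lambda>i. \<mu> (A i)) sums \<mu> (\<Union>i. A i)"
  using assms unfolding cradon_def by blast

lemma cradon_empty [simp]:
  assumes "cradon \<mu>" shows "\<mu> {} = 0"
proof -
  have "(\<lambda>i::nat. \<mu> {}) sums \<mu> (\<Union>i::nat. {})"
    by (rule cradon_sums[OF assms]) (auto simp: disjoint_family_on_def)
  then show ?thesis
    using summable_const_iff sums_summable by blast
qed

lemma cradon_Un:
  assumes \<mu>: "cradon \<mu>" and A: "A \<in> bborel" and B: "B \<in> bborel" and dj: "A \<inter> B = {}"
  shows "\<mu> (A \<union> B) = \<mu> A + \<mu> B"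
proof -
  have "(\<lambda>i. \<mu> (binaryset A B i)) sums \<mu> (\<Union>i. binaryset A B i)"
  proof (rule cradon_sums[OF \<mu>])
    show "binaryset A B i \<in> bborel" for i
      using A B by (auto simp: binaryset_def)
    show "disjoint_family (binaryset A B)"
      using dj by (auto simp: disjoint_family_on_def binaryset_def)
    show "bounded (\<Union>i. binaryset A B i)"
      using A B by (auto simp: UN_binaryset_eq bborel_def)
  qed
  moreover have "(\<lambda>i. \<mu> (binaryset A B i)) sums (\<mu> A + \<mu> B)"
    by (rule binaryset_sums) (simp add: \<mu>)
  ultimately show ?thesis
    by (metis UN_binaryset_eq sums_unique2)
qed

lemma cradon_Diff:
  assumes "cradon \<mu>" "A \<in> bborel" "B \<in> bborel" "A \<subseteq> B"
  shows "\<mu> (B - A) = \<mu> B - \<mu> A"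
proof -
  have "\<mu> (A \<union> (B - A)) = \<mu> A + \<mu> (B - A)"
    using assms by (intro cradon_Un) (auto intro: bborel_Diff bborel_borel)
  moreover have "A \<union> (B - A) = B" using assms by auto
  ultimately show ?thesis by simp
qed

lemma cradon_lincomb:
  assumes "cradon \<mu>" "cradon \<nu>"
  shows "cradon (\<lambda>B. a * \<mu> B + b * \<nu> B)"
  using assms unfolding cradon_def by (auto intro!: sums_add sums_mult)

lemma cradon_cmult: "cradon \<mu> \<Longrightarrow> cradon (\<lambda>B. c * \<mu> B)"
  using cradon_lincomb[of \<mu> \<mu> c 0] by simp

text \<open>If the values were unbounded on subsets of \<open>B\<close>, then \<open>B\<close> could
  be cut into two parts of modulus above 1, one of which again has unbounded values. Iterating
  inside that part and collecting the discarded ones gives disjoint subsets of \<open>B\<close>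
  whose series converges by countable additivity although its terms do not tend to 0.\<close>

lemma cradon_bounded:
  assumes \<mu>: "cradon \<mu>" and B: "B \<in> bborel"
  shows "\<exists>M. \<forall>A\<in>bborel. A \<subseteq> B \<longrightarrow> norm (\<mu> A) \<le> M"
proof (rule ccontr)
  define unb where "unb = (\<lambda>B. \<forall>M. \<exists>A\<in>bborel. A \<subseteq> B \<and> norm (\<mu> A) > M)"
  assume "\<not> ?thesis"
  then have unbB: "unb B" unfolding unb_def by (meson not_le)
  have step: "\<exists>C. (C \<in> bborel \<and> unb C) \<and> C \<subseteq> B \<and> norm (\<mu> (B - C)) > 1"
    if B: "B \<in> bborel" and u: "unb B" for B
  proof -
    \<comment> \<open>The surplus 1 over \<open>norm (\<mu> B)\<close> forces modulus above 1 on
      \<open>B - A\<close> as well as on \<open>A\<close>, so that either may be discarded.\<close>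
    obtain A where A: "A \<in> bborel" "A \<subseteq> B" "norm (\<mu> A) > norm (\<mu> B) + 1"
      using u unfolding unb_def by blast
    have d: "\<mu> (B - A) = \<mu> B - \<mu> A" using A B \<mu> by (intro cradon_Diff)
    have n1: "norm (\<mu> (B - A)) > 1"
      using A(3) norm_triangle_ineq2[of "\<mu> A" "\<mu> B"] by (simp add: d norm_minus_commute)
    have n2: "norm (\<mu> A) > 1" using A(3) by (smt (verit) norm_ge_zero)
    have BA: "B - A \<in> bborel" using A B by (auto intro: bborel_Diff bborel_borel)
    have "unb A \<or> unb (B - A)"
    proof (rule ccontr)
      assume "\<not> ?thesis"
      then obtain M1 M2 where M: "\<And>E. E \<in> bborel \<Longrightarrow> E \<subseteq> A \<Longrightarrow> norm (\<mu> E) \<le> M1"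
        "\<And>E. E \<in> bborel \<Longrightarrow> E \<subseteq> B - A \<Longrightarrow> norm (\<mu> E) \<le> M2"
        unfolding unb_def by (meson not_le)
      obtain E where E: "E \<in> bborel" "E \<subseteq> B" "norm (\<mu> E) > M1 + M2"
        using u unfolding unb_def by blast
      have e: "E \<inter> A \<in> bborel" "E - A \<in> bborel"
        using E A by (auto intro: bborel_Diff bborel_Int bborel_borel)
      have "\<mu> ((E \<inter> A) \<union> (E - A)) = \<mu> (E \<inter> A) + \<mu> (E - A)"
        using e by (intro cradon_Un[OF \<mu>]) auto
      moreover have "(E \<inter> A) \<union> (E - A) = E" by auto
      moreover have "norm (\<mu> (E \<inter> A)) \<le> M1" "norm (\<mu> (E - A)) \<le> M2"
        using M e E by auto
      ultimately show False using E(3) norm_triangle_ineq[of "\<mu> (E \<inter> A)" "\<mu> (E - A)"] by simp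
    qed
    then show ?thesis
    proof
      assume "unb A" with A n1 show ?thesis by blast
    next
      have "B - (B - A) = A" using A by auto
      moreover assume "unb (B - A)"
      ultimately show ?thesis using BA n2 by (metis Diff_subset)
    qed
  qed
  have "\<exists>F. \<forall>n::nat. ((F n \<in> bborel \<and> unb (F n)) \<and> (n = 0 \<longrightarrow> F n = B)) \<and>
      (F (Suc n) \<subseteq> F n \<and> norm (\<mu> (F n - F (Suc n))) > 1)"
  proof (rule dependent_nat_choice)
    show "\<exists>C. (C \<in> bborel \<and> unb C) \<and> ((0::nat) = 0 \<longrightarrow> C = B)" using B unbB by blast
  next
    fix C and n :: nat assume "(C \<in> bborel \<and> unb C) \<and> (n = 0 \<longrightarrow> C = B)"
    then show "\<exists>D. ((D \<in> bborel \<and> unb D) \<and> (Suc n = 0 \<longrightarrow> D = B)) \<and>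
        D \<subseteq> C \<and> norm (\<mu> (C - D)) > 1"
      using step[of C] by simp
  qed
  then obtain F where F: "\<And>n. F n \<in> bborel \<and> unb (F n)" and F0: "F 0 = B"
    and FS: "\<And>n. F (Suc n) \<subseteq> F n \<and> norm (\<mu> (F n - F (Suc n))) > 1"
    by auto
  have dec: "F j \<subseteq> F i" if "i \<le> j" for i j
    using lift_Suc_antimono_le[of F, OF _ that] FS by blast
  define D where "D = (\<lambda>i. F i - F (Suc i))"
  have "(\<lambda>i. \<mu> (D i)) sums \<mu> (\<Union>i. D i)"
  proof (rule cradon_sums[OF \<mu>])
    show "D i \<in> bborel" for i
      using F by (auto simp: D_def intro: bborel_Diff bborel_borel)
    have "D i \<inter> D j = {}" if "i < j" for i j
      using dec[of "Suc i" j] that by (auto simp: D_def)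
    then show "disjoint_family D"
      unfolding disjoint_family_on_def by (metis inf_commute linorder_neqE_nat)
    have "(\<Union>i. D i) \<subseteq> B" using dec[of 0] F0 by (auto simp: D_def)
    then show "bounded (\<Union>i. D i)" using B bborel_bounded bounded_subset by blast
  qed
  then have "(\<lambda>i. \<mu> (D i)) \<longlonglongrightarrow> 0" using sums_summable summable_LIMSEQ_zero by blast
  then have "\<forall>\<^sub>F i in sequentially. norm (\<mu> (D i)) < 1"
    using order_tendstoD(2)[OF tendsto_norm_zero, of "\<lambda>i. \<mu> (D i)" sequentially 1] by simp
  then show False using FS by (auto simp: D_def eventually_sequentially intro: less_asym)
qed

text \<open>Taking the supremum over bounded subsets gives a measure on all Borel sets, although
  the complex measure itself is only meaningful on bounded ones.\<close>

definition pos_var :: "('a::euclidean_space set \<Rightarrow> complex) \<Rightarrow> 'a set \<Rightarrow> ennreal" where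
  "pos_var \<mu> B = (SUP A\<in>{A\<in>bborel. A \<subseteq> B}. ennreal (Re (\<mu> A)))"

lemma pos_var_upper: "A \<in> bborel \<Longrightarrow> A \<subseteq> B \<Longrightarrow> ennreal (Re (\<mu> A)) \<le> pos_var \<mu> B"
  unfolding pos_var_def by (rule SUP_upper) auto

text \<open>The union of a competitor for \<open>A\<close> and one for \<open>B\<close> is a
  competitor for \<open>A \<union> B\<close>.\<close>

lemma pos_var_superadd:
  assumes \<mu>: "cradon \<mu>" and dj: "A \<inter> B = {}"
  shows "pos_var \<mu> A + pos_var \<mu> B \<le> pos_var \<mu> (A \<union> B)"
proof -
  have *: "ennreal (Re (\<mu> E)) + ennreal (Re (\<mu> F)) \<le> pos_var \<mu> (A \<union> B)"
    if "E \<in> bborel" "E \<subseteq> A" "F \<in> bborel" "F \<subseteq> B" for E F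
  proof -
    have "\<mu> (E \<union> F) = \<mu> E + \<mu> F" using that dj by (intro cradon_Un[OF \<mu>]) auto
    moreover have "ennreal (Re (\<mu> (E \<union> F))) \<le> pos_var \<mu> (A \<union> B)"
      "ennreal (Re (\<mu> E)) \<le> pos_var \<mu> (A \<union> B)" "ennreal (Re (\<mu> F)) \<le> pos_var \<mu> (A \<union> B)"
      using that by (auto intro!: pos_var_upper bborel_Un)
    \<comment> \<open>\<open>ennreal\<close> truncates negative reals to 0, so when one of the real
      parts is negative the other set alone serves as competitor.\<close>
    ultimately show ?thesis
      by (cases "Re (\<mu> E) \<ge> 0"; cases "Re (\<mu> F) \<ge> 0") (auto simp: ennreal_plus ennreal_neg)
  qed
  have ne: "{A\<in>bborel. A \<subseteq> X} \<noteq> {}" for X :: "'a set" using bborel_empty by blast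
  have "pos_var \<mu> A + pos_var \<mu> B
      = (SUP E\<in>{E\<in>bborel. E \<subseteq> A}. SUP F\<in>{F\<in>bborel. F \<subseteq> B}. ennreal (Re (\<mu> E)) + ennreal (Re (\<mu> F)))"
    unfolding pos_var_def by (simp only: ennreal_SUP_add_left[OF ne, symmetric] ennreal_SUP_add_right[OF ne, symmetric] ennreal_add_eq_top)
  then show ?thesis using * by (auto intro!: SUP_least)
qed

text \<open>Only an inequality, because negative terms are truncated to 0 on the right. It compares
  the real partial sums of a competitor with the nonnegative series in
  \<open>countably_additive_pos_var\<close>.\<close>

lemma ennreal_sum_le: "ennreal (\<Sum>i\<in>I. f i) \<le> (\<Sum>i\<in>I. ennreal (f i))"
proof (induction I rule: infinite_finite_induct)
  case (insert i I)
  have "ennreal (f i + sum f I) \<le> ennreal (f i) + ennreal (sum f I)"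
    by (cases "f i \<ge> 0"; cases "sum f I \<ge> 0")
       (auto simp: ennreal_plus ennreal_neg intro!: ennreal_leI)
  with insert show ?case by (auto intro: order_trans add_left_mono)
qed auto

text \<open>Superadditivity on finite unions bounds the series from above. Conversely a competitor
  \<open>E\<close> for the union splits into the pieces \<open>E \<inter> A i\<close>, over which
  \<open>\<mu>\<close> is countably additive because \<open>E\<close> is bounded.\<close>

lemma countably_additive_pos_var:
  assumes \<mu>: "cradon \<mu>"
  shows "countably_additive (sets borel) (pos_var \<mu>)"
proof (rule countably_additiveI)
  fix A :: "nat \<Rightarrow> 'a set" assume A: "range A \<subseteq> sets borel" and dj: "disjoint_family A"
  have partial: "(\<Sum>i<n. pos_var \<mu> (A i)) \<le> pos_var \<mu> (\<Union>i<n. A i)" for n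
  proof (induction n)
    case (Suc n)
    have "A i \<inter> A n = {}" if "i < n" for i
      using disjoint_family_onD[OF dj, of i n] that by simp
    then have "(\<Union>i<n. A i) \<inter> A n = {}" by blast
    from pos_var_superadd[OF \<mu> this] have "pos_var \<mu> (\<Union>i<n. A i) + pos_var \<mu> (A n) \<le> pos_var \<mu> (\<Union>i<Suc n. A i)"
      by (simp only: lessThan_Suc UN_insert Un_commute)
    with add_right_mono[OF Suc, of "pos_var \<mu> (A n)"] show ?case
      unfolding sum.lessThan_Suc by (rule order_trans)
  qed simp
  have "(\<Sum>i. pos_var \<mu> (A i)) \<le> pos_var \<mu> (\<Union>i. A i)"
    unfolding suminf_eq_SUP
  proof (rule SUP_least)
    fix n
    have "pos_var \<mu> (\<Union>i<n. A i) \<le> pos_var \<mu> (\<Union>i. A i)"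
      unfolding pos_var_def by (rule SUP_subset_mono) auto
    with partial[of n] show "(\<Sum>i<n. pos_var \<mu> (A i)) \<le> pos_var \<mu> (\<Union>i. A i)"
      by (rule order_trans)
  qed
  moreover have "pos_var \<mu> (\<Union>i. A i) \<le> (\<Sum>i. pos_var \<mu> (A i))"
    unfolding pos_var_def[of _ "\<Union>i. A i"]
  proof (rule SUP_least, clarify)
    fix E assume E: "E \<in> bborel" "E \<subseteq> (\<Union>i. A i)"
    have "(\<lambda>i. \<mu> (E \<inter> A i)) sums \<mu> (\<Union>i. E \<inter> A i)"
    proof (rule cradon_sums[OF \<mu>])
      show "E \<inter> A i \<in> bborel" for i using E(1) A by (intro bborel_Int) blast+
      show "disjoint_family (\<lambda>i. E \<inter> A i)" using dj by (auto simp: disjoint_family_on_def)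
      show "bounded (\<Union>i. E \<inter> A i)" by (rule bounded_subset[OF bborel_bounded[OF E(1)]]) blast
    qed
    moreover have "(\<Union>i. E \<inter> A i) = E" using E by auto
    ultimately have "(\<lambda>i. Re (\<mu> (E \<inter> A i))) sums Re (\<mu> E)"
      using sums_Re by fastforce
    then have "(\<lambda>n. ennreal (\<Sum>i<n. Re (\<mu> (E \<inter> A i)))) \<longlonglongrightarrow> ennreal (Re (\<mu> E))"
      unfolding sums_def by (rule tendsto_ennrealI)
    moreover have "ennreal (\<Sum>i<n. Re (\<mu> (E \<inter> A i))) \<le> (\<Sum>i. pos_var \<mu> (A i))" for n
    proof -
      have "ennreal (\<Sum>i<n. Re (\<mu> (E \<inter> A i))) \<le> (\<Sum>i<n. ennreal (Re (\<mu> (E \<inter> A i))))"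
        by (rule ennreal_sum_le)
      also have "\<dots> \<le> (\<Sum>i<n. pos_var \<mu> (A i))"
        using E(1) A by (intro sum_mono pos_var_upper bborel_Int) blast+
      also have "\<dots> \<le> (\<Sum>i. pos_var \<mu> (A i))"
        by (rule sum_le_suminf) auto
      finally show ?thesis .
    qed
    ultimately show "ennreal (Re (\<mu> E)) \<le> (\<Sum>i. pos_var \<mu> (A i))"
      using LIMSEQ_le_const2 by blast
  qed
  ultimately show "(\<Sum>i. pos_var \<mu> (A i)) = pos_var \<mu> (\<Union>i. A i)" by (rule antisym)
qed

lemma pos_var_finite:
  assumes "cradon \<mu>" "B \<in> bborel" shows "pos_var \<mu> B < \<infinity>"
proof -
  obtain M where M: "\<And>A. A \<in> bborel \<Longrightarrow> A \<subseteq> B \<Longrightarrow> norm (\<mu> A) \<le> M"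
    using cradon_bounded[OF assms] by blast
  have "pos_var \<mu> B \<le> ennreal M"
    unfolding pos_var_def
  proof (rule SUP_least, clarify)
    fix A assume "A \<in> bborel" "A \<subseteq> B"
    from M[OF this] complex_Re_le_cmod[of "\<mu> A"] show "ennreal (Re (\<mu> A)) \<le> ennreal M"
      by (intro ennreal_leI) linarith
  qed
  also have "\<dots> < \<infinity>" by simp
  finally show ?thesis .
qed

text \<open>Passing to the complement in \<open>B\<close> turns a lower bound for the real part into
  an upper one: \<open>Re (\<mu> A) = Re (\<mu> B) - Re (\<mu> (B - A))\<close>. Used for
  \<open>\<mu>\<close> and for its negative, the inequality becomes the Jordan decomposition of the
  real part.\<close>

lemma pos_var_le_neg:
  assumes \<mu>: "cradon \<mu>" and B: "B \<in> bborel"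
  shows "enn2real (pos_var \<mu> B) \<le> enn2real (pos_var (\<lambda>A. - \<mu> A) B) + Re (\<mu> B)"
proof -
  have \<mu>': "cradon (\<lambda>A. - \<mu> A)" using cradon_cmult[OF \<mu>, of "-1"] by simp
  let ?n = "enn2real (pos_var (\<lambda>A. - \<mu> A) B)"
  have n: "- Re (\<mu> A) \<le> ?n" if "A \<in> bborel" "A \<subseteq> B" for A
  proof -
    have "ennreal (Re (- \<mu> A)) \<le> pos_var (\<lambda>A. - \<mu> A) B"
      using that by (rule pos_var_upper)
    also have "\<dots> = ennreal ?n"
      using pos_var_finite[OF \<mu>' B] by simp
    finally have "Re (- \<mu> A) \<le> ?n" by (simp only: ennreal_le_iff[OF enn2real_nonneg])
    then show ?thesis by simp
  qed
  have le: "Re (\<mu> A) \<le> ?n + Re (\<mu> B)" if "A \<in> bborel" "A \<subseteq> B" for A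
  proof -
    have "\<mu> (B - A) = \<mu> B - \<mu> A" using that B \<mu> by (intro cradon_Diff)
    moreover have "- Re (\<mu> (B - A)) \<le> ?n"
      by (rule n[OF bborel_Diff[OF B bborel_borel[OF that(1)]]]) blast
    ultimately show ?thesis by simp
  qed
  have "pos_var \<mu> B \<le> ennreal (?n + Re (\<mu> B))"
    unfolding pos_var_def[of \<mu>] using le by (intro SUP_least) (auto intro!: ennreal_leI)
  moreover have "0 \<le> ?n + Re (\<mu> B)" using le[of "{}"] \<mu> by simp
  ultimately show ?thesis by (simp add: enn2real_leI)
qed

lemma Re_cradon_eq:
  assumes \<mu>: "cradon \<mu>" and B: "B \<in> bborel"
  shows "Re (\<mu> B) = enn2real (pos_var \<mu> B) - enn2real (pos_var (\<lambda>A. - \<mu> A) B)"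
proof -
  have \<mu>': "cradon (\<lambda>A. - \<mu> A)" using cradon_cmult[OF \<mu>, of "-1"] by simp
  show ?thesis using pos_var_le_neg[OF \<mu> B] pos_var_le_neg[OF \<mu>' B] by simp
qed

section \<open>Representation of a complex Radon measure by a density\<close>

definition radon_rep :: "('a::euclidean_space set \<Rightarrow> complex) \<Rightarrow> 'a measure \<Rightarrow> ('a \<Rightarrow> complex) \<Rightarrow> bool" where
  "radon_rep \<mu> \<nu> h \<longleftrightarrow> sets \<nu> = sets borel \<and>
      (\<forall>B\<in>bborel. emeasure \<nu> B < \<infinity> \<and> set_integrable \<nu> B h \<and> \<mu> B = (LINT x:B|\<nu>. h x))"

lemma sigma_finite_borel_measure:
  fixes \<nu> :: "'a::euclidean_space measure"
  assumes s: "sets \<nu> = sets borel" and f: "\<And>B. B \<in> bborel \<Longrightarrow> emeasure \<nu> B < \<infinity>"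
  shows "sigma_finite_measure \<nu>"
proof
  have "x \<in> (\<Union>n::nat. cball 0 (real n))" for x :: 'a
    using real_arch_simple[of "norm x"] by (simp add: dist_norm)
  then have "(\<Union>n::nat. cball (0::'a) (real n)) = UNIV" by blast
  moreover have "space \<nu> = UNIV" using s by (simp add: sets_eq_imp_space_eq)
  moreover have "emeasure \<nu> (cball 0 (real n)) \<noteq> \<infinity>" for n
    using f[OF bborel_cball, of 0 "real n"] by simp
  ultimately show "\<exists>A. countable A \<and> A \<subseteq> sets \<nu> \<and> \<Union> A = space \<nu> \<and> (\<forall>a\<in>A. emeasure \<nu> a \<noteq> \<infinity>)"
    using s by (intro exI[of _ "range (\<lambda>n::nat. cball 0 (real n))"]) (simp add: image_subset_iff)
qed

text \<open>\<open>Radon_Nikodym\<close> delivers extended nonnegative densities. A finite integral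
  over \<open>B\<close> makes them finite almost everywhere there, so that \<open>enn2real\<close>
  does not change the integral.\<close>

lemma finite_density_part:
  fixes \<nu> :: "'a measure"
  assumes f: "f \<in> borel_measurable \<nu>" and B: "B \<in> sets \<nu>"
    and fin: "(\<integral>\<^sup>+x. f x * indicator B x \<partial>\<nu>) < \<infinity>"
  shows "set_integrable \<nu> B (\<lambda>x. complex_of_real (enn2real (f x)))"
    and "(LINT x:B|\<nu>. complex_of_real (enn2real (f x))) = enn2real (\<integral>\<^sup>+x. f x * indicator B x \<partial>\<nu>)"
proof -
  note [measurable] = f B
  let ?g = "\<lambda>x. indicator B x * enn2real (f x)"
  have ae: "AE x in \<nu>. f x * indicator B x \<noteq> \<infinity>"
    using fin by (intro nn_integral_noteq_infinite) auto
  have eq: "(\<integral>\<^sup>+x. ennreal (?g x) \<partial>\<nu>) = (\<integral>\<^sup>+x. f x * indicator B x \<partial>\<nu>)"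
    using ae by (intro nn_integral_cong_AE) (auto simp: indicator_def top.not_eq_extremum elim!: eventually_mono)
  have int: "integrable \<nu> ?g"
    using fin eq by (intro integrableI_nonneg) auto
  show "set_integrable \<nu> B (\<lambda>x. complex_of_real (enn2real (f x)))"
    unfolding set_integrable_def using integrable_of_real[OF int, where 'a=complex]
    by (simp add: scaleR_conv_of_real)
  have "(LINT x:B|\<nu>. complex_of_real (enn2real (f x))) = (LINT x|\<nu>. complex_of_real (?g x))"
    unfolding set_lebesgue_integral_def by (simp add: scaleR_conv_of_real)
  also have "\<dots> = complex_of_real (LINT x|\<nu>. ?g x)" by (rule integral_complex_of_real)
  also have "(LINT x|\<nu>. ?g x) = enn2real (\<integral>\<^sup>+x. f x * indicator B x \<partial>\<nu>)"
    unfolding eq[symmetric] by (rule integral_eq_nn_integral) auto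
  finally show "(LINT x:B|\<nu>. complex_of_real (enn2real (f x))) = enn2real (\<integral>\<^sup>+x. f x * indicator B x \<partial>\<nu>)" .
qed

text \<open>The real and imaginary parts of \<open>\<mu>\<close> are differences of the variations
  of \<open>c * \<mu>\<close> for the four units \<open>c\<close>. These are positive measures,
  absolutely continuous with respect to their sum \<open>\<nu>\<close>, and their densities combine
  to \<open>h\<close>.\<close>

lemma radon_rep_exists:
  fixes \<mu> :: "'a::euclidean_space set \<Rightarrow> complex"
  assumes \<mu>: "cradon \<mu>"
  shows "\<exists>\<nu> h. radon_rep \<mu> \<nu> h"
proof -
  define C where "C = {1, -1, \<i>, -\<i>}"
  define P where "P = (\<lambda>c. pos_var (\<lambda>A. c * \<mu> A))"
  have fC: "finite C" by (simp add: C_def)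
  have cr: "cradon (\<lambda>A. c * \<mu> A)" for c by (rule cradon_cmult[OF \<mu>])
  have P0: "P c {} = 0" for c
    using \<mu> by (auto simp: P_def pos_var_def intro!: SUP_eq_const[of _ _ 0, simplified])
  have sa: "sigma_algebra UNIV (sets (borel :: 'a measure))"
    by (metis sets.sigma_algebra_axioms space_borel)
  define M where "M = (\<lambda>c. measure_of UNIV (sets borel) (P c))"
  have M: "emeasure (M c) B = P c B" if "B \<in> sets borel" for c B
    unfolding M_def using that P0 countably_additive_pos_var[OF cr]
    by (intro emeasure_measure_of_sigma sa) (auto simp: positive_def P_def)
  have sM: "sets (M c) = sets borel" for c unfolding M_def
    by (metis sets.sets_measure_of_eq space_borel)
  define Q where "Q = (\<lambda>B. \<Sum>c\<in>C. P c B)"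
  define \<nu> where "\<nu> = measure_of UNIV (sets borel) Q"
  have s\<nu>: "sets \<nu> = sets borel" unfolding \<nu>_def
    by (metis sets.sets_measure_of_eq space_borel)
  have "countably_additive (sets borel) Q"
    unfolding countably_additive_def
  proof safe
    fix A :: "nat \<Rightarrow> 'a set"
    assume A: "range A \<subseteq> sets borel" "disjoint_family A" "(\<Union>i. A i) \<in> sets borel"
    have "(\<Sum>i. Q (A i)) = (\<Sum>c\<in>C. \<Sum>i. P c (A i))"
      unfolding Q_def by (rule suminf_sum) auto
    also have "\<dots> = Q (\<Union>i. A i)"
      unfolding Q_def P_def using countably_additive_pos_var[OF cr] A
      by (intro sum.cong) (auto simp: countably_additive_def)
    finally show "(\<Sum>i. Q (A i)) = Q (\<Union>i. A i)" .
  qed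
  then have \<nu>: "emeasure \<nu> B = Q B" if "B \<in> sets borel" for B
    unfolding \<nu>_def using that P0
    by (intro emeasure_measure_of_sigma sa) (auto simp: positive_def Q_def)
  have Pfin: "P c B < \<infinity>" if "B \<in> bborel" for c B
    unfolding P_def by (rule pos_var_finite[OF cr that])
  have \<nu>fin: "emeasure \<nu> B < \<infinity>" if "B \<in> bborel" for B
    using that Pfin \<nu> by (auto simp: Q_def ennreal_sum_less_top fC dest: bborel_borel)
  interpret sigma_finite_measure \<nu> by (rule sigma_finite_borel_measure[OF s\<nu> \<nu>fin])
  have "\<exists>f \<in> borel_measurable \<nu>. density \<nu> f = M c" if c: "c \<in> C" for c
  proof (rule Radon_Nikodym)
    show "sets (M c) = sets \<nu>" using sM s\<nu> by simp
    show "absolutely_continuous \<nu> (M c)"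
      unfolding absolutely_continuous_def null_sets_def using M \<nu> sM s\<nu> c fC
      by (auto simp: Q_def)
  qed
  then obtain f where fm: "\<And>c. c \<in> C \<Longrightarrow> f c \<in> borel_measurable \<nu>"
    and fd: "\<And>c. c \<in> C \<Longrightarrow> density \<nu> (f c) = M c" by metis
  have fint: "(\<integral>\<^sup>+x. f c x * indicator B x \<partial>\<nu>) = P c B" if "c \<in> C" "B \<in> sets borel" for c B
    using emeasure_density[OF fm[OF that(1)], of B] that fd M s\<nu> by simp
  \<comment> \<open>The weights \<open>cnj c\<close> are 1, -1, -\<i> and \<i>; the imaginary part
    appears through \<open>Im z = Re (-\<i> * z)\<close>.\<close>
  define h where "h = (\<lambda>x. \<Sum>c\<in>C. cnj c * complex_of_real (enn2real (f c x)))"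
  have "set_integrable \<nu> B h \<and> \<mu> B = (LINT x:B|\<nu>. h x)" if B: "B \<in> bborel" for B
  proof -
    have Bs: "B \<in> sets \<nu>" using B s\<nu> bborel_borel by auto
    have fi: "(\<integral>\<^sup>+x. f c x * indicator B x \<partial>\<nu>) = P c B" if "c \<in> C" for c
      using fint that B bborel_borel by auto
    have i: "set_integrable \<nu> B (\<lambda>x. complex_of_real (enn2real (f c x)))"
        "(LINT x:B|\<nu>. complex_of_real (enn2real (f c x))) = enn2real (P c B)" if "c \<in> C" for c
      using finite_density_part[OF fm[OF that] Bs] Pfin[OF B, of c] fi[OF that] by auto
    have set_integrable_sum: "set_integrable \<nu> B (\<lambda>x. \<Sum>c\<in>C. g c x)"
      and set_integral_sum: "(LINT x:B|\<nu>. \<Sum>c\<in>C. g c x) = (\<Sum>c\<in>C. LINT x:B|\<nu>. g c x)"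
      if "\<And>c. c \<in> C \<Longrightarrow> set_integrable \<nu> B (g c)" for g :: "complex \<Rightarrow> 'a \<Rightarrow> complex"
      using that unfolding set_integrable_def set_lebesgue_integral_def scaleR_sum_right
      by (auto intro!: Bochner_Integration.integral_sum Bochner_Integration.integrable_sum)
    have 1: "set_integrable \<nu> B h" unfolding h_def
      using i by (intro set_integrable_sum set_integrable_mult_right)
    have "(LINT x:B|\<nu>. h x) = (\<Sum>c\<in>C. cnj c * complex_of_real (enn2real (P c B)))"
      unfolding h_def using fC i
      by (subst set_integral_sum) (auto intro!: set_integrable_mult_right sum.cong)
    also have "\<dots> = (enn2real (P 1 B) - enn2real (P (-1) B)) + \<i> * (enn2real (P (-\<i>) B) - enn2real (P \<i> B))"
      by (simp add: C_def complex_eq_iff)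
    also have "\<dots> = Re (\<mu> B) + \<i> * Im (\<mu> B)"
      using Re_cradon_eq[OF \<mu> B] Re_cradon_eq[OF cr B, of "-\<i>"] by (simp add: P_def)
    also have "\<dots> = \<mu> B" by (simp add: complex_eq_iff)
    finally show ?thesis using 1 by simp
  qed
  then show ?thesis unfolding radon_rep_def using s\<nu> \<nu>fin by blast
qed

text \<open>A class of test functions wider than \<open>Cc\<close>: it contains the indicators of
  bounded Borel sets, on which the integral returns the measure, and is closed under products with
  continuous functions.\<close>

definition bounded_borel_fun :: "('a::euclidean_space \<Rightarrow> complex) set" where
  "bounded_borel_fun = {\<phi> \<in> borel_measurable borel. bounded (range \<phi>) \<and> bounded {x. \<phi> x \<noteq> 0}}"

lemma bbf_measurable [measurable_dest]: "\<phi> \<in> bounded_borel_fun \<Longrightarrow> \<phi> \<in> borel_measurable borel"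
  by (simp add: bounded_borel_fun_def)

lemma bbf_bound:
  assumes "\<phi> \<in> bounded_borel_fun"
  obtains K where "K > 0" "\<And>x. norm (\<phi> x) \<le> K"
  using assms unfolding bounded_borel_fun_def bounded_pos by auto

lemma bbf_support:
  assumes "\<phi> \<in> bounded_borel_fun"
  obtains r where "r > 0" "\<And>x. norm x > r \<Longrightarrow> \<phi> x = 0"
  using assms unfolding bounded_borel_fun_def bounded_pos by force

lemma bbfI:
  assumes "\<phi> \<in> borel_measurable borel" "\<And>x. norm (\<phi> x) \<le> K" "\<And>x. x \<notin> B \<Longrightarrow> \<phi> x = 0" "bounded B"
  shows "\<phi> \<in> bounded_borel_fun"
proof -
  have "{x. \<phi> x \<noteq> 0} \<subseteq> B" using assms(3) by blast
  then show ?thesis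
    using assms(1,2,4) unfolding bounded_borel_fun_def
    by (auto intro: boundedI bounded_subset)
qed

lemma bbf_indicator: "B \<in> bborel \<Longrightarrow> indicator B \<in> bounded_borel_fun"
  by (rule bbfI[where K=1 and B=B]) (auto simp: indicator_def bborel_def)

lemma bbf_mult:
  assumes \<phi>: "\<phi> \<in> bounded_borel_fun" and g: "continuous_on UNIV g"
  shows "(\<lambda>x. \<phi> x * g x) \<in> bounded_borel_fun"
proof -
  obtain K where K: "K > 0" "\<And>x. norm (\<phi> x) \<le> K" using bbf_bound[OF \<phi>] by blast
  obtain r where r: "r > 0" "\<And>x. norm x > r \<Longrightarrow> \<phi> x = 0" using bbf_support[OF \<phi>] by blast
  have "compact (g ` cball 0 r)"
    using g by (auto intro!: compact_continuous_image intro: continuous_on_subset)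
  then obtain L where L: "L > 0" "\<And>x. x \<in> cball 0 r \<Longrightarrow> norm (g x) \<le> L"
    using compact_imp_bounded[of "g ` cball 0 r"] unfolding bounded_pos by blast
  have [measurable]: "g \<in> borel_measurable borel" using g by (rule borel_measurable_continuous_onI)
  have "norm (\<phi> x * g x) \<le> K * L" for x
    using K L(2)[of x] L(1) r(2)[of x]
    by (cases "norm x \<le> r") (auto simp: norm_mult intro!: mult_mono)
  then show ?thesis
    using r \<phi> by (intro bbfI[where K="K * L" and B="cball 0 r"]) auto
qed

lemma bbf_lincomb:
  assumes \<phi>: "\<phi> \<in> bounded_borel_fun" and \<psi>: "\<psi> \<in> bounded_borel_fun"
  shows "(\<lambda>x. a * \<phi> x + b * \<psi> x) \<in> bounded_borel_fun"
proof -
  obtain K where K: "K > 0" "\<And>x. norm (\<phi> x) \<le> K" using bbf_bound[OF \<phi>] by blast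
  obtain L where L: "L > 0" "\<And>x. norm (\<psi> x) \<le> L" using bbf_bound[OF \<psi>] by blast
  have "norm (a * \<phi> x + b * \<psi> x) \<le> norm a * K + norm b * L" for x
    using K L by (auto simp: norm_mult intro!: order.trans[OF norm_triangle_ineq] add_mono mult_left_mono)
  moreover have "bounded ({x. \<phi> x \<noteq> 0} \<union> {x. \<psi> x \<noteq> 0})"
    using assms by (auto simp: bounded_borel_fun_def)
  moreover have "(\<lambda>x. a * \<phi> x + b * \<psi> x) \<in> borel_measurable borel"
    using \<phi> \<psi> by measurable
  ultimately show ?thesis by (intro bbfI[where B="{x. \<phi> x \<noteq> 0} \<union> {x. \<psi> x \<noteq> 0}"]) simp_all
qed

lemma bbf_Cc:
  assumes "\<phi> \<in> Cc" shows "\<phi> \<in> bounded_borel_fun"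
proof -
  have c: "continuous_on UNIV \<phi>" and b: "bounded {x. \<phi> x \<noteq> 0}" using assms by (auto simp: Cc_def)
  obtain r where r: "r > 0" "{x. \<phi> x \<noteq> 0} \<subseteq> cball 0 r"
    using b unfolding bounded_pos by (auto simp: subset_eq)
  have "indicator (cball 0 r) \<in> bounded_borel_fun" by (rule bbf_indicator) simp
  from bbf_mult[OF this c] show ?thesis
    by (rule back_subst[of "\<lambda>f. f \<in> _"]) (use r in \<open>auto simp: indicator_def fun_eq_iff\<close>)
qed

section \<open>Independence of the integral from the representation\<close>

lemma radon_rep_integrable:
  assumes rep: "radon_rep \<mu> \<nu> h" and \<phi>: "\<phi> \<in> bounded_borel_fun"
  shows "integrable \<nu> (\<lambda>x. \<phi> x * h x)"
proof -
  obtain K where K: "K > 0" "\<And>x. norm (\<phi> x) \<le> K" using bbf_bound[OF \<phi>] by blast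
  obtain r where r: "r > 0" "\<And>x. norm x > r \<Longrightarrow> \<phi> x = 0" using bbf_support[OF \<phi>] by blast
  have [measurable_cong]: "sets \<nu> = sets borel" using rep by (simp add: radon_rep_def)
  have i: "integrable \<nu> (\<lambda>x. indicator (cball 0 r) x *\<^sub>R h x)"
    using rep bborel_cball[of 0 r] unfolding radon_rep_def set_integrable_def by blast
  have eq: "\<phi> x * h x = \<phi> x * (indicator (cball 0 r) x *\<^sub>R h x)" for x
    using r(2)[of x] by (auto simp: indicator_def)
  have [measurable]: "\<phi> \<in> borel_measurable \<nu>" using \<phi> by measurable
  show ?thesis
  proof (rule Bochner_Integration.integrable_bound)
    show "integrable \<nu> (\<lambda>x. K *\<^sub>R norm (indicator (cball 0 r) x *\<^sub>R h x))"
      by (intro integrable_scaleR_right integrable_norm i)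
    show "(\<lambda>x. \<phi> x * h x) \<in> borel_measurable \<nu>"
      unfolding eq using i by (intro borel_measurable_times) auto
    show "AE x in \<nu>. norm (\<phi> x * h x) \<le> norm (K *\<^sub>R norm (indicator (cball 0 r) x *\<^sub>R h x))"
    proof (rule AE_I2)
      fix x
      have "norm (\<phi> x * h x) = norm (\<phi> x) * norm (indicator (cball 0 r) x *\<^sub>R h x)"
        by (subst eq) (rule norm_mult)
      also have "\<dots> \<le> K * norm (indicator (cball 0 r) x *\<^sub>R h x)"
        by (intro mult_right_mono K) simp
      finally show "norm (\<phi> x * h x) \<le> norm (K *\<^sub>R norm (indicator (cball 0 r) x *\<^sub>R h x))"
        using K(1) by simp
    qed
  qed
qed

text \<open>The integral of a simple function in terms of \<open>\<mu>\<close> alone, without a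
  representation. The value 0 is left out because for \<open>s\<close> of bounded support its level
  set is unbounded, where \<open>\<mu>\<close> carries no information.\<close>

definition simple_sum :: "('a set \<Rightarrow> complex) \<Rightarrow> ('a \<Rightarrow> complex) \<Rightarrow> complex" where
  "simple_sum \<mu> s = (\<Sum>y\<in>range s - {0}. y * \<mu> (s -` {y}))"

text \<open>Dominated convergence along simple functions. Since the approximating sums involve only
  \<open>\<mu>\<close>, the limit is the same for every representation.\<close>

lemma radon_rep_simple_limit:
  assumes rep: "radon_rep \<mu> \<nu> h" and \<phi>: "\<phi> \<in> bounded_borel_fun"
    and s: "\<And>i. simple_function borel (s i)" and lim: "\<And>x. (\<lambda>i. s i x) \<longlonglongrightarrow> \<phi> x"
    and le: "\<And>i x. norm (s i x) \<le> 2 * norm (\<phi> x)"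
  shows "(\<lambda>i. simple_sum \<mu> (s i)) \<longlonglongrightarrow> (LINT x|\<nu>. \<phi> x * h x)"
proof -
  have fin: "finite (range (s i))" for i using simple_functionD(1)[OF s] by simp
  have sm [measurable]: "s i \<in> borel_measurable borel" for i
    using s by (rule borel_measurable_simple_function)
  obtain r where r: "r > 0" "\<And>x. norm x > r \<Longrightarrow> \<phi> x = 0" using bbf_support[OF \<phi>] by blast
  \<comment> \<open>The bound by \<open>2 * norm (\<phi> x)\<close> keeps the nonzero level sets
    inside the support of \<open>\<phi>\<close>.\<close>
  have bb: "s i -` {y} \<in> bborel" if "y \<noteq> 0" for i y
  proof (rule bborel_subset)
    have "norm x \<le> r" if "s i x = y" for x
      using that \<open>y \<noteq> 0\<close> le[of i x] r(2)[of x] by (cases "norm x \<le> r") auto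
    then show "s i -` {y} \<subseteq> cball 0 r" by auto
    show "s i -` {y} \<in> sets borel" using measurable_sets_borel[OF sm, of "{y}" i] by simp
  qed simp
  have s\<nu>: "sets \<nu> = sets borel" using rep by (simp add: radon_rep_def)
  have eq: "s i x * h x = (\<Sum>y\<in>range (s i) - {0}. y * (indicator (s i -` {y}) x *\<^sub>R h x))" for i x
  proof -
    have "(\<Sum>y\<in>range (s i) - {0}. y * (indicator (s i -` {y}) x *\<^sub>R h x))
        = (\<Sum>y\<in>range (s i) - {0}. if y = s i x then s i x * h x else 0)"
      by (intro sum.cong) auto
    also have "\<dots> = s i x * h x" using fin[of i] by (simp add: sum.delta)
    finally show ?thesis by simp
  qed
  have *: "integrable \<nu> (\<lambda>x. indicator (s i -` {y}) x *\<^sub>R h x)"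
      "(LINT x|\<nu>. indicator (s i -` {y}) x *\<^sub>R h x) = \<mu> (s i -` {y})" if "y \<noteq> 0" for i y
    using rep bb[OF that] unfolding radon_rep_def set_integrable_def set_lebesgue_integral_def by auto
  have "(LINT x|\<nu>. s i x * h x) = simple_sum \<mu> (s i)" for i
  proof -
    have "(LINT x|\<nu>. s i x * h x) = (\<Sum>y\<in>range (s i) - {0}. LINT x|\<nu>. y * (indicator (s i -` {y}) x *\<^sub>R h x))"
      unfolding eq using *(1) by (intro Bochner_Integration.integral_sum integrable_mult_right) auto
    also have "\<dots> = simple_sum \<mu> (s i)"
      unfolding simple_sum_def integral_mult_right_zero by (intro sum.cong refl arg_cong2[where f="(*)"] *(2)) blast
    finally show ?thesis .
  qed
  moreover have "(\<lambda>i. LINT x|\<nu>. s i x * h x) \<longlonglongrightarrow> (LINT x|\<nu>. \<phi> x * h x)"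
  proof (rule integral_dominated_convergence)
    show "integrable \<nu> (\<lambda>x. 2 * norm (\<phi> x * h x))"
      using radon_rep_integrable[OF rep \<phi>] by auto
    show "(\<lambda>x. \<phi> x * h x) \<in> borel_measurable \<nu>"
      using radon_rep_integrable[OF rep \<phi>] by auto
    show "(\<lambda>x. s i x * h x) \<in> borel_measurable \<nu>" for i
      unfolding eq using *(1) by (intro borel_measurable_sum borel_measurable_times) auto
    show "AE x in \<nu>. (\<lambda>i. s i x * h x) \<longlonglongrightarrow> \<phi> x * h x"
      using lim by (intro AE_I2 tendsto_mult) auto
    show "AE x in \<nu>. norm (s i x * h x) \<le> 2 * norm (\<phi> x * h x)" for i
      using mult_right_mono[OF le norm_ge_zero] by (intro AE_I2) (simp add: norm_mult mult.assoc)
  qed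
  ultimately show ?thesis by simp
qed

lemma simple_approx:
  assumes "\<phi> \<in> bounded_borel_fun"
  obtains s where "\<And>i::nat. simple_function borel (s i)" "\<And>x. (\<lambda>i. s i x) \<longlonglongrightarrow> \<phi> x"
    "\<And>i x. norm (s i x) \<le> 2 * norm (\<phi> x)"
  using borel_measurable_implies_sequence_metric[OF bbf_measurable[OF assms], of 0] by auto

text \<open>For uniqueness in the description, two representations give the limit of one and the
  same sequence of simple sums.\<close>

lemma cint_eq:
  assumes rep: "radon_rep \<mu> \<nu> h" and \<phi>: "\<phi> \<in> bounded_borel_fun"
  shows "cint \<mu> \<phi> = (LINT x|\<nu>. \<phi> x * h x)"
  unfolding cint_def
proof (rule the_equality)
  show "\<exists>\<nu>' h'. sets \<nu>' = sets borel \<and>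
      (\<forall>B\<in>bborel. emeasure \<nu>' B < \<infinity> \<and> set_integrable \<nu>' B h' \<and> \<mu> B = (LINT x:B|\<nu>'. h' x)) \<and>
      integrable \<nu>' (\<lambda>x. \<phi> x * h' x) \<and> (LINT x|\<nu>. \<phi> x * h x) = (LINT x|\<nu>'. \<phi> x * h' x)"
    using rep radon_rep_integrable[OF rep \<phi>] unfolding radon_rep_def by blast
next
  fix I assume "\<exists>\<nu>' h'. sets \<nu>' = sets borel \<and>
      (\<forall>B\<in>bborel. emeasure \<nu>' B < \<infinity> \<and> set_integrable \<nu>' B h' \<and> \<mu> B = (LINT x:B|\<nu>'. h' x)) \<and>
      integrable \<nu>' (\<lambda>x. \<phi> x * h' x) \<and> I = (LINT x|\<nu>'. \<phi> x * h' x)"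
  then obtain \<nu>' h' where rep': "radon_rep \<mu> \<nu>' h'" and I: "I = (LINT x|\<nu>'. \<phi> x * h' x)"
    unfolding radon_rep_def by blast
  obtain s where s: "\<And>i::nat. simple_function borel (s i)" "\<And>x. (\<lambda>i. s i x) \<longlonglongrightarrow> \<phi> x"
    "\<And>i x. norm (s i x) \<le> 2 * norm (\<phi> x)" using simple_approx[OF \<phi>] by blast
  show "I = (LINT x|\<nu>. \<phi> x * h x)"
    unfolding I using radon_rep_simple_limit[OF rep \<phi> s] radon_rep_simple_limit[OF rep' \<phi> s]
    by (rule LIMSEQ_unique[rotated])
qed

lemma cint_simple_limit:
  assumes \<mu>: "cradon \<mu>" and \<phi>: "\<phi> \<in> bounded_borel_fun"
    and s: "\<And>i. simple_function borel (s i)" "\<And>x. (\<lambda>i. s i x) \<longlonglongrightarrow> \<phi> x"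
      "\<And>i x. norm (s i x) \<le> 2 * norm (\<phi> x)"
  shows "(\<lambda>i. simple_sum \<mu> (s i)) \<longlonglongrightarrow> cint \<mu> \<phi>"
  using radon_rep_exists[OF \<mu>] radon_rep_simple_limit[OF _ \<phi> s] cint_eq[OF _ \<phi>] by metis

text \<open>Linearity is plain for simple sums and survives the limit; \<open>\<mu>\<close>,
  \<open>\<nu>\<close> and their combination may have unrelated representations.\<close>

lemma cint_lincomb_measure:
  assumes \<mu>: "cradon \<mu>" and \<nu>: "cradon \<nu>" and \<phi>: "\<phi> \<in> bounded_borel_fun"
  shows "cint (\<lambda>B. a * \<mu> B + b * \<nu> B) \<phi> = a * cint \<mu> \<phi> + b * cint \<nu> \<phi>"
proof -
  obtain s where s: "\<And>i::nat. simple_function borel (s i)" "\<And>x. (\<lambda>i. s i x) \<longlonglongrightarrow> \<phi> x"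
    "\<And>i x. norm (s i x) \<le> 2 * norm (\<phi> x)" using simple_approx[OF \<phi>] by blast
  have "simple_sum (\<lambda>B. a * \<mu> B + b * \<nu> B) (s i) = a * simple_sum \<mu> (s i) + b * simple_sum \<nu> (s i)" for i
    unfolding simple_sum_def sum_distrib_left sum.distrib[symmetric]
    by (intro sum.cong) (auto simp: algebra_simps)
  then have "(\<lambda>i. simple_sum (\<lambda>B. a * \<mu> B + b * \<nu> B) (s i)) \<longlonglongrightarrow> a * cint \<mu> \<phi> + b * cint \<nu> \<phi>"
    using cint_simple_limit[OF \<mu> \<phi> s] cint_simple_limit[OF \<nu> \<phi> s] by (auto intro!: tendsto_intros)
  then show ?thesis
    using cint_simple_limit[OF cradon_lincomb[OF \<mu> \<nu>] \<phi> s] LIMSEQ_unique by blast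
qed

text \<open>All level sets entering the simple sums lie where \<open>\<phi>\<close> is nonzero. This
  carries the locality of \<open>\<Psi>\<close> over to integrals.\<close>

lemma cint_cong:
  assumes \<mu>: "cradon \<mu>" and \<nu>: "cradon \<nu>" and \<phi>: "\<phi> \<in> bounded_borel_fun"
    and eq: "\<And>B. B \<in> bborel \<Longrightarrow> B \<subseteq> {x. \<phi> x \<noteq> 0} \<Longrightarrow> \<mu> B = \<nu> B"
  shows "cint \<mu> \<phi> = cint \<nu> \<phi>"
proof -
  obtain s where s: "\<And>i::nat. simple_function borel (s i)" "\<And>x. (\<lambda>i. s i x) \<longlonglongrightarrow> \<phi> x"
    "\<And>i x. norm (s i x) \<le> 2 * norm (\<phi> x)" using simple_approx[OF \<phi>] by blast
  have "simple_sum \<mu> (s i) = simple_sum \<nu> (s i)" for i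
    unfolding simple_sum_def
  proof (intro sum.cong refl arg_cong2[where f="(*)"] eq)
    fix y assume y: "y \<in> range (s i) - {0}"
    have "\<phi> x \<noteq> 0" if "s i x = y" for x using that y s(3)[of i x] by auto
    then show "s i -` {y} \<subseteq> {x. \<phi> x \<noteq> 0}" by blast
    moreover have "s i -` {y} \<in> sets borel"
      using measurable_sets_borel[OF borel_measurable_simple_function[OF s(1)], of "{y}" i] by simp
    ultimately show "s i -` {y} \<in> bborel"
      using \<phi> by (auto simp: bounded_borel_fun_def bborel_def intro: bounded_subset)
  qed
  then show ?thesis
    using cint_simple_limit[OF \<mu> \<phi> s] cint_simple_limit[OF \<nu> \<phi> s] LIMSEQ_unique by auto
qed

lemma cint_lincomb:
  assumes \<mu>: "cradon \<mu>" and \<phi>: "\<phi> \<in> bounded_borel_fun" and \<psi>: "\<psi> \<in> bounded_borel_fun"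
  shows "cint \<mu> (\<lambda>x. a * \<phi> x + b * \<psi> x) = a * cint \<mu> \<phi> + b * cint \<mu> \<psi>"
proof -
  obtain \<nu> h where rep: "radon_rep \<mu> \<nu> h" using radon_rep_exists[OF \<mu>] by blast
  have "(LINT x|\<nu>. (a * \<phi> x + b * \<psi> x) * h x) = (LINT x|\<nu>. a * (\<phi> x * h x) + b * (\<psi> x * h x))"
    by (simp add: algebra_simps)
  then show ?thesis
    using radon_rep_integrable[OF rep \<phi>] radon_rep_integrable[OF rep \<psi>]
    by (simp add: cint_eq[OF rep] \<phi> \<psi> bbf_lincomb)
qed

lemma cint_mult: "cradon \<mu> \<Longrightarrow> \<phi> \<in> bounded_borel_fun \<Longrightarrow> cint \<mu> (\<lambda>x. a * \<phi> x) = a * cint \<mu> \<phi>"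
  using cint_lincomb[of \<mu> \<phi> \<phi> a 0] by simp

lemma cint_indicator:
  assumes "cradon \<mu>" and "B \<in> bborel"
  shows "cint \<mu> (indicator B) = \<mu> B"
proof -
  obtain \<nu> h where rep: "radon_rep \<mu> \<nu> h" using radon_rep_exists[OF assms(1)] by blast
  have "\<mu> B = (LINT x|\<nu>. indicator B x *\<^sub>R h x)"
    using rep assms(2) unfolding radon_rep_def set_lebesgue_integral_def by blast
  also have "\<dots> = (LINT x|\<nu>. indicator B x * h x)"
    by (intro Bochner_Integration.integral_cong) (auto simp: indicator_def)
  finally show ?thesis using cint_eq[OF rep bbf_indicator[OF assms(2)]] by simp
qed

lemma cint_dominated_convergence:
  assumes \<mu>: "cradon \<mu>" and \<phi>: "\<phi> \<in> bounded_borel_fun" and s: "\<And>i::nat. s i \<in> bounded_borel_fun"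
    and lim: "\<And>x. (\<lambda>i. s i x) \<longlonglongrightarrow> \<phi> x"
    and K: "\<And>i x. norm (s i x) \<le> K" and B: "B \<in> bborel" "\<And>i x. x \<notin> B \<Longrightarrow> s i x = 0"
  shows "(\<lambda>i. cint \<mu> (s i)) \<longlonglongrightarrow> cint \<mu> \<phi>"
proof -
  obtain \<nu> h where rep: "radon_rep \<mu> \<nu> h" using radon_rep_exists[OF \<mu>] by blast
  have "(\<lambda>i. LINT x|\<nu>. s i x * h x) \<longlonglongrightarrow> (LINT x|\<nu>. \<phi> x * h x)"
  proof (rule integral_dominated_convergence)
    show "integrable \<nu> (\<lambda>x. K * norm (indicator B x *\<^sub>R h x))"
      using rep B(1) unfolding radon_rep_def set_integrable_def by (intro integrable_mult_right integrable_norm) blast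
    show "AE x in \<nu>. (\<lambda>i. s i x * h x) \<longlonglongrightarrow> \<phi> x * h x"
      using lim by (intro AE_I2 tendsto_mult) auto
    show "AE x in \<nu>. norm (s i x * h x) \<le> K * norm (indicator B x *\<^sub>R h x)" for i
      using K[of i] B(2)[of _ i] by (intro AE_I2) (auto simp: norm_mult indicator_def intro!: mult_right_mono)
    show "(\<lambda>x. \<phi> x * h x) \<in> borel_measurable \<nu>" "(\<lambda>x. s i x * h x) \<in> borel_measurable \<nu>" for i
      using radon_rep_integrable[OF rep \<phi>] radon_rep_integrable[OF rep s] by auto
  qed
  then show ?thesis using cint_eq[OF rep] \<phi> s by simp
qed

section \<open>Measures are determined by their integrals\<close>

lemma bborel_subset_cball:
  assumes "B \<in> bborel" obtains r where "r > 0" "B \<subseteq> cball 0 r"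
proof -
  obtain r where "r > 0" "\<And>x. x \<in> B \<Longrightarrow> norm x \<le> r"
    using bborel_bounded[OF assms] unfolding bounded_pos by blast
  then show thesis by (intro that[of r]) (auto simp: subset_iff)
qed

text \<open>Compact sets come first, their indicators being dominated limits of functions in
  \<open>Cc\<close>. Closed sets generate the Borel sets and are stable under intersection, so
  Dynkin's argument gives the rest.\<close>

lemma cradon_vanish:
  assumes \<mu>: "cradon \<mu>" and z: "\<And>\<phi>. \<phi> \<in> Cc \<Longrightarrow> cint \<mu> \<phi> = 0" and B: "B \<in> bborel"
  shows "\<mu> B = 0"
proof -
  have cpt: "\<mu> K = 0" if K: "compact K" for K
  proof (cases "K = {}")
    case False
    have Kb: "K \<in> bborel" using K by (auto simp: bborel_def compact_imp_bounded borel_compact)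
    \<comment> \<open>Tents over \<open>K\<close> of slope \<open>m + 1\<close>: 1 on
      \<open>K\<close>, 0 from distance 1 on, and decreasing to the indicator as \<open>m\<close>
      grows.\<close>
    define s where "s = (\<lambda>(m::nat) x. complex_of_real (max 0 (1 - real (Suc m) * infdist x K)))"
    have C: "compact {x. infdist x K \<le> 1}" using K by (intro compact_infdist_le) (auto simp: False)
    have out: "s m x = 0" if "infdist x K > 1" for m x
    proof -
      have "1 * 1 \<le> real (Suc m) * infdist x K" using that by (intro mult_mono) auto
      then show ?thesis by (auto simp: s_def)
    qed
    have Cc: "s m \<in> Cc" for m
    proof -
      have "{x. s m x \<noteq> 0} \<subseteq> {x. infdist x K \<le> 1}" using out[of _ m] by force
      moreover have "continuous_on UNIV (s m)" unfolding s_def by (intro continuous_intros)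
      ultimately show ?thesis using C compact_imp_bounded bounded_subset by (auto simp: Cc_def)
    qed
    have "(\<lambda>m. cint \<mu> (s m)) \<longlonglongrightarrow> cint \<mu> (indicator K)"
    proof (rule cint_dominated_convergence[OF \<mu>])
      show "indicator K \<in> bounded_borel_fun" by (rule bbf_indicator[OF Kb])
      show "s i \<in> bounded_borel_fun" for i by (rule bbf_Cc[OF Cc])
      show "norm (s i x) \<le> 1" for i x by (simp add: s_def infdist_nonneg del: of_nat_Suc)
      show "{x. infdist x K \<le> 1} \<in> bborel"
        using C by (auto simp: bborel_def compact_imp_bounded borel_compact)
      show "s i x = 0" if "x \<notin> {x. infdist x K \<le> 1}" for i x using that by (intro out) simp
      show "(\<lambda>i. s i x) \<longlonglongrightarrow> indicator K x" for x
      proof (cases "x \<in> K")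
        case True then show ?thesis by (simp add: s_def)
      next
        case False
        then have d: "infdist x K > 0"
          using K \<open>K \<noteq> {}\<close> compact_imp_closed infdist_pos_not_in_closed by blast
        obtain N :: nat where N: "real N * infdist x K > 1" using d ex_less_of_nat_mult by blast
        have "s i x = 0" if "i \<ge> N" for i
        proof -
          have "real N * infdist x K \<le> real (Suc i) * infdist x K"
            using that d by (intro mult_right_mono) auto
          then show ?thesis using N by (auto simp: s_def)
        qed
        then have "eventually (\<lambda>i. s i x = 0) sequentially" by (auto simp: eventually_sequentially)
        then show ?thesis using False by (auto intro: tendsto_eventually)
      qed
    qed
    then have "cint \<mu> (indicator K) = 0" using z[OF Cc] by (simp add: LIMSEQ_const_iff)
    then show ?thesis using cint_indicator[OF \<mu> Kb] by simp
  qed (use \<mu> in simp)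
  obtain r where r: "B \<subseteq> cball 0 r"
    using bborel_subset_cball[OF B] by blast
  have isc: "Int_stable (Collect closed)" and ss: "Collect closed \<subseteq> Pow UNIV" by (auto simp: Int_stable_def)
  \<comment> \<open>Intersecting with a fixed ball keeps all sets bounded; on unbounded sets
    \<open>\<mu>\<close> is 0 by convention and need not be additive.\<close>
  have "\<mu> (E \<inter> cball 0 r) = 0" if "E \<in> sigma_sets UNIV (Collect closed)" for E
    using isc ss that
  proof (induction rule: sigma_sets_induct_disjoint)
    case (basic A)
    then show ?case by (intro cpt) (auto intro: closed_Int_compact)
  next
    case (compl A)
    then have A: "A \<in> sets borel" by (simp add: borel_eq_closed)
    have "(UNIV - A) \<inter> cball 0 r = cball 0 r - (A \<inter> cball 0 r)" by auto
    moreover have "\<mu> (cball 0 r - (A \<inter> cball 0 r)) = \<mu> (cball 0 r) - \<mu> (A \<inter> cball 0 r)"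
      using A by (intro cradon_Diff[OF \<mu>]) (auto intro: bborel_subset[of _ "cball 0 r"])
    ultimately show ?case using compl cpt[of "cball 0 r"] by simp
  next
    case (union A)
    have A: "A i \<in> sets borel" for i using union by (auto simp: borel_eq_closed)
    have "(\<lambda>i. \<mu> (A i \<inter> cball 0 r)) sums \<mu> (\<Union>i. A i \<inter> cball 0 r)"
    proof (rule cradon_sums[OF \<mu>])
      show "A i \<inter> cball 0 r \<in> bborel" for i using A[of i] by (auto intro: bborel_subset[of _ "cball 0 r"])
      show "disjoint_family (\<lambda>i. A i \<inter> cball 0 r)" using union by (auto simp: disjoint_family_on_def)
      show "bounded (\<Union>i. A i \<inter> cball 0 r)" by (rule bounded_subset[of "cball 0 r"]) auto
    qed
    moreover have "(\<Union>i. A i \<inter> cball 0 r) = (\<Union>i. A i) \<inter> cball 0 r" by auto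
    ultimately show ?case using union.IH by (simp add: sums_iff)
  qed (use \<mu> in \<open>auto simp: Int_stable_def\<close>)
  moreover have "B \<in> sigma_sets UNIV (Collect closed)"
    using bborel_borel[OF B] by (subst (asm) borel_eq_closed) simp
  ultimately show ?thesis using r by (metis Int_absorb2)
qed

lemma cradon_eqI:
  assumes \<mu>: "cradon \<mu>" and \<nu>: "cradon \<nu>" and "\<And>\<phi>. \<phi> \<in> Cc \<Longrightarrow> cint \<mu> \<phi> = cint \<nu> \<phi>" and "B \<in> bborel"
  shows "\<mu> B = \<nu> B"
proof -
  have "1 * \<mu> B + (-1) * \<nu> B = 0"
  proof (rule cradon_vanish[where \<mu>="\<lambda>B. 1 * \<mu> B + (-1) * \<nu> B"])
    show "cint (\<lambda>B. 1 * \<mu> B + (-1) * \<nu> B) \<phi> = 0" if "\<phi> \<in> Cc" for \<phi>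
      using assms(3)[OF that] by (subst cint_lincomb_measure[OF \<mu> \<nu> bbf_Cc[OF that]]) simp
  qed (intro cradon_lincomb assms)+
  then show ?thesis by simp
qed

text \<open>The value 0 off \<open>bborel\<close> is the normalisation demanded by
  \<open>cradon\<close>.\<close>

definition density_measure :: "('a::euclidean_space \<Rightarrow> complex) \<Rightarrow> 'a set \<Rightarrow> complex" where
  "density_measure d B = (if B \<in> bborel then LINT x:B|lborel. d x else 0)"

lemma continuous_set_integrable:
  fixes d :: "'a::euclidean_space \<Rightarrow> 'b::euclidean_space"
  assumes d: "continuous_on UNIV d" and B: "B \<in> bborel"
  shows "set_integrable lborel B d"
proof -
  obtain r where r: "B \<subseteq> cball 0 r" using bborel_subset_cball[OF B] by blast
  have "set_integrable lborel (cball 0 r) d"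
    unfolding set_integrable_def using d
    by (intro borel_integrable_compact) (auto intro: continuous_on_subset)
  then show ?thesis using r B bborel_borel by (auto intro: set_integrable_subset)
qed

lemma radon_rep_density_measure:
  assumes "continuous_on UNIV d"
  shows "radon_rep (density_measure d) lborel d"
  unfolding radon_rep_def density_measure_def
  using continuous_set_integrable[OF assms] emeasure_bounded_finite bborel_bounded by auto

lemma cradon_density_measure:
  assumes d: "continuous_on UNIV d"
  shows "cradon (density_measure d)"
  unfolding cradon_def
proof (intro conjI allI impI)
  show "density_measure d B = 0" if "B \<notin> bborel" for B using that by (simp add: density_measure_def)
next
  fix A :: "nat \<Rightarrow> 'a set"
  assume A: "range A \<subseteq> bborel" and dj: "disjoint_family A" and b: "bounded (\<Union>i. A i)"
  have Ab: "A i \<in> bborel" for i using A by auto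
  have U: "(\<Union>i. A i) \<in> bborel"
    using b Ab bborel_borel by (intro bborelI) (auto intro!: sets.countable_UN)
  have Un: "(\<Union>i<n. A i) \<in> bborel" for n
    by (rule bborel_subset[OF _ _ U]) (use Ab bborel_borel in \<open>auto intro!: sets.countable_UN\<close>)
  have part: "(\<Sum>i<n. density_measure d (A i)) = (LINT x:(\<Union>i<n. A i)|lborel. d x)" for n
  proof (induction n)
    case (Suc n)
    have "A i \<inter> A n = {}" if "i < n" for i
      using disjoint_family_onD[OF dj, of i n] that by simp
    then have e: "(\<Union>i<n. A i) \<inter> A n = {}" by blast
    have u: "(\<Union>i<Suc n. A i) = (\<Union>i<n. A i) \<union> A n" by (auto simp: lessThan_Suc)
    show ?case unfolding u
      using Suc Ab e by (subst set_integral_Un)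
        (auto simp: density_measure_def intro!: continuous_set_integrable[OF d] Un)
  qed (simp add: set_lebesgue_integral_def)
  have "(\<lambda>n. LINT x:(\<Union>i<n. A i)|lborel. d x) \<longlonglongrightarrow> (LINT x:(\<Union>n. \<Union>i<n. A i)|lborel. d x)"
  proof (rule set_integral_cont_up)
    show "incseq (\<lambda>n. \<Union>i<n. A i)" by (fastforce simp: incseq_def)
    have "(\<Union>n. \<Union>i<n. A i) = (\<Union>i. A i)" by auto
    then show "set_integrable lborel (\<Union>n. \<Union>i<n. A i) d"
      using continuous_set_integrable[OF d U] by simp
  qed (use Un bborel_borel in auto)
  moreover have "(\<Union>n. \<Union>i<n. A i) = (\<Union>i. A i)" by auto
  ultimately show "(\<lambda>i. density_measure d (A i)) sums density_measure d (\<Union>i. A i)"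
    unfolding sums_def part using U by (simp add: density_measure_def)
qed

lemma cint_density_measure:
  assumes "continuous_on UNIV d" "\<phi> \<in> bounded_borel_fun"
  shows "cint (density_measure d) \<phi> = (LINT x|lborel. \<phi> x * d x)"
  by (rule cint_eq[OF radon_rep_density_measure[OF assms(1)] assms(2)])

section \<open>Translation invariant measures\<close>

lemma lborel_integral_indicator_translate:
  fixes c :: "'a::euclidean_space"
  assumes "E \<in> bborel"
  shows "integrable lborel (\<lambda>y. indicator E (y + c) :: complex)"
    and "(LINT y|lborel. indicator E (y + c) :: complex) = measure lborel E"
proof -
  have [measurable]: "E \<in> sets borel" using assms by (rule bborel_borel)
  have "integrable lborel (\<lambda>x. complex_of_real (indicator E x))"
    using emeasure_bounded_finite[OF bborel_bounded[OF assms]]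
    by (intro integrable_of_real integrable_real_indicator) auto
  moreover have "(\<lambda>x. complex_of_real (indicator E x)) = indicator E" by (auto simp: indicator_def fun_eq_iff)
  ultimately have i: "integrable lborel (indicator E :: 'a \<Rightarrow> complex)" by simp
  have d: "lborel = distr lborel borel (\<lambda>y. c + y)" using lborel_distr_plus[of c] by simp
  show "integrable lborel (\<lambda>y. indicator E (y + c) :: complex)"
    using i by (subst (asm) d) (simp add: integrable_distr_eq add.commute)
  have "(LINT y|lborel. indicator E y :: complex) = (LINT y|lborel. indicator E (y + c))"
    by (subst d) (simp add: integral_distr add.commute)
  moreover have "(LINT y|lborel. indicator E y :: complex) = (LINT y|lborel. complex_of_real (indicator E y))"
    by (intro Bochner_Integration.integral_cong) (auto simp: indicator_def)
  ultimately show "(LINT y|lborel. indicator E (y + c) :: complex) = measure lborel E"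
    unfolding integral_complex_of_real by simp
qed

text \<open>By Fubini the integral over \<open>y\<close> may be taken first; it is the volume of a
  translate of \<open>E\<close>, whatever \<open>x\<close> is.\<close>

lemma convolution_indicator_integral:
  fixes k :: "'a::euclidean_space \<Rightarrow> complex"
  assumes s: "sigma_finite_measure \<nu>" and sets: "sets \<nu> = sets borel"
    and k: "integrable \<nu> k" and E: "E \<in> bborel"
  shows "(LINT y|lborel. LINT x|\<nu>. k x * indicator E (y + s *\<^sub>R x)) = (LINT x|\<nu>. k x) * measure lborel E"
proof -
  interpret \<nu>: sigma_finite_measure \<nu> by (rule s)
  interpret pair_sigma_finite \<nu> lborel ..
  note [measurable_cong] = sets
  have [measurable]: "E \<in> sets borel" using E by (rule bborel_borel)
  have [measurable]: "k \<in> borel_measurable borel"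
    using k borel_measurable_integrable measurable_cong_sets[OF sets refl] by blast
  have nrm: "norm (indicator E z :: complex) = indicator E z" for z by (simp add: indicator_def)
  have "integrable (\<nu> \<Otimes>\<^sub>M lborel) (\<lambda>(x, y). k x * indicator E (y + s *\<^sub>R x))"
  proof (rule Fubini_integrable)
    show "(\<lambda>(x, y). k x * indicator E (y + s *\<^sub>R x)) \<in> borel_measurable (\<nu> \<Otimes>\<^sub>M lborel)"
      by measurable
    have "(LINT y|lborel. norm (k x * indicator E (y + s *\<^sub>R x))) = norm (k x) * measure lborel E" for x
    proof -
      have "complex_of_real (LINT y|lborel. indicator E (y + s *\<^sub>R x)) = (LINT y|lborel. complex_of_real (indicator E (y + s *\<^sub>R x)))"
        by (rule integral_complex_of_real[symmetric])
      also have "\<dots> = (LINT y|lborel. indicator E (y + s *\<^sub>R x))"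
        by (intro Bochner_Integration.integral_cong) (auto simp: indicator_def)
      finally have "(LINT y|lborel. indicator E (y + s *\<^sub>R x)) = measure lborel E"
        using lborel_integral_indicator_translate(2)[OF E] of_real_eq_iff by metis
      then show ?thesis by (simp add: norm_mult nrm)
    qed
    then show "integrable \<nu> (\<lambda>x. LINT y|lborel. norm (case (x, y) of (x, y) \<Rightarrow> k x * indicator E (y + s *\<^sub>R x)))"
      using k by simp
    show "AE x in \<nu>. integrable lborel (\<lambda>y. case (x, y) of (x, y) \<Rightarrow> k x * indicator E (y + s *\<^sub>R x))"
      using lborel_integral_indicator_translate(1)[OF E] by (intro AE_I2) simp
  qed
  from Fubini_integral[OF this] show ?thesis
    using lborel_integral_indicator_translate[OF E] by simp
qed

text \<open>The uniqueness argument for Haar measure. The pairs \<open>(x, y)\<close> with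
  \<open>x\<close> in \<open>B\<close> and \<open>y - x\<close> in a unit cube are measured by
  \<open>\<mu>\<close> in \<open>x\<close> and by volume in \<open>y\<close>, once directly and once
  after translating the sections in \<open>x\<close> by \<open>- y\<close>.\<close>

lemma translation_invariant_cradon:
  fixes \<mu> :: "'a::euclidean_space set \<Rightarrow> complex"
  assumes \<mu>: "cradon \<mu>" and inv: "\<And>B y. B \<in> bborel \<Longrightarrow> \<mu> ((\<lambda>z. z + y) ` B) = \<mu> B" and B: "B \<in> bborel"
  shows "\<mu> B = \<mu> (cbox (- One) 0) * measure lborel B"
proof -
  obtain \<nu> h where rep: "radon_rep \<mu> \<nu> h" using radon_rep_exists[OF \<mu>] by blast
  have s: "sets \<nu> = sets borel" and fin: "\<And>B. B \<in> bborel \<Longrightarrow> emeasure \<nu> B < \<infinity>"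
    using rep by (auto simp: radon_rep_def)
  have sf: "sigma_finite_measure \<nu>" by (rule sigma_finite_borel_measure[OF s fin])
  define k where "k = (\<lambda>A x. indicator A x *\<^sub>R h x)"
  have k: "integrable \<nu> (k A)" "(LINT x|\<nu>. k A x) = \<mu> A" if "A \<in> bborel" for A
    using rep that by (auto simp: radon_rep_def k_def set_integrable_def set_lebesgue_integral_def)
  define E where "E = cbox 0 (One::'a)"
  \<comment> \<open>The reflection of \<open>E\<close>: translating the sections turns the condition
    on \<open>y - x\<close> into one on its negative, which is why the constant is read off on
    \<open>cbox (- One) 0\<close>.\<close>
  define E' where "E' = cbox (- One) (0::'a)"
  have E: "E \<in> bborel" "E' \<in> bborel" by (auto simp: E_def E'_def bborel_def)
  have neg: "- z \<in> E \<longleftrightarrow> z \<in> E'" for z by (auto simp: E_def E'_def mem_box)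
  \<comment> \<open>For fixed \<open>y\<close> the two sides are \<open>\<mu>\<close> of the
    translate by \<open>y\<close> of the set \<open>A\<close> below and of \<open>A\<close>
    itself.\<close>
  have "(LINT x|\<nu>. k B x * indicator E (y + (-1) *\<^sub>R x)) = (LINT x|\<nu>. k E' x * indicator B (y + 1 *\<^sub>R x))" for y
  proof -
    define A where "A = {x \<in> E'. y + x \<in> B}"
    have Bm: "B \<in> sets borel" and Em: "E' \<in> sets borel" using B E by (auto dest: bborel_borel)
    have Ab: "A \<in> bborel"
    proof (rule bborel_subset[OF _ _ E(2)])
      have "A = E' \<inter> (\<lambda>x. y + x) -` B" by (auto simp: A_def)
      moreover have "(\<lambda>x. y + x) -` B \<in> sets borel" using measurable_sets_borel[OF _ Bm, of "\<lambda>x. y + x"] by simp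
      ultimately show "A \<in> sets borel" using Em by simp
    qed (use E in \<open>auto simp: A_def\<close>)
    have T: "(\<lambda>z. z + y) ` A = {x \<in> B. y - x \<in> E}"
    proof safe
      fix x assume x: "x \<in> B" "y - x \<in> E"
      then have "x - y \<in> A" using neg[of "x - y"] by (simp add: A_def)
      then show "x \<in> (\<lambda>z. z + y) ` A" by (intro image_eqI[of _ _ "x - y"]) auto
    next
      fix x assume x: "x \<in> A"
      then show "x + y \<in> B" by (simp add: A_def add.commute)
      have "y - (x + y) = - x" by simp
      with x show "y - (x + y) \<in> E" unfolding neg[symmetric] A_def by (metis (no_types, lifting) mem_Collect_eq neg)
    qed
    have TB: "(\<lambda>z. z + y) ` A \<in> bborel"
    proof (rule bborel_subset[OF _ _ B])
      have "{x \<in> B. y - x \<in> E} = B \<inter> (\<lambda>x. y - x) -` E" by auto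
      moreover have "(\<lambda>x. y - x) -` E \<in> sets borel"
        using measurable_sets_borel[of "\<lambda>x. y - x" borel E] E bborel_borel by simp
      ultimately show "(\<lambda>z. z + y) ` A \<in> sets borel" using Bm T by simp
    qed (use T in auto)
    have "(LINT x|\<nu>. k B x * indicator E (y + (-1) *\<^sub>R x)) = (LINT x|\<nu>. k ((\<lambda>z. z + y) ` A) x)"
      unfolding T k_def by (intro Bochner_Integration.integral_cong) (auto simp: indicator_def)
    also have "\<dots> = \<mu> A" using k(2)[OF TB] inv[OF Ab] by simp
    also have "\<dots> = (LINT x|\<nu>. k A x)" using k(2)[OF Ab] by simp
    also have "\<dots> = (LINT x|\<nu>. k E' x * indicator B (y + 1 *\<^sub>R x))"
      unfolding A_def k_def by (intro Bochner_Integration.integral_cong) (auto simp: indicator_def)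
    finally show ?thesis .
  qed
  then have "(LINT x|\<nu>. k B x) * measure lborel E = (LINT x|\<nu>. k E' x) * measure lborel B"
    using convolution_indicator_integral[OF sf s k(1)[OF B] E(1), of "-1"]
      convolution_indicator_integral[OF sf s k(1)[OF E(2)] B, of 1] by simp
  moreover have "measure lborel E = 1" by (simp add: E_def)
  ultimately show ?thesis using k(2) B E by (simp add: E'_def)
qed

section \<open>Adding a ridge function\<close>

lemma Conv_limit:
  assumes f: "\<And>i::nat. f i \<in> Conv" and lim: "\<And>x. (\<lambda>i. f i x) \<longlonglongrightarrow> g x"
  shows "g \<in> Conv"
  unfolding Conv_def mem_Collect_eq
proof (rule convex_onI)
  fix t x y assume t: "(0::real) < t" "t < 1"
  show "g ((1 - t) *\<^sub>R x + t *\<^sub>R y) \<le> (1 - t) * g x + t * g y"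
  proof (rule LIMSEQ_le[OF lim])
    show "(\<lambda>i. (1 - t) * f i x + t * f i y) \<longlonglongrightarrow> (1 - t) * g x + t * g y"
      by (intro tendsto_intros lim)
    show "\<exists>N. \<forall>i\<ge>N. f i ((1 - t) *\<^sub>R x + t *\<^sub>R y) \<le> (1 - t) * f i x + t * f i y"
      using f t by (intro exI[of _ 0]) (auto simp: Conv_def convex_on_def)
  qed
qed auto

lemma Conv_add: "f \<in> Conv \<Longrightarrow> g \<in> Conv \<Longrightarrow> (\<lambda>x. f x + g x) \<in> Conv"
  by (simp add: Conv_def convex_on_add)

lemma Conv_cmult: "f \<in> Conv \<Longrightarrow> 0 \<le> c \<Longrightarrow> (\<lambda>x. c * f x) \<in> Conv"
  by (simp add: Conv_def convex_on_cmul)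

lemma Conv_const: "(\<lambda>x. c) \<in> Conv"
  by (auto simp: Conv_def convex_on_def simp flip: distrib_right)

lemma Conv_sum: "finite I \<Longrightarrow> (\<And>i. i \<in> I \<Longrightarrow> f i \<in> Conv) \<Longrightarrow> (\<lambda>x. \<Sum>i\<in>I. f i x) \<in> Conv"
  by (induction I rule: finite_induct) (auto intro: Conv_add Conv_const)

lemma Conv_ridge:
  assumes "convex_on UNIV g" shows "(\<lambda>x. g (e \<bullet> x)) \<in> Conv"
  unfolding Conv_def mem_Collect_eq
proof (rule convex_onI)
  fix t x y assume "(0::real) < t" "t < 1"
  then show "g (e \<bullet> ((1 - t) *\<^sub>R x + t *\<^sub>R y)) \<le> (1 - t) * g (e \<bullet> x) + t * g (e \<bullet> y)"
    using assms by (simp add: inner_add_right convex_on_def)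
qed auto

lemma convex_hinge: "convex_on UNIV (\<lambda>u. max 0 (u - s :: real))"
proof (rule convex_onI)
  fix t x y :: real assume t: "0 < t" "t < 1"
  have "(1 - t) * (x - s) \<le> (1 - t) * max 0 (x - s)" "t * (y - s) \<le> t * max 0 (y - s)"
    using t by (auto intro!: mult_left_mono)
  moreover have "0 \<le> (1 - t) * max 0 (x - s)" "0 \<le> t * max 0 (y - s)" using t by auto
  moreover have "((1 - t) *\<^sub>R x + t *\<^sub>R y) - s = (1 - t) * (x - s) + t * (y - s)" by (simp add: algebra_simps)
  ultimately show "max 0 (((1 - t) *\<^sub>R x + t *\<^sub>R y) - s) \<le> (1 - t) * max 0 (x - s) + t * max 0 (y - s)"
    by linarith
qed auto

definition hinge :: "'a::euclidean_space \<Rightarrow> real \<Rightarrow> 'a \<Rightarrow> real" where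
  "hinge e s x = max 0 (e \<bullet> x - s)"

lemma Conv_hinge: "hinge e s \<in> Conv"
  using Conv_ridge[OF convex_hinge, of e s] by (simp add: hinge_def[abs_def])

lemma loc_unif_conv_scale:
  assumes g: "continuous_on UNIV g" and c: "c \<longlonglongrightarrow> c'"
  shows "loc_unif_conv (\<lambda>i x. h x + c i * g x) (\<lambda>x. h x + c' * (g x :: real))"
  unfolding loc_unif_conv_def
proof (intro allI impI uniform_limitI)
  fix K :: "'a set" and \<epsilon> :: real assume K: "compact K" and \<epsilon>: "\<epsilon> > 0"
  have "compact (g ` K)" using K g by (auto intro: compact_continuous_image continuous_on_subset)
  then obtain B where B: "B > 0" "\<And>x. x \<in> K \<Longrightarrow> \<bar>g x\<bar> \<le> B"
    using compact_imp_bounded[of "g ` K"] unfolding bounded_pos by auto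
  have "\<forall>\<^sub>F i in sequentially. dist (c i) c' < \<epsilon> / B"
    using c \<epsilon> B by (simp add: tendsto_iff)
  then show "\<forall>\<^sub>F i in sequentially. \<forall>x\<in>K. dist (h x + c i * g x) (h x + c' * g x) < \<epsilon>"
  proof eventually_elim
    case (elim i)
    show ?case
    proof
      fix x assume x: "x \<in> K"
      have "dist (h x + c i * g x) (h x + c' * g x) = \<bar>c i - c'\<bar> * \<bar>g x\<bar>"
        by (simp add: dist_real_def abs_mult[symmetric] algebra_simps)
      also have "\<dots> \<le> \<bar>c i - c'\<bar> * B" using B(2)[OF x] by (intro mult_left_mono) auto
      also have "\<dots> < \<epsilon>" using elim B(1) by (simp add: dist_real_def pos_less_divide_eq)
      finally show "dist (h x + c i * g x) (h x + c' * g x) < \<epsilon>" .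
    qed
  qed
qed

text \<open>Cauchy's functional equation: additivity settles rational arguments, and rounding
  \<open>(n + 1) * a\<close> down gives fractions that approach \<open>a\<close> inside the half
  line.\<close>

lemma additive_continuous_halfline:
  fixes w :: "real \<Rightarrow> complex"
  assumes add: "\<And>a b. 0 \<le> a \<Longrightarrow> 0 \<le> b \<Longrightarrow> w (a + b) = w a + w b"
    and cont: "\<And>s a. (\<And>i::nat. 0 \<le> s i) \<Longrightarrow> 0 \<le> a \<Longrightarrow> s \<longlonglongrightarrow> a \<Longrightarrow> (\<lambda>i. w (s i)) \<longlonglongrightarrow> w a"
    and a: "0 \<le> a"
  shows "w a = complex_of_real a * w 1"
proof -
  have w0: "w 0 = 0" using add[of 0 0] by simp
  have mult: "w (real m * x) = of_nat m * w x" if "0 \<le> x" for m x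
  proof (induction m)
    case (Suc m)
    have "w (real (Suc m) * x) = w (real m * x + x)" by (simp add: algebra_simps)
    also have "\<dots> = w (real m * x) + w x" using that by (intro add) auto
    finally show ?case using Suc by (simp add: algebra_simps)
  qed (simp add: w0)
  have rat: "w (real m / real (Suc n)) = complex_of_real (real m / real (Suc n)) * w 1" for m n
  proof -
    have "w 1 = of_nat (Suc n) * w (1 / real (Suc n))"
      using mult[of "1 / real (Suc n)" "Suc n"] by (simp del: of_nat_Suc)
    then have "w (1 / real (Suc n)) = w 1 / of_nat (Suc n)" by (simp del: of_nat_Suc)
    then show ?thesis using mult[of "1 / real (Suc n)" m] by (simp del: of_nat_Suc)
  qed
  define m where "m = (\<lambda>n. nat \<lfloor>real (Suc n) * a\<rfloor>)"
  define s where "s = (\<lambda>n. real (m n) / real (Suc n))"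
  have m: "real (m n) \<le> real (Suc n) * a" "real (Suc n) * a - 1 \<le> real (m n)" for n
  proof -
    have "0 \<le> real (Suc n) * a" using a by simp
    then show "real (m n) \<le> real (Suc n) * a" "real (Suc n) * a - 1 \<le> real (m n)"
      unfolding m_def by linarith+
  qed
  have lim: "s \<longlonglongrightarrow> a"
  proof (rule tendsto_sandwich)
    have "a - 1 / real (Suc n) \<le> s n" for n
    proof -
      have "(real (Suc n) * a - 1) / real (Suc n) \<le> s n"
        unfolding s_def by (intro divide_right_mono m) simp
      then show ?thesis by (simp add: diff_divide_distrib del: of_nat_Suc)
    qed
    then show "\<forall>\<^sub>F n in sequentially. a - 1 / real (Suc n) \<le> s n" by simp
    have "s n \<le> a" for n
      unfolding s_def using m(1)[of n] by (simp add: divide_le_eq mult.commute del: of_nat_Suc)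
    then show "\<forall>\<^sub>F n in sequentially. s n \<le> a" by simp
    have "(\<lambda>n. a - inverse (real (Suc n))) \<longlonglongrightarrow> a - 0"
      by (intro tendsto_diff tendsto_const LIMSEQ_inverse_real_of_nat)
    then show "(\<lambda>n. a - 1 / real (Suc n)) \<longlonglongrightarrow> a" by (simp add: inverse_eq_divide)
  qed simp
  have "(\<lambda>n. w (s n)) \<longlonglongrightarrow> w a" by (rule cont[OF _ a lim]) (simp add: s_def)
  moreover have "w (s n) = complex_of_real (s n) * w 1" for n
    unfolding s_def by (rule rat)
  moreover have "(\<lambda>n. complex_of_real (s n) * w 1) \<longlonglongrightarrow> complex_of_real a * w 1"
    by (intro tendsto_intros lim)
  ultimately show ?thesis using LIMSEQ_unique by auto
qed

section \<open>Ridge functions as superpositions of hinges\<close>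

lemma riemann_sum_error:
  fixes F :: "real \<Rightarrow> real"
  assumes F: "continuous_on {a..b} F" and ab: "a \<le> b" and N: "N > 0"
    and osc: "\<And>s t. s \<in> {a..b} \<Longrightarrow> t \<in> {a..b} \<Longrightarrow> \<bar>s - t\<bar> \<le> (b - a) / real N \<Longrightarrow> \<bar>F s - F t\<bar> \<le> \<epsilon>"
  shows "\<bar>integral {a..b} F - (\<Sum>i<N. (b - a) / real N * F (a + real i * ((b - a) / real N)))\<bar> \<le> (b - a) * \<epsilon>"
proof -
  define \<delta> where "\<delta> = (b - a) / real N"
  have \<delta>: "\<delta> \<ge> 0" "real N * \<delta> = b - a" using ab N by (auto simp: \<delta>_def)
  have le: "a + real j * \<delta> \<le> b" if "j \<le> N" for j
  proof -
    have "real j * \<delta> \<le> real N * \<delta>" using that \<delta>(1) by (intro mult_right_mono) auto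
    then show ?thesis using \<delta> by simp
  qed
  have ge: "a \<le> a + real j * \<delta>" for j using \<delta> by simp
  have "\<bar>integral {a..a + real j * \<delta>} F - (\<Sum>i<j. \<delta> * F (a + real i * \<delta>))\<bar> \<le> real j * \<delta> * \<epsilon>" if "j \<le> N" for j
    using that
  proof (induction j)
    case (Suc j)
    define p where "p = a + real j * \<delta>"
    have p: "a \<le> p" "p + \<delta> \<le> b" "a + real (Suc j) * \<delta> = p + \<delta>"
      using le[OF Suc.prems] ge[of j] by (auto simp: p_def algebra_simps)
    have c: "continuous_on {p..p + \<delta>} F" "continuous_on {a..p + \<delta>} F"
      using F p \<delta> by (auto intro: continuous_on_subset)
    have "integral {a..p} F + integral {p..p + \<delta>} F = integral {a..p + \<delta>} F"
      using p \<delta> c(2) by (intro Henstock_Kurzweil_Integration.integral_combine integrable_continuous_interval) auto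
    moreover have "\<bar>integral {p..p + \<delta>} F - \<delta> * F p\<bar> \<le> \<delta> * \<epsilon>"
    proof -
      have "integral {p..p + \<delta>} (\<lambda>t. F t - F p) = integral {p..p + \<delta>} F - integral {p..p + \<delta>} (\<lambda>t. F p)"
        using c(1) by (intro Henstock_Kurzweil_Integration.integral_diff integrable_continuous_interval) auto
      then have "integral {p..p + \<delta>} F - \<delta> * F p = integral {p..p + \<delta>} (\<lambda>t. F t - F p)"
        using \<delta> by simp
      moreover have "norm (integral {p..p + \<delta>} (\<lambda>t. F t - F p)) \<le> \<epsilon> * (p + \<delta> - p)"
      proof (rule integral_bound)
        show "continuous_on {p..p + \<delta>} (\<lambda>t. F t - F p)" using c(1) by (intro continuous_intros)
        show "norm (F t - F p) \<le> \<epsilon>" if "t \<in> {p..p + \<delta>}" for t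
          using that p \<delta> by (auto intro!: osc simp: \<delta>_def[symmetric])
      qed (use \<delta> in simp)
      ultimately show ?thesis by (simp add: mult.commute)
    qed
    moreover have "\<bar>integral {a..p} F - (\<Sum>i<j. \<delta> * F (a + real i * \<delta>))\<bar> \<le> real j * \<delta> * \<epsilon>"
      using Suc by (simp add: p_def)
    moreover have "real (Suc j) * \<delta> * \<epsilon> = real j * \<delta> * \<epsilon> + \<delta> * \<epsilon>" by (simp add: algebra_simps)
    ultimately show ?case
      unfolding p(3) sum.lessThan_Suc p_def[symmetric] by linarith
  qed simp
  from this[of N] show ?thesis using \<delta> by (simp add: \<delta>_def[symmetric])
qed

text \<open>The left endpoint Riemann sum of \<open>hinge_int M d u\<close> with step
  \<open>2 * M / N\<close>. As a function of \<open>u\<close> it is a finite combination of hinges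
  with knots between \<open>- M\<close> and \<open>M\<close>.\<close>

definition hinge_sum :: "real \<Rightarrow> (real \<Rightarrow> real) \<Rightarrow> nat \<Rightarrow> real \<Rightarrow> real" where
  "hinge_sum M d N u = (\<Sum>i<N. (2 * M / real N) * d (- M + real i * (2 * M / real N)) *
     max 0 (u - (- M + real i * (2 * M / real N))))"

definition hinge_int :: "real \<Rightarrow> (real \<Rightarrow> real) \<Rightarrow> real \<Rightarrow> real" where
  "hinge_int M d u = integral {-M..M} (\<lambda>t. d t * max 0 (u - t))"

text \<open>The integrand is uniformly continuous in \<open>(u, t)\<close> on a compact rectangle,
  so the mesh can be chosen for all \<open>u\<close> at once. The index \<open>Suc N\<close> keeps
  the number of intervals positive.\<close>

lemma hinge_sum_uniform:
  assumes d: "continuous_on UNIV d" and M: "M > 0"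
  shows "uniform_limit {-L..L} (\<lambda>N. hinge_sum M d (Suc N)) (hinge_int M d) sequentially"
proof (rule uniform_limitI)
  fix \<epsilon> :: real assume \<epsilon>: "\<epsilon> > 0"
  define F where "F = (\<lambda>(u, t). d t * max 0 (u - t))"
  have "continuous_on ({-L..L} \<times> {-M..M}) F" unfolding F_def case_prod_beta
    by (intro continuous_intros continuous_on_compose2[OF d]) auto
  then have "uniformly_continuous_on ({-L..L} \<times> {-M..M}) F"
    by (intro compact_uniformly_continuous compact_Times compact_Icc)
  \<comment> \<open>On an interval of length \<open>2 * M\<close> this oscillation produces an error
    of \<open>\<epsilon> / 2\<close>.\<close>
  moreover have e: "\<epsilon> / (4 * M) > 0" using \<epsilon> M by simp
  ultimately obtain \<delta> where \<delta>: "\<delta> > 0" and uc: "\<And>z z'. z \<in> {-L..L} \<times> {-M..M} \<Longrightarrow> z' \<in> {-L..L} \<times> {-M..M} \<Longrightarrow>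
      dist z' z < \<delta> \<Longrightarrow> dist (F z') (F z) < \<epsilon> / (4 * M)"
    unfolding uniformly_continuous_on_def by metis
  obtain N0 where N0: "2 * M / \<delta> < real N0" using reals_Archimedean2 by blast
  show "\<forall>\<^sub>F N in sequentially. \<forall>u\<in>{-L..L}. dist (hinge_sum M d (Suc N) u) (hinge_int M d u) < \<epsilon>"
  proof (rule eventually_sequentiallyI[of N0], rule ballI)
    fix N u assume N: "N0 \<le> N" and u: "u \<in> {-L..L}"
    have "2 * M / \<delta> < real (Suc N)" using N N0 by simp
    then have small: "2 * M / real (Suc N) < \<delta>" using \<delta> by (simp add: field_simps del: of_nat_Suc)
    have "\<bar>integral {-M..M} (\<lambda>t. d t * max 0 (u - t)) -
        (\<Sum>i<Suc N. (M - (-M)) / real (Suc N) * (\<lambda>t. d t * max 0 (u - t)) (- M + real i * ((M - (-M)) / real (Suc N))))\<bar>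
        \<le> (M - (- M)) * (\<epsilon> / (4 * M))"
    proof (rule riemann_sum_error)
      show "continuous_on {- M..M} (\<lambda>t. d t * max 0 (u - t))"
        by (intro continuous_intros continuous_on_compose2[OF d]) auto
      fix s t assume st: "s \<in> {-M..M}" "t \<in> {-M..M}" "\<bar>s - t\<bar> \<le> (M - - M) / real (Suc N)"
      have "dist (u, s) (u, t) < \<delta>" using st(3) small by (simp add: dist_Pair_Pair dist_real_def)
      then show "\<bar>d s * max 0 (u - s) - d t * max 0 (u - t)\<bar> \<le> \<epsilon> / (4 * M)"
        using uc[of "(u, t)" "(u, s)"] u st by (simp add: F_def dist_real_def)
    qed (use M in auto)
    also have "(M - (- M)) * (\<epsilon> / (4 * M)) < \<epsilon>" using M \<epsilon> by (simp add: field_simps)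
    finally show "dist (hinge_sum M d (Suc N) u) (hinge_int M d u) < \<epsilon>"
      by (simp add: hinge_sum_def hinge_int_def dist_real_def abs_minus_commute mult.assoc del: of_nat_Suc sum.lessThan_Suc)
  qed
qed

text \<open>Taylor's formula at \<open>- M\<close> with integral remainder. On the interval
  \<open>g\<close> and \<open>hinge_int M d\<close> differ by an affine function, which
  \<open>\<Psi>\<close> does not see.\<close>

lemma hinge_int_eq:
  assumes g: "\<And>t. (g has_real_derivative g' t) (at t)" and g': "\<And>t. (g' has_real_derivative d t) (at t)"
    and u: "u \<in> {-M..M}"
  shows "hinge_int M d u = g u - g (- M) - g' (- M) * (u + M)"
proof -
  have "((\<lambda>t. d t * (u - t)) has_integral ((g u + g' u * (u - u)) - (g (-M) + g' (-M) * (u - (-M))))) {-M..u}"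
  proof (rule fundamental_theorem_of_calculus)
    fix t
    have "((\<lambda>t. g t + g' t * (u - t)) has_real_derivative d t * (u - t)) (at t)"
      by (auto intro!: derivative_eq_intros g g')
    then show "((\<lambda>t. g t + g' t * (u - t)) has_vector_derivative d t * (u - t)) (at t within {-M..u})"
      by (simp add: has_real_derivative_iff_has_vector_derivative has_vector_derivative_at_within)
  qed (use u in simp)
  then have "((\<lambda>t. d t * max 0 (u - t)) has_integral (g u - g (-M) - g' (-M) * (u + M))) {-M..u}"
    by (rule has_integral_eq_rhs[OF has_integral_eq[rotated]]) auto
  moreover have "((\<lambda>t. d t * max 0 (u - t)) has_integral 0) {u..M}"
    by (rule has_integral_eq[OF _ has_integral_0]) auto
  ultimately have "((\<lambda>t. d t * max 0 (u - t)) has_integral (g u - g (-M) - g' (-M) * (u + M)) + 0) {-M..M}"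
    using u by (intro has_integral_combine) auto
  then show ?thesis unfolding hinge_int_def by (simp add: integral_unique)
qed

lemma convex_hinge_sum:
  assumes "\<And>t. 0 \<le> d t" "0 \<le> M" shows "convex_on UNIV (hinge_sum M d N)"
proof -
  have "(\<lambda>u. \<Sum>i\<in>{..<N}. (2 * M / real N) * d (- M + real i * (2 * M / real N)) *
     max 0 (u - (- M + real i * (2 * M / real N)))) \<in> Conv"
    using assms convex_hinge by (intro Conv_sum Conv_cmult) (auto simp: Conv_def)
  then show ?thesis by (simp add: Conv_def hinge_sum_def[abs_def])
qed

lemma convex_hinge_int:
  assumes d: "continuous_on UNIV d" "\<And>t. 0 \<le> d t" and M: "M > 0"
  shows "convex_on UNIV (hinge_int M d)"
proof -
  have "hinge_int M d \<in> Conv"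
  proof (rule Conv_limit)
    show "hinge_sum M d (Suc i) \<in> Conv" for i using convex_hinge_sum d M by (simp add: Conv_def)
    fix u :: real
    have "u \<in> {-\<bar>u\<bar>..\<bar>u\<bar>}" using abs_ge_self[of u] abs_ge_minus_self[of u] by simp
    from tendsto_uniform_limitI[OF hinge_sum_uniform[OF d(1) M] this]
    show "(\<lambda>i. hinge_sum M d (Suc i) u) \<longlonglongrightarrow> hinge_int M d u" .
  qed
  then show ?thesis by (simp add: Conv_def)
qed

lemma loc_unif_conv_ridge:
  assumes u: "\<And>L. uniform_limit {-L..L} s g sequentially"
  shows "loc_unif_conv (\<lambda>i x. h x + s i (e \<bullet> x)) (\<lambda>x. h x + g (e \<bullet> x :: real))"
  unfolding loc_unif_conv_def
proof (intro allI impI uniform_limitI)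
  fix K :: "'a set" and \<epsilon> :: real assume K: "compact K" and \<epsilon>: "\<epsilon> > 0"
  obtain B where B: "\<And>x. x \<in> K \<Longrightarrow> norm x \<le> B" using compact_imp_bounded[OF K] unfolding bounded_iff by blast
  have in_L: "e \<bullet> x \<in> {-(norm e * B)..norm e * B}" if "x \<in> K" for x
    using Cauchy_Schwarz_ineq2[of e x] mult_left_mono[OF B[OF that], of "norm e"] by auto
  have "\<forall>\<^sub>F i in sequentially. \<forall>v\<in>{-(norm e * B)..norm e * B}. dist (s i v) (g v) < \<epsilon>"
    using u \<epsilon> by (simp add: uniform_limit_iff)
  then show "\<forall>\<^sub>F i in sequentially. \<forall>x\<in>K. dist (h x + s i (e \<bullet> x)) (h x + g (e \<bullet> x)) < \<epsilon>"
    by (rule eventually_mono) (use in_L in \<open>auto simp: dist_real_def\<close>)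
qed

lemma cradon_ext:
  assumes "cradon \<mu>" "cradon \<nu>" "\<And>B. B \<in> bborel \<Longrightarrow> \<mu> B = \<nu> B"
  shows "\<mu> = \<nu>"
proof
  fix B show "\<mu> B = \<nu> B"
    using assms unfolding cradon_def by (cases "B \<in> bborel") auto
qed

lemma Conv_affine: "(\<lambda>x. a \<bullet> x + b) \<in> Conv"
  unfolding Conv_def mem_Collect_eq
  by (rule convex_onI) (auto simp: inner_add_right algebra_simps)

section \<open>Hinge contributions of the valuation\<close>

locale ma_valuation =
  fixes k :: nat and \<Psi> :: "('a::euclidean_space \<Rightarrow> real) \<Rightarrow> 'a set \<Rightarrow> complex"
  assumes MA: "MAVal k \<Psi>"
begin

lemmas MA_conj = MA[unfolded MAVal_def]

lemma cradon_val [simp]: "f \<in> Conv \<Longrightarrow> cradon (\<Psi> f)"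
  by (rule MA_conj[THEN conjunct1, rule_format])

lemma valuation:
  assumes "f \<in> Conv" "h \<in> Conv" "(\<lambda>x. min (f x) (h x)) \<in> Conv" "(\<lambda>x. max (f x) (h x)) \<in> Conv"
  shows "\<Psi> (\<lambda>x. max (f x) (h x)) B + \<Psi> (\<lambda>x. min (f x) (h x)) B = \<Psi> f B + \<Psi> h B"
proof (cases "B \<in> bborel")
  case True then show ?thesis
    using MA_conj[THEN conjunct2, THEN conjunct1, rule_format, OF assms(1,2,3)] by blast
next
  case False then show ?thesis using assms cradon_val unfolding cradon_def by simp
qed

lemma val_continuous:
  "(\<And>j. fs j \<in> Conv) \<Longrightarrow> f \<in> Conv \<Longrightarrow> loc_unif_conv fs f \<Longrightarrow> \<phi> \<in> Cc \<Longrightarrow>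
   (\<lambda>j. cint (\<Psi> (fs j)) \<phi>) \<longlonglongrightarrow> cint (\<Psi> f) \<phi>"
  by (rule MA_conj[THEN conjunct2, THEN conjunct2, THEN conjunct1, unfolded weak_star_conv_def, rule_format])

lemma val_affine:
  assumes f: "f \<in> Conv" and g: "\<And>x. g x = f x + (a \<bullet> x + b)"
  shows "\<Psi> g = \<Psi> f"
proof -
  have "g \<in> Conv" using Conv_add[OF f Conv_affine, of a b] g by presburger
  moreover have "g = (\<lambda>x. f x + (a \<bullet> x + b))" using g by blast
  ultimately show ?thesis
    using f by (intro cradon_ext cradon_val) (auto intro: MA_conj[THEN conjunct2, THEN conjunct2, THEN conjunct2, THEN conjunct1, rule_format])
qed

text \<open>Locality joined with affine invariance. In this form it applies to hinges, which are
  affine on either side of their hyperplane, and to ridges compared with hinge integrals on a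
  slab.\<close>

lemma val_local:
  assumes f: "f \<in> Conv" and g: "g \<in> Conv" and U: "open U" and eq: "\<And>x. x \<in> U \<Longrightarrow> g x = f x + (a \<bullet> x + b)"
    and B: "B \<in> bborel" "B \<subseteq> U"
  shows "\<Psi> g B = \<Psi> f B"
proof -
  define f' where "f' = (\<lambda>x. f x + (a \<bullet> x + b))"
  have "f' \<in> Conv" unfolding f'_def by (rule Conv_add[OF f Conv_affine])
  moreover have "\<forall>x\<in>U. g x = f' x" using eq by (simp add: f'_def)
  ultimately have "\<Psi> g B = \<Psi> f' B"
    using MA_conj[THEN conjunct2, THEN conjunct2, THEN conjunct2, THEN conjunct2, THEN conjunct1] g U B by blast
  also have "\<Psi> f' = \<Psi> f" by (rule val_affine[OF f]) (simp add: f'_def)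
  finally show ?thesis .
qed

lemma cint_local:
  assumes f: "f \<in> Conv" and g: "g \<in> Conv" and U: "open U" and eq: "\<And>x. x \<in> U \<Longrightarrow> g x = f x + (a \<bullet> x + b)"
    and \<phi>: "\<phi> \<in> bounded_borel_fun" "{x. \<phi> x \<noteq> 0} \<subseteq> U"
  shows "cint (\<Psi> g) \<phi> = cint (\<Psi> f) \<phi>"
  using \<phi> by (intro cint_cong cradon_val f g val_local[OF f g U eq]) auto

text \<open>For \<open>r \<le> s\<close> the first hinge may be reflected at the cost of an affine
  function. The two hinges then have disjoint supports, so that \<open>h\<close> with both hinges
  and \<open>h\<close> itself are the maximum and the minimum of \<open>h\<close> with one hinge
  each, and the valuation property applies.\<close>

lemma hinge_pair:
  assumes h: "h \<in> Conv" and ab: "0 \<le> a" "0 \<le> b"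
  shows "\<Psi> (\<lambda>x. h x + a * hinge e r x + b * hinge e s x) B + \<Psi> h B
    = \<Psi> (\<lambda>x. h x + a * hinge e r x) B + \<Psi> (\<lambda>x. h x + b * hinge e s x) B"
proof -
  have main: "\<Psi> (\<lambda>x. h x + a * hinge e r x + b * hinge e s x) B + \<Psi> h B
    = \<Psi> (\<lambda>x. h x + a * hinge e r x) B + \<Psi> (\<lambda>x. h x + b * hinge e s x) B"
    if rs: "r \<le> s" and ab: "0 \<le> a" "0 \<le> b" for a b r s
  proof -
    have neg: "hinge e r x = hinge (- e) (- r) x + (e \<bullet> x - r)" for x
      by (simp add: hinge_def)
    define f1 where "f1 = (\<lambda>x. h x + a * hinge (- e) (- r) x)"
    define f2 where "f2 = (\<lambda>x. h x + b * hinge e s x)"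
    have cv: "f1 \<in> Conv" "f2 \<in> Conv"
      unfolding f1_def f2_def using ab h by (intro Conv_add Conv_cmult Conv_hinge; simp)+
    have zero: "hinge (- e) (- r) x = 0 \<or> hinge e s x = 0" for x
      using rs by (auto simp: hinge_def max_def)
    have nn: "0 \<le> hinge e s x" for e s and x :: 'a by (simp add: hinge_def)
    have mm: "max (f1 x) (f2 x) = h x + a * hinge (- e) (- r) x + b * hinge e s x \<and> min (f1 x) (f2 x) = h x" for x
      using zero[of x] mult_nonneg_nonneg[OF ab(1) nn[of "- e" "- r" x]] mult_nonneg_nonneg[OF ab(2) nn[of e s x]]
      by (auto simp: f1_def f2_def)
    then have mx: "(\<lambda>x. max (f1 x) (f2 x)) = (\<lambda>x. h x + a * hinge (- e) (- r) x + b * hinge e s x)"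
      and mn: "(\<lambda>x. min (f1 x) (f2 x)) = h"
      by auto
    have cm: "(\<lambda>x. h x + a * hinge (- e) (- r) x + b * hinge e s x) \<in> Conv"
      using ab h by (intro Conv_add Conv_cmult Conv_hinge)
    have "\<Psi> (\<lambda>x. h x + a * hinge e r x + b * hinge e s x) = \<Psi> (\<lambda>x. h x + a * hinge (- e) (- r) x + b * hinge e s x)"
      by (rule val_affine[OF cm, of _ "a *\<^sub>R e" "- a * r"]) (simp add: neg algebra_simps)
    moreover have "\<Psi> (\<lambda>x. h x + a * hinge e r x) = \<Psi> f1"
      by (rule val_affine[OF cv(1), of _ "a *\<^sub>R e" "- a * r"]) (simp add: f1_def neg algebra_simps)
    moreover have "\<Psi> (\<lambda>x. max (f1 x) (f2 x)) B + \<Psi> (\<lambda>x. min (f1 x) (f2 x)) B = \<Psi> f1 B + \<Psi> f2 B"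
      using cv h cm mx mn by (intro valuation) auto
    ultimately show ?thesis unfolding mx mn by (simp add: f2_def)
  qed
  show ?thesis
  proof (cases "r \<le> s")
    case True with main ab show ?thesis by blast
  next
    case False
    have "(\<lambda>x. h x + a * hinge e r x + b * hinge e s x) = (\<lambda>x. h x + b * hinge e s x + a * hinge e r x)"
      by (simp add: algebra_simps)
    with main[of s r b a] False ab show ?thesis by simp
  qed
qed

lemma cint_hinge_pair:
  assumes h: "h \<in> Conv" and ab: "0 \<le> a" "0 \<le> b" and \<phi>: "\<phi> \<in> bounded_borel_fun"
  shows "cint (\<Psi> (\<lambda>x. h x + a * hinge e r x + b * hinge e s x)) \<phi> + cint (\<Psi> h) \<phi>
    = cint (\<Psi> (\<lambda>x. h x + a * hinge e r x)) \<phi> + cint (\<Psi> (\<lambda>x. h x + b * hinge e s x)) \<phi>"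
proof -
  have c: "(\<lambda>x. h x + a * hinge e r x + b * hinge e s x) \<in> Conv"
    "(\<lambda>x. h x + a * hinge e r x) \<in> Conv" "(\<lambda>x. h x + b * hinge e s x) \<in> Conv"
    using ab h by (intro Conv_add Conv_cmult Conv_hinge; simp)+
  show ?thesis
    using cint_lincomb_measure[OF cradon_val[OF c(1)] cradon_val[OF h] \<phi>, of 1 1]
      cint_lincomb_measure[OF cradon_val[OF c(2)] cradon_val[OF c(3)] \<phi>, of 1 1]
    by (simp add: hinge_pair[OF h ab])
qed

text \<open>\<open>hinge_pair\<close> with equal knots makes the contribution additive in the
  weight; continuity of \<open>\<Psi>\<close> makes it linear.\<close>

lemma cint_hinge_scale:
  assumes h: "h \<in> Conv" and a: "0 \<le> a" and \<phi>: "\<phi> \<in> Cc"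
  shows "cint (\<Psi> (\<lambda>x. h x + a * hinge e s x)) \<phi> - cint (\<Psi> h) \<phi>
    = complex_of_real a * (cint (\<Psi> (\<lambda>x. h x + hinge e s x)) \<phi> - cint (\<Psi> h) \<phi>)"
proof -
  define w where "w = (\<lambda>a. cint (\<Psi> (\<lambda>x. h x + a * hinge e s x)) \<phi> - cint (\<Psi> h) \<phi>)"
  have c: "(\<lambda>x. h x + a * hinge e s x) \<in> Conv" if "0 \<le> a" for a
    using that h by (intro Conv_add Conv_cmult Conv_hinge)
  have "w a = complex_of_real a * w 1"
  proof (rule additive_continuous_halfline[OF _ _ a])
    fix a b :: real assume ab: "0 \<le> a" "0 \<le> b"
    show "w (a + b) = w a + w b"
      using cint_hinge_pair[OF h ab bbf_Cc[OF \<phi>], of e s s] unfolding w_def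
      by (simp add: algebra_simps)
  next
    fix t :: "nat \<Rightarrow> real" and a :: real assume t: "\<And>i::nat. 0 \<le> t i" and a: "0 \<le> a" and lim: "t \<longlonglongrightarrow> a"
    have "continuous_on UNIV (hinge e s)"
      unfolding hinge_def[abs_def] by (intro continuous_intros)
    then have "loc_unif_conv (\<lambda>i x. h x + t i * hinge e s x) (\<lambda>x. h x + a * hinge e s x)"
      using lim by (rule loc_unif_conv_scale)
    then show "(\<lambda>i. w (t i)) \<longlonglongrightarrow> w a"
      unfolding w_def by (intro tendsto_diff tendsto_const val_continuous c t a \<phi>)
  qed
  then show ?thesis by (simp add: w_def)
qed

text \<open>The set \<open>B\<close> splits into its parts on the two open sides of the hyperplane,
  and on each side the hinge is affine.\<close>

lemma hinge_difference_support:
  assumes h: "h \<in> Conv" and B: "B \<in> bborel" and off: "\<And>x. x \<in> B \<Longrightarrow> e \<bullet> x \<noteq> s"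
  shows "\<Psi> (\<lambda>x. h x + hinge e s x) B = \<Psi> h B"
proof -
  have c: "(\<lambda>x. h x + hinge e s x) \<in> Conv" using h by (intro Conv_add Conv_hinge)
  define U V where "U = {x. e \<bullet> x < s}" and "V = {x. e \<bullet> x > s}"
  have o: "open U" "open V" unfolding U_def V_def by (auto intro: open_halfspace_lt open_halfspace_gt)
  have "B \<inter> U \<union> B \<inter> V = B" using off by (force simp: U_def V_def)
  moreover have b: "B \<inter> U \<in> bborel" "B \<inter> V \<in> bborel" using B o by (auto intro: bborel_Int)
  moreover have "(B \<inter> U) \<inter> (B \<inter> V) = {}" by (auto simp: U_def V_def)
  ultimately have split: "\<Psi> f B = \<Psi> f (B \<inter> U) + \<Psi> f (B \<inter> V)" if "f \<in> Conv" for f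
    using cradon_Un[OF cradon_val[OF that] b] by simp
  have "\<Psi> (\<lambda>x. h x + hinge e s x) (B \<inter> U) = \<Psi> h (B \<inter> U)"
    by (rule val_local[OF h c o(1), of 0 0]) (use b in \<open>auto simp: U_def hinge_def\<close>)
  moreover have "\<Psi> (\<lambda>x. h x + hinge e s x) (B \<inter> V) = \<Psi> h (B \<inter> V)"
    by (rule val_local[OF h c o(2), of e "-s"]) (use b in \<open>auto simp: V_def hinge_def\<close>)
  ultimately show ?thesis using split[OF c] split[OF h] by simp
qed

text \<open>The contribution of the hinge lives on \<open>e \<bullet> x = s\<close>, where the test
  function \<open>\<psi>\<close> below vanishes.\<close>

lemma cint_hinge_mult:
  assumes h: "h \<in> Conv" and \<phi>: "\<phi> \<in> bounded_borel_fun" and d: "continuous_on UNIV d"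
  shows "cint (\<Psi> (\<lambda>x. h x + hinge e s x)) (\<lambda>x. \<phi> x * d (e \<bullet> x)) - cint (\<Psi> h) (\<lambda>x. \<phi> x * d (e \<bullet> x))
    = d s * (cint (\<Psi> (\<lambda>x. h x + hinge e s x)) \<phi> - cint (\<Psi> h) \<phi>)"
proof -
  have c: "(\<lambda>x. h x + hinge e s x) \<in> Conv" using h by (intro Conv_add Conv_hinge)
  have d': "continuous_on UNIV (\<lambda>x. d (e \<bullet> x))"
    by (intro continuous_on_compose2[OF d] continuous_intros) auto
  have \<phi>d: "(\<lambda>x. \<phi> x * d (e \<bullet> x)) \<in> bounded_borel_fun" by (rule bbf_mult[OF \<phi> d'])
  define \<psi> where "\<psi> = (\<lambda>x. 1 * (\<phi> x * d (e \<bullet> x)) + (- d s) * \<phi> x)"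
  have \<psi>: "\<psi> \<in> bounded_borel_fun" unfolding \<psi>_def by (rule bbf_lincomb[OF \<phi>d \<phi>])
  have "cint (\<Psi> (\<lambda>x. h x + hinge e s x)) \<psi> = cint (\<Psi> h) \<psi>"
    by (rule cint_cong[OF cradon_val[OF c] cradon_val[OF h] \<psi>])
       (auto intro!: hinge_difference_support[OF h] simp: \<psi>_def)
  moreover have "cint (\<Psi> f) \<psi> = cint (\<Psi> f) (\<lambda>x. \<phi> x * d (e \<bullet> x)) - d s * cint (\<Psi> f) \<phi>" if "f \<in> Conv" for f
    unfolding \<psi>_def using cint_lincomb[OF cradon_val[OF that] \<phi>d \<phi>, of 1 "- d s"] by simp
  ultimately show ?thesis using c h by (simp add: algebra_simps)
qed

lemma cint_hinge_family:
  fixes c :: "nat \<Rightarrow> real"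
  assumes h: "h \<in> Conv" and c: "\<And>i. 0 \<le> c i" and \<phi>: "\<phi> \<in> Cc"
  shows "cint (\<Psi> (\<lambda>x. h x + (\<Sum>i<N. c i * hinge e (s i) x))) \<phi> - cint (\<Psi> h) \<phi>
    = (\<Sum>i<N. complex_of_real (c i) * (cint (\<Psi> (\<lambda>x. h x + hinge e (s i) x)) \<phi> - cint (\<Psi> h) \<phi>))"
proof -
  define T where "T = (\<lambda>N x. h x + (\<Sum>i<N. c i * hinge e (s i) x))"
  have T: "T N \<in> Conv" for N
    unfolding T_def using h c by (intro Conv_add Conv_sum Conv_cmult Conv_hinge) auto
  have TS: "T (Suc N) = (\<lambda>x. T N x + c N * hinge e (s N) x)" for N
    by (simp add: T_def fun_eq_iff)
  \<comment> \<open>By \<open>hinge_pair\<close> a hinge contributes the same on top of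
    \<open>T N\<close> as on top of \<open>h\<close>.\<close>
  have indep: "cint (\<Psi> (\<lambda>x. T N x + a * hinge e r x)) \<phi> - cint (\<Psi> (T N)) \<phi>
      = cint (\<Psi> (\<lambda>x. h x + a * hinge e r x)) \<phi> - cint (\<Psi> h) \<phi>" if a: "0 \<le> a" for N a r
  proof (induction N)
    case (Suc N)
    have "cint (\<Psi> (\<lambda>x. T (Suc N) x + a * hinge e r x)) \<phi> + cint (\<Psi> (T N)) \<phi>
      = cint (\<Psi> (T (Suc N))) \<phi> + cint (\<Psi> (\<lambda>x. T N x + a * hinge e r x)) \<phi>"
      unfolding TS by (rule cint_hinge_pair[OF T c a bbf_Cc[OF \<phi>]])
    with Suc show ?case by algebra
  qed (simp add: T_def)
  have "cint (\<Psi> (T N)) \<phi> - cint (\<Psi> h) \<phi>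
    = (\<Sum>i<N. complex_of_real (c i) * (cint (\<Psi> (\<lambda>x. h x + hinge e (s i) x)) \<phi> - cint (\<Psi> h) \<phi>))"
  proof (induction N)
    case (Suc N)
    have "cint (\<Psi> (T (Suc N))) \<phi> - cint (\<Psi> (T N)) \<phi> = cint (\<Psi> (\<lambda>x. h x + c N * hinge e (s N) x)) \<phi> - cint (\<Psi> h) \<phi>"
      unfolding TS by (rule indep[OF c])
    also have "\<dots> = complex_of_real (c N) * (cint (\<Psi> (\<lambda>x. h x + hinge e (s N) x)) \<phi> - cint (\<Psi> h) \<phi>)"
      by (rule cint_hinge_scale[OF h c \<phi>])
    finally show ?case using Suc by (simp add: algebra_simps)
  qed (simp add: T_def)
  then show ?thesis by (simp add: T_def)
qed

text \<open>Both sides are limits of the same sums of hinge contributions: the contribution of a hinge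
  at \<open>s\<close> lives on the hyperplane \<open>e \<bullet> x = s\<close>, so that weighting it by \<open>d s\<close>
  amounts to multiplying the test function by \<open>d (e \<bullet> x)\<close>.\<close>

lemma cint_hinge_int:
  assumes h: "h \<in> Conv" and d: "continuous_on UNIV d" "\<And>t. 0 \<le> d t" and M: "M > 0" and \<phi>: "\<phi> \<in> Cc"
  shows "cint (\<Psi> (\<lambda>x. h x + hinge_int M d (e \<bullet> x))) \<phi> - cint (\<Psi> h) \<phi>
    = cint (\<Psi> (\<lambda>x. h x + hinge_int M (\<lambda>t. 1) (e \<bullet> x))) (\<lambda>x. \<phi> x * complex_of_real (d (e \<bullet> x)))
      - cint (\<Psi> h) (\<lambda>x. \<phi> x * complex_of_real (d (e \<bullet> x)))"
proof -
  have lim: "(\<lambda>N. cint (\<Psi> (\<lambda>x. h x + hinge_sum M d (Suc N) (e \<bullet> x))) \<phi> - cint (\<Psi> h) \<phi>)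
      \<longlonglongrightarrow> cint (\<Psi> (\<lambda>x. h x + hinge_int M d (e \<bullet> x))) \<phi> - cint (\<Psi> h) \<phi>"
    if d: "continuous_on UNIV d" "\<And>t. 0 \<le> d t" and \<phi>: "\<phi> \<in> Cc" for d \<phi>
  proof (intro tendsto_diff tendsto_const val_continuous)
    show "(\<lambda>x. h x + hinge_sum M d (Suc N) (e \<bullet> x)) \<in> Conv" for N
      using d M by (intro Conv_add Conv_ridge convex_hinge_sum h) auto
    show "(\<lambda>x. h x + hinge_int M d (e \<bullet> x)) \<in> Conv"
      using d M by (intro Conv_add Conv_ridge convex_hinge_int h) auto
    show "loc_unif_conv (\<lambda>N x. h x + hinge_sum M d (Suc N) (e \<bullet> x)) (\<lambda>x. h x + hinge_int M d (e \<bullet> x))"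
      by (rule loc_unif_conv_ridge[OF hinge_sum_uniform[OF d(1) M]])
  qed (rule \<phi>)
  have dc: "continuous_on UNIV (\<lambda>t. complex_of_real (d t))" by (intro continuous_intros d)
  have \<phi>d: "(\<lambda>x. \<phi> x * complex_of_real (d (e \<bullet> x))) \<in> Cc"
  proof -
    have "continuous_on UNIV (\<lambda>x. \<phi> x * complex_of_real (d (e \<bullet> x)))"
      using \<phi> unfolding Cc_def
      by (intro continuous_intros continuous_on_compose2[OF d(1)]) auto
    moreover have "{x. \<phi> x * complex_of_real (d (e \<bullet> x)) \<noteq> 0} \<subseteq> {x. \<phi> x \<noteq> 0}" by auto
    ultimately show ?thesis using \<phi> bounded_subset unfolding Cc_def by blast
  qed
  have one: "continuous_on UNIV (\<lambda>t::real. 1::real)" by simp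
  define t where "t = (\<lambda>N i. - M + real i * (2 * M / real N))"
  have hs: "(\<lambda>x. h x + hinge_sum M d N (e \<bullet> x)) = (\<lambda>x. h x + (\<Sum>i<N. ((2 * M / real N) * d (t N i)) * hinge e (t N i) x))" for N d
    by (simp add: hinge_sum_def hinge_def t_def)
  have "cint (\<Psi> (\<lambda>x. h x + hinge_sum M d N (e \<bullet> x))) \<phi> - cint (\<Psi> h) \<phi>
    = cint (\<Psi> (\<lambda>x. h x + hinge_sum M (\<lambda>t. 1) N (e \<bullet> x))) (\<lambda>x. \<phi> x * complex_of_real (d (e \<bullet> x)))
      - cint (\<Psi> h) (\<lambda>x. \<phi> x * complex_of_real (d (e \<bullet> x)))" for N
  proof -
    have nn: "0 \<le> (2 * M / real N) * d (t N i)" "0 \<le> (2 * M / real N) * 1" for i using d M by auto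
    show ?thesis
      unfolding hs cint_hinge_family[OF h nn(1) \<phi>] cint_hinge_family[OF h nn(2) \<phi>d]
      by (intro sum.cong refl) (simp add: cint_hinge_mult[OF h bbf_Cc[OF \<phi>] dc])
  qed
  then show ?thesis
    using LIMSEQ_unique[OF lim[OF d \<phi>]] lim[OF one _ \<phi>d] by simp
qed

text \<open>The ridge with second derivative 1, against which the other ridges are measured.\<close>

definition quad1 :: "'a \<Rightarrow> 'a \<Rightarrow> real" where
  "quad1 e x = (e \<bullet> x)\<^sup>2 / 2"

text \<open>Over the support of \<open>\<phi>\<close> the values \<open>e \<bullet> x\<close> stay
  in a bounded interval, where \<open>g\<close> and the square differ from the hinge integrals with
  weights \<open>d\<close> and 1 by affine functions only. Locality reduces the claim to
  \<open>cint_hinge_int\<close>.\<close>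

lemma cint_ridge:
  assumes h: "h \<in> Conv" and cg: "convex_on UNIV g"
    and g: "\<And>t. (g has_real_derivative g' t) (at t)" and g': "\<And>t. (g' has_real_derivative d t) (at t)"
    and d: "continuous_on UNIV d" "\<And>t. 0 \<le> d t" and \<phi>: "\<phi> \<in> Cc"
  shows "cint (\<Psi> (\<lambda>x. h x + g (e \<bullet> x))) \<phi> = cint (\<Psi> h) \<phi> +
    (cint (\<Psi> (\<lambda>x. h x + quad1 e x)) (\<lambda>x. \<phi> x * complex_of_real (d (e \<bullet> x)))
      - cint (\<Psi> h) (\<lambda>x. \<phi> x * complex_of_real (d (e \<bullet> x))))"
proof -
  obtain r where r: "r > 0" "\<And>x. norm x > r \<Longrightarrow> \<phi> x = 0"
    using bbf_support[OF bbf_Cc[OF \<phi>]] by blast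
  \<comment> \<open>\<open>norm e * r\<close> bounds \<open>e \<bullet> x\<close> on the support;
    the added 1 makes the slab \<open>U\<close> an open neighbourhood of it and \<open>M\<close>
    positive.\<close>
  define M where "M = norm e * r + 1"
  have M: "M > 0" using r by (simp add: M_def add_nonneg_pos)
  define U where "U = {x. e \<bullet> x < M} \<inter> {x. e \<bullet> x > - M}"
  have U: "open U" unfolding U_def by (intro open_Int open_halfspace_lt open_halfspace_gt)
  have in_U: "x \<in> U" if "\<phi> x \<noteq> 0" for x
  proof -
    have "norm x \<le> r" using r(2)[of x] that by force
    then have "\<bar>e \<bullet> x\<bar> \<le> norm e * r"
      using Cauchy_Schwarz_ineq2[of e x] mult_left_mono[of "norm x" r "norm e"] by simp
    then show ?thesis by (auto simp: U_def M_def)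
  qed
  have in_M: "e \<bullet> x \<in> {-M..M}" if "x \<in> U" for x using that by (auto simp: U_def)
  have one: "continuous_on UNIV (\<lambda>t::real. 1::real)" by simp
  have hi: "(\<lambda>x. h x + hinge_int M d (e \<bullet> x)) \<in> Conv"
    using d M by (intro Conv_add Conv_ridge convex_hinge_int h) auto
  have hi1: "(\<lambda>x. h x + hinge_int M (\<lambda>t. 1) (e \<bullet> x)) \<in> Conv"
    using M by (intro Conv_add Conv_ridge convex_hinge_int h) auto
  have cq: "(\<lambda>x. h x + quad1 e x) \<in> Conv"
  proof -
    have "convex_on UNIV (\<lambda>u::real. u\<^sup>2 / 2)"
      by (rule f''_ge0_imp_convex[where f'="\<lambda>u. u" and f''="\<lambda>u. 1"]) (auto intro!: derivative_eq_intros)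
    from Conv_ridge[OF this, of e] show ?thesis using h by (auto simp: quad1_def intro: Conv_add)
  qed
  have \<phi>d: "(\<lambda>x. \<phi> x * complex_of_real (d (e \<bullet> x))) \<in> bounded_borel_fun"
    by (intro bbf_mult bbf_Cc \<phi> continuous_intros continuous_on_compose2[OF d(1)]) auto
  have 1: "cint (\<Psi> (\<lambda>x. h x + g (e \<bullet> x))) \<phi> = cint (\<Psi> (\<lambda>x. h x + hinge_int M d (e \<bullet> x))) \<phi>"
  proof (rule cint_local[OF hi _ U, of _ "g' (-M) *\<^sub>R e" "g (- M) + g' (- M) * M"])
    show "(\<lambda>x. h x + g (e \<bullet> x)) \<in> Conv" by (intro Conv_add Conv_ridge h cg)
    show "h x + g (e \<bullet> x) = h x + hinge_int M d (e \<bullet> x) + ((g' (-M) *\<^sub>R e) \<bullet> x + (g (- M) + g' (- M) * M))"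
      if "x \<in> U" for x
      by (subst hinge_int_eq[OF g g' in_M[OF that]]) (simp add: algebra_simps)
    show "{x. \<phi> x \<noteq> 0} \<subseteq> U" using in_U by blast
  qed (rule bbf_Cc[OF \<phi>])
  have 2: "cint (\<Psi> (\<lambda>x. h x + quad1 e x)) (\<lambda>x. \<phi> x * complex_of_real (d (e \<bullet> x)))
      = cint (\<Psi> (\<lambda>x. h x + hinge_int M (\<lambda>t. 1) (e \<bullet> x))) (\<lambda>x. \<phi> x * complex_of_real (d (e \<bullet> x)))"
  \<comment> \<open>The affine term of \<open>hinge_int_eq\<close> for \<open>u\<^sup>2 / 2\<close>,
    whose value and slope at \<open>- M\<close> are \<open>M\<^sup>2 / 2\<close> and
    \<open>- M\<close>.\<close>
  proof (rule cint_local[OF hi1 cq U, of "(-M) *\<^sub>R e" "M\<^sup>2 / 2 - M * M"])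
    have der: "((\<lambda>u. u\<^sup>2 / 2) has_real_derivative t) (at t)" "((\<lambda>u. u) has_real_derivative 1) (at t)" for t :: real
      by (auto intro!: derivative_eq_intros)
    show "h x + quad1 e x = h x + hinge_int M (\<lambda>t. 1) (e \<bullet> x) + (((-M) *\<^sub>R e) \<bullet> x + (M\<^sup>2 / 2 - M * M))"
      if "x \<in> U" for x
      by (subst hinge_int_eq[OF der in_M[OF that]]) (simp add: quad1_def algebra_simps power2_eq_square)
    show "{x. \<phi> x * complex_of_real (d (e \<bullet> x)) \<noteq> 0} \<subseteq> U" using in_U by force
  qed (rule \<phi>d)
  show ?thesis
    using cint_hinge_int[OF h d M \<phi>, of e] unfolding 1 2 by (simp add: algebra_simps)
qed

end

section \<open>Quadratic forms\<close>

lemma symmetric_dot: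
  fixes A :: "real^'n^'n"
  assumes "transpose A = A" shows "x \<bullet> (A *v y) = (A *v x) \<bullet> y"
  using dot_lmul_matrix[of x A y] transpose_matrix_vector[of A x] assms by simp

definition psd :: "real^'n^'n \<Rightarrow> bool" where
  "psd A \<longleftrightarrow> transpose A = A \<and> (\<forall>x. 0 \<le> x \<bullet> (A *v x))"

definition quad :: "real^'n^'n \<Rightarrow> real^'n \<Rightarrow> real" where
  "quad A x = x \<bullet> (A *v x) / 2"

definition outer :: "real^'n \<Rightarrow> real^'n^'n" where
  "outer e = (\<chi> i j. e $ i * e $ j)"

definition diagm :: "('n \<Rightarrow> real) \<Rightarrow> real^'n^'n" where
  "diagm d = (\<chi> i j. if i = j then d i else 0)"

lemma transpose_add: "transpose (A + B) = transpose A + transpose (B :: real^'n^'m)"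
  by (simp add: transpose_def vec_eq_iff)

lemma scaleR_matrix_vector: "(t *\<^sub>R A) *v x = t *\<^sub>R (A *v (x :: real^'n))"
  by (simp add: scaleR_matrix_vector_assoc)

lemma outer_vector: "outer e *v x = (e \<bullet> x) *\<^sub>R e"
  by (simp add: outer_def matrix_vector_mult_def vec_eq_iff inner_vec_def sum_distrib_left sum_distrib_right mult_ac)

lemma diagm_vector: "(diagm d *v x) $ i = d i * x $ i"
  by (simp add: diagm_def matrix_vector_mult_def if_distrib if_distribR sum.delta cong: if_cong)

lemma psd_add: "psd A \<Longrightarrow> psd B \<Longrightarrow> psd (A + B)"
  by (simp add: psd_def transpose_add matrix_vector_mult_add_rdistrib inner_add_right)

lemma psd_scale: "psd A \<Longrightarrow> 0 \<le> t \<Longrightarrow> psd (t *\<^sub>R A)"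
  by (simp add: psd_def transpose_scalar scaleR_matrix_vector)

lemma psd_outer: "psd (outer e)"
  unfolding psd_def outer_vector
  by (auto simp: inner_commute transpose_def outer_def vec_eq_iff mult.commute)

lemma psd_zero: "psd 0"
  by (simp add: psd_def transpose_def vec_eq_iff)

lemma psd_diagm: "(\<And>i. 0 \<le> d i) \<Longrightarrow> psd (diagm d)"
  unfolding psd_def
  by (auto simp: transpose_def diagm_def vec_eq_iff inner_vec_def diagm_vector[unfolded diagm_def] intro!: sum_nonneg)
     (metis mult.left_commute mult_nonneg_nonneg zero_le_square)

lemma congruence_dot: "x \<bullet> ((transpose g ** A ** g) *v x) = (g *v x) \<bullet> (A *v (g *v (x :: real^'n)))"
proof -
  have "(transpose g ** A ** g) *v x = (A *v (g *v x)) v* g"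
    by (simp only: matrix_vector_mul_assoc[symmetric] transpose_matrix_vector)
  then have "x \<bullet> ((transpose g ** A ** g) *v x) = ((A *v (g *v x)) v* g) \<bullet> x"
    by (simp only: inner_commute)
  also have "\<dots> = (A *v (g *v x)) \<bullet> (g *v x)" by (rule dot_lmul_matrix)
  finally show ?thesis by (simp only: inner_commute)
qed

lemma psd_congruence: "psd A \<Longrightarrow> psd (transpose g ** A ** g)"
  unfolding psd_def congruence_dot by (simp add: matrix_transpose_mul matrix_mul_assoc)

lemma quad_add: "quad (A + B) x = quad A x + quad B x"
  by (simp add: quad_def matrix_vector_mult_add_rdistrib inner_add_right add_divide_distrib)

lemma quad_scale: "quad (t *\<^sub>R A) x = t * quad A x"
  by (simp add: quad_def scaleR_matrix_vector)

lemma quad_outer: "quad (outer e) x = (e \<bullet> x)\<^sup>2 / 2"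
  by (simp add: quad_def outer_vector power2_eq_square inner_commute)

lemma quad_congruence: "quad A (g *v x) = quad (transpose g ** A ** g) x"
  unfolding quad_def congruence_dot ..

lemma quad_translate: "transpose A = A \<Longrightarrow> quad A (x + y) = quad A x + ((A *v y) \<bullet> x + quad A y)"
  using symmetric_dot[of A x y] symmetric_dot[of A y x]
  by (simp add: quad_def matrix_vector_right_distrib inner_add_left inner_add_right inner_commute add_divide_distrib)

lemma quad_comb:
  "quad A (s *\<^sub>R x + t *\<^sub>R y) = s\<^sup>2 * quad A x + t\<^sup>2 * quad A y + s * t * ((x \<bullet> (A *v y) + y \<bullet> (A *v x)) / 2)"
  unfolding quad_def
  by (simp add: matrix_vector_right_distrib matrix_vector_mult_scaleR inner_add_left inner_add_right
      power2_eq_square distrib_left add_divide_distrib mult_ac)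

lemma Conv_quad:
  assumes "psd A" shows "quad A \<in> Conv"
  unfolding Conv_def mem_Collect_eq
proof (rule convex_onI)
  fix t x y assume t: "(0::real) < t" "t < 1"
  define m where "m = (x \<bullet> (A *v y) + y \<bullet> (A *v x)) / 2"
  \<comment> \<open>The convexity defect of a quadratic form is \<open>t * (1 - t)\<close> times its
    value at \<open>x - y\<close>.\<close>
  have "0 \<le> quad A (1 *\<^sub>R x + (-1) *\<^sub>R y)" using assms by (simp add: quad_def psd_def)
  then have "0 \<le> quad A x + quad A y - m" unfolding quad_comb m_def[symmetric] by simp
  then have "0 \<le> t * (1 - t) * (quad A x + quad A y - m)" using t by simp
  also have "\<dots> = (1 - t) * quad A x + t * quad A y - ((1 - t)\<^sup>2 * quad A x + t\<^sup>2 * quad A y + (1 - t) * t * m)"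
    by (simp add: power2_eq_square algebra_simps)
  finally show "quad A ((1 - t) *\<^sub>R x + t *\<^sub>R y) \<le> (1 - t) * quad A x + t * quad A y"
    unfolding quad_comb m_def[symmetric] by linarith
qed auto

lemma norm_matrix_vector_le: "norm (A *v x) \<le> norm A * norm (x :: real^'n)"
proof -
  have "norm (A *v x) \<le> L2_set (\<lambda>i. norm (A $ i) * norm x) UNIV"
    unfolding norm_vec_def[of "A *v x"]
  proof (intro L2_set_mono)
    fix i
    have "(A *v x) $ i = A $ i \<bullet> x" by (simp add: matrix_vector_mult_def inner_vec_def)
    then show "norm ((A *v x) $ i) \<le> norm (A $ i) * norm x" by (simp add: Cauchy_Schwarz_ineq2)
  qed simp
  also have "\<dots> = norm A * norm x" by (simp add: norm_vec_def[of A] L2_set_left_distrib)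
  finally show ?thesis .
qed

lemma loc_unif_conv_quad:
  fixes A :: "nat \<Rightarrow> real^'n^'n"
  assumes "A \<longlonglongrightarrow> B"
  shows "loc_unif_conv (\<lambda>i. quad (A i)) (quad B)"
  unfolding loc_unif_conv_def
proof (intro allI impI uniform_limitI)
  fix K :: "(real^'n) set" and \<epsilon> :: real assume K: "compact K" and \<epsilon>: "\<epsilon> > 0"
  obtain r where r: "r > 0" "\<And>x. x \<in> K \<Longrightarrow> norm x \<le> r"
    using compact_imp_bounded[OF K] unfolding bounded_pos by blast
  have "\<forall>\<^sub>F i in sequentially. dist (A i) B < \<epsilon> / (r * r)"
    using assms \<epsilon> r by (simp add: tendsto_iff)
  then show "\<forall>\<^sub>F i in sequentially. \<forall>x\<in>K. dist (quad (A i) x) (quad B x) < \<epsilon>"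
  proof eventually_elim
    case (elim i)
    show ?case
    proof
      fix x assume x: "x \<in> K"
      have "dist (quad (A i) x) (quad B x) = \<bar>x \<bullet> ((A i - B) *v x)\<bar> / 2"
        by (simp add: quad_def dist_real_def matrix_vector_mult_diff_rdistrib inner_diff_right diff_divide_distrib[symmetric])
      also have "\<dots> \<le> \<bar>x \<bullet> ((A i - B) *v x)\<bar>" by simp
      also have "\<dots> \<le> norm x * (norm (A i - B) * norm x)"
        by (rule order.trans[OF Cauchy_Schwarz_ineq2]) (intro mult_left_mono norm_matrix_vector_le norm_ge_zero)
      also have "\<dots> \<le> r * (norm (A i - B) * r)"
        using r x by (intro mult_mono) auto
      also have "\<dots> = norm (A i - B) * (r * r)" by (simp add: mult_ac)
      also have "\<dots> < \<epsilon>" using elim r(1) by (simp add: dist_norm pos_less_divide_eq)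
      finally show "dist (quad (A i) x) (quad B x) < \<epsilon>" .
    qed
  qed
qed

subsection \<open>Orthogonal diagonalisation\<close>

lemma linear_le_quadratic_zero:
  fixes b c :: real
  assumes "\<And>t. 2 * t * b + t\<^sup>2 * c \<le> 0" shows "b = 0"
proof (rule ccontr)
  assume b: "b \<noteq> 0"
  \<comment> \<open>With \<open>m\<close> above \<open>\<bar>c\<bar>\<close> the linear term
    dominates at \<open>t = b / m\<close>.\<close>
  define m where "m = \<bar>c\<bar> + 1"
  have m: "m > 0" "\<bar>c\<bar> < m" by (auto simp: m_def)
  have "2 * (b / m) * b + (b / m)\<^sup>2 * c = b\<^sup>2 / m * (2 + c / m)"
    using m by (simp add: field_simps power2_eq_square)
  moreover have "\<bar>c / m\<bar> < 1" using m by simp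
  then have "2 + c / m > 0" by linarith
  then have "b\<^sup>2 / m * (2 + c / m) > 0" using b m by simp
  ultimately show False using assms[of "b / m"] by simp
qed

text \<open>A maximiser \<open>v\<close> of the quadratic form on the unit sphere of
  \<open>V\<close> is varied in the directions of \<open>V\<close> orthogonal to \<open>v\<close>;
  the first order condition says that \<open>A *v v\<close> has no component there.\<close>

lemma symmetric_eigenvector:
  fixes A :: "real^'n^'n"
  assumes A: "transpose A = A" and V: "subspace V" and inv: "\<And>x. x \<in> V \<Longrightarrow> A *v x \<in> V" and ne: "V \<noteq> {0}"
  obtains v l where "v \<in> V" "norm v = 1" "A *v v = l *\<^sub>R v"
proof -
  define S where "S = V \<inter> sphere 0 1"
  have "compact S" unfolding S_def by (intro closed_Int_compact closed_subspace V compact_sphere)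
  moreover have "S \<noteq> {}"
  proof -
    obtain x where x: "x \<in> V" "x \<noteq> 0" using ne subspace_0[OF V] by blast
    then have "inverse (norm x) *\<^sub>R x \<in> S" using V by (auto simp: S_def subspace_scale)
    then show ?thesis by blast
  qed
  moreover have "continuous_on S (\<lambda>x. x \<bullet> (A *v x))"
    by (intro continuous_intros matrix_vector_mult_linear_continuous_on)
  ultimately obtain v where v: "v \<in> S" and mx: "\<And>x. x \<in> S \<Longrightarrow> x \<bullet> (A *v x) \<le> v \<bullet> (A *v v)"
    using continuous_attains_sup[of S "\<lambda>x. x \<bullet> (A *v x)"] by blast
  define l where "l = v \<bullet> (A *v v)"
  have vV: "v \<in> V" and nv: "norm v = 1" using v by (auto simp: S_def)
  have vv: "v \<bullet> v = 1" using nv by (simp add: norm_eq_1)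
  have mx': "x \<bullet> (A *v x) \<le> l * (x \<bullet> x)" if x: "x \<in> V" for x
  proof (cases "x = 0")
    case False
    define y where "y = inverse (norm x) *\<^sub>R x"
    have "y \<in> S" using False x V by (auto simp: S_def y_def subspace_scale)
    then have "y \<bullet> (A *v y) \<le> l" unfolding l_def by (rule mx)
    then have "(x \<bullet> (A *v x)) / (norm x)\<^sup>2 \<le> l"
      by (simp add: y_def matrix_vector_mult_scaleR power2_eq_square divide_inverse mult_ac)
    then show ?thesis using False by (simp add: divide_le_eq power2_norm_eq_inner)
  qed simp
  have orth: "w \<bullet> (A *v v) = 0" if w: "w \<in> V" "w \<bullet> v = 0" for w
  proof (rule linear_le_quadratic_zero)
    fix t :: real
    have "(v + t *\<^sub>R w) \<bullet> (A *v (v + t *\<^sub>R w)) \<le> l * ((v + t *\<^sub>R w) \<bullet> (v + t *\<^sub>R w))"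
      using w vV V by (intro mx') (auto intro: subspace_add subspace_scale)
    moreover have "v \<bullet> (A *v w) = w \<bullet> (A *v v)" using symmetric_dot[OF A] by (simp add: inner_commute)
    moreover have "v \<bullet> w = 0" using w by (simp add: inner_commute)
    ultimately show "2 * t * (w \<bullet> (A *v v)) + t\<^sup>2 * (w \<bullet> (A *v w) - l * (w \<bullet> w)) \<le> 0"
      using w vv by (simp add: matrix_vector_right_distrib matrix_vector_mult_scaleR inner_add_left inner_add_right
          l_def[symmetric] power2_eq_square algebra_simps)
  qed
  \<comment> \<open>The residual lies in \<open>V\<close> and is orthogonal to \<open>v\<close>, so
    \<open>orth\<close> applies to it and makes it orthogonal to itself.\<close>
  define w where "w = A *v v - l *\<^sub>R v"
  have wv: "w \<bullet> v = 0" using vv by (simp add: w_def inner_diff_left inner_diff_right l_def inner_commute)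
  have "w \<in> V" unfolding w_def using inv vV V by (intro subspace_diff subspace_scale)
  from orth[OF this wv] have "w \<bullet> (w + l *\<^sub>R v) = 0" by (simp add: w_def)
  then have "w \<bullet> w = 0" using wv by (simp add: inner_add_right)
  then have "A *v v = l *\<^sub>R v" by (simp add: w_def)
  with vV nv show thesis by (rule that)
qed

text \<open>Induction on the dimension, stated for invariant subspaces because the orthogonal
  complement of an eigenvector inside \<open>V\<close> is again invariant, by symmetry of
  \<open>A\<close>.\<close>

lemma symmetric_eigenbasis:
  fixes A :: "real^'n^'n"
  assumes A: "transpose A = A" and V: "subspace V" and inv: "\<And>x. x \<in> V \<Longrightarrow> A *v x \<in> V"
  shows "\<exists>B. B \<subseteq> V \<and> span B = V \<and> pairwise orthogonal B \<and> (\<forall>b\<in>B. norm b = 1 \<and> (\<exists>l. A *v b = l *\<^sub>R b))"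
  using V inv
proof (induction "dim V" arbitrary: V rule: less_induct)
  case less
  show ?case
  proof (cases "V = {0}")
    case True then show ?thesis by (intro exI[of _ "{}"]) auto
  next
    case False
    obtain v l where v: "v \<in> V" "norm v = 1" "A *v v = l *\<^sub>R v"
      using symmetric_eigenvector[OF A less.prems False] by blast
    define W where "W = V \<inter> {w. v \<bullet> w = 0}"
    have W: "subspace W" unfolding W_def by (intro subspace_inter less.prems subspace_hyperplane)
    have "v \<notin> W" using v(2) by (auto simp: W_def)
    moreover have "W \<subseteq> V" by (auto simp: W_def)
    ultimately have "W \<subset> V" using v(1) by blast
    then have d: "dim W < dim V" using W less.prems(1) by (intro dim_psubset) (simp add: span_eq_iff[THEN iffD2])
    have invW: "A *v x \<in> W" if "x \<in> W" for x
    proof -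
      have "v \<bullet> (A *v x) = (A *v v) \<bullet> x" by (rule symmetric_dot[OF A])
      then show ?thesis using that less.prems(2) v(3) by (auto simp: W_def)
    qed
    obtain B where B: "B \<subseteq> W" "span B = W" "pairwise orthogonal B" "\<forall>b\<in>B. norm b = 1 \<and> (\<exists>l. A *v b = l *\<^sub>R b)"
      using less.hyps[OF d W invW] by blast
    have "span (insert v B) = V"
    proof
      show "span (insert v B) \<subseteq> V" using B(1) v(1) less.prems(1) by (intro span_minimal) (auto simp: W_def)
      show "V \<subseteq> span (insert v B)"
      proof
        fix x assume x: "x \<in> V"
        have "v \<bullet> v = 1" using v(2) by (simp add: norm_eq_1)
        then have "x - (v \<bullet> x) *\<^sub>R v \<in> W"
          using x v(1) less.prems(1) by (simp add: W_def inner_diff_right subspace_diff subspace_scale)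
        then have "x - (v \<bullet> x) *\<^sub>R v \<in> span B" using B(2) by simp
        then show "x \<in> span (insert v B)" unfolding span_insert by blast
      qed
    qed
    moreover have "pairwise orthogonal (insert v B)"
      using B(1,3) by (auto simp: pairwise_insert orthogonal_def W_def inner_commute)
    ultimately show ?thesis using B v by (intro exI[of _ "insert v B"]) (auto simp: W_def)
  qed
qed

lemma symmetric_diagonalisation:
  fixes A :: "real^'n^'n"
  assumes A: "transpose A = A"
  obtains Q d where "orthogonal_matrix Q" "A = Q ** diagm d ** transpose Q"
proof -
  obtain B where B: "span B = UNIV" "pairwise orthogonal B"
    "\<And>b. b \<in> B \<Longrightarrow> norm b = 1" "\<And>b. b \<in> B \<Longrightarrow> \<exists>l. A *v b = l *\<^sub>R b"
    using symmetric_eigenbasis[OF A subspace_UNIV] by auto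
  have "0 \<notin> B" using B(3)[of 0] by auto
  then have ind: "independent B" by (rule pairwise_orthogonal_independent[OF B(2)])
  have "finite B" using ind by (rule independent_imp_finite)
  moreover have "card B = CARD('n)" using dim_eq_card[of B UNIV] B(1) ind by simp
  ultimately obtain f where f: "bij_betw f (UNIV :: 'n set) B"
    using finite_same_card_bij[of "UNIV :: 'n set" B] by auto
  have fB: "f i \<in> B" for i using f by (auto simp: bij_betw_def)
  have inner_f: "f i \<bullet> f j = (if i = j then 1 else 0)" for i j
  proof (cases "i = j")
    case True then show ?thesis using B(3)[OF fB] by (simp add: norm_eq_1)
  next
    case False
    then have "f i \<noteq> f j" using f by (auto simp: bij_betw_def inj_on_def)
    then show ?thesis using B(2) fB False by (simp add: pairwise_def orthogonal_def)
  qed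
  obtain d where d: "\<And>i. A *v f i = d i *\<^sub>R f i" using B(4)[OF fB] by metis
  define Q where "Q = (\<chi> i j. f j $ i)"
  have Q: "transpose Q ** Q = mat 1"
    using inner_f by (simp add: vec_eq_iff matrix_matrix_mult_def transpose_def Q_def inner_vec_def mat_def)
  then have Q': "Q ** transpose Q = mat 1" by (simp add: matrix_left_right_inverse)
  have "A ** Q = Q ** diagm d"
  proof -
    have "(A ** Q) $ i $ j = (A *v f j) $ i" for i j
      by (simp add: matrix_matrix_mult_def matrix_vector_mult_def Q_def)
    moreover have "(Q ** diagm d) $ i $ j = d j * f j $ i" for i j
      by (simp add: matrix_matrix_mult_def diagm_def Q_def if_distrib sum.delta cong: if_cong)
    ultimately show ?thesis using d by (simp add: vec_eq_iff)
  qed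
  then have "A = Q ** diagm d ** transpose Q"
    by (metis Q' matrix_mul_assoc matrix_mul_rid)
  moreover have "orthogonal_matrix Q" using Q Q' by (simp add: orthogonal_matrix_def)
  ultimately show thesis using that by blast
qed

lemma eigenvalue_nonneg:
  assumes A: "psd A" and Q: "orthogonal_matrix Q" and eq: "A = Q ** diagm d ** transpose Q"
  shows "0 \<le> d i"
proof -
  have "transpose Q ** A ** Q = diagm d"
    using Q unfolding eq orthogonal_matrix_def by (metis matrix_mul_assoc matrix_mul_lid matrix_mul_rid)
  then have "psd (diagm d)" using psd_congruence[OF A, of Q] by simp
  then have "0 \<le> axis i 1 \<bullet> (diagm d *v axis i 1)" unfolding psd_def by blast
  then show ?thesis by (simp add: inner_axis' diagm_vector)
qed

lemma diagm_eq_sum: "diagm d = (\<Sum>i\<in>UNIV. d i *\<^sub>R outer (axis i 1))"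
proof -
  have "(\<Sum>i\<in>UNIV. d i *\<^sub>R outer (axis i 1)) $ a $ b = diagm d $ a $ b" for a b :: 'a
  proof -
    have "(\<Sum>i\<in>UNIV. d i *\<^sub>R outer (axis i 1)) $ a $ b = (\<Sum>i\<in>UNIV. if i = a then (if a = b then d i else 0) else 0)"
      unfolding sum_component by (intro sum.cong) (auto simp: outer_def axis_def)
    then show ?thesis by (simp add: diagm_def)
  qed
  then show ?thesis by (simp add: vec_eq_iff)
qed

lemma diagm_upd: "diagm (d(i := t)) = diagm (d(i := 0)) + t *\<^sub>R outer (axis i 1)"
  by (auto simp: vec_eq_iff diagm_def outer_def axis_def)

text \<open>Conjugation with a permutation matrix permutes the diagonal; this is the source of the
  symmetry of \<open>quad_val\<close> on diagonal matrices.\<close>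

lemma permutation_matrix_orthogonal:
  fixes p :: "'n::finite \<Rightarrow> 'n" and P :: "real^'n^'n"
  assumes "bij p" and P_def: "P = (\<chi> i j. if j = p i then 1 else 0)"
  shows "orthogonal_matrix P"
    and "diagm (\<lambda>i. d (p i)) = P ** diagm d ** transpose P"
proof -
  have inj: "p i = p j \<longleftrightarrow> i = j" for i j using assms by (simp add: bij_def inj_eq)
  have eq: "diagm (\<lambda>i. d (p i)) = P ** diagm d ** transpose P" for d
  proof -
    have L: "(P ** M) $ i $ j = M $ p i $ j" and R: "(M ** transpose P) $ i $ j = M $ i $ p j" for M :: "real^'n^'n" and i j
    proof -
      have "(P ** M) $ i $ j = (\<Sum>k\<in>UNIV. (if k = p i then 1 else 0) * M $ k $ j)"
        by (simp add: P_def matrix_matrix_mult_def)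
      also have "\<dots> = (\<Sum>k\<in>UNIV. if k = p i then M $ k $ j else 0)" by (intro sum.cong) auto
      finally show "(P ** M) $ i $ j = M $ p i $ j" by simp
      have "(M ** transpose P) $ i $ j = (\<Sum>k\<in>UNIV. M $ i $ k * (if k = p j then 1 else 0))"
        by (simp add: P_def matrix_matrix_mult_def transpose_def)
      also have "\<dots> = (\<Sum>k\<in>UNIV. if k = p j then M $ i $ k else 0)" by (intro sum.cong) auto
      finally show "(M ** transpose P) $ i $ j = M $ i $ p j" by simp
    qed
    show ?thesis by (simp add: vec_eq_iff L R) (simp add: diagm_def inj)
  qed
  have one: "diagm (\<lambda>i::'n. 1) = mat 1" by (simp add: diagm_def mat_def)
  \<comment> \<open>Orthogonality is the second claim for the identity matrix.\<close>
  have "P ** transpose P = mat 1" using eq[of "\<lambda>i. 1"] unfolding one by simp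
  then show "orthogonal_matrix P" by (simp add: orthogonal_matrix_def matrix_left_right_inverse)
  show "diagm (\<lambda>i. d (p i)) = P ** diagm d ** transpose P" by (rule eq)
qed

text \<open>The uniqueness behind the description is left as a hypothesis. It is supplied in
  \<open>quad_val_eq_sigma\<close>, where any two diagonalisations of \<open>A\<close> compute the
  same value \<open>quad_val A\<close>.\<close>

lemma sigma_eig_eqI:
  assumes Q: "orthogonal_matrix Q" "A = Q ** diagm d ** transpose Q"
    and unique: "\<And>Q' d'. orthogonal_matrix Q' \<Longrightarrow> A = Q' ** diagm d' ** transpose Q' \<Longrightarrow> elem_sym k d' = elem_sym k d"
  shows "sigma_eig k A = elem_sym k d"
  unfolding sigma_eig_def diagm_def[symmetric]
proof (rule the_equality)
  show "\<exists>Q' d'. orthogonal_matrix Q' \<and> A = Q' ** diagm d' ** transpose Q' \<and> elem_sym k d = elem_sym k d'"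
    using Q by blast
next
  fix s assume "\<exists>Q' d'. orthogonal_matrix Q' \<and> A = Q' ** diagm d' ** transpose Q' \<and> s = elem_sym k d'"
  then show "s = elem_sym k d" using unique by blast
qed

section \<open>Values on quadratic forms\<close>

text \<open>Induction on the variables: freezing the variable \<open>i\<close> at 0 and at 1 gives
  two expansions in the remaining ones, and affinity in \<open>i\<close> joins them.\<close>

lemma multiaffine_expansion:
  fixes F :: "('n \<Rightarrow> real) \<Rightarrow> complex"
  assumes "finite I"
    and "\<And>d i t. (\<And>j. 0 \<le> d j) \<Longrightarrow> i \<in> I \<Longrightarrow> 0 \<le> t \<Longrightarrow>
      F (d(i := t)) = F (d(i := 0)) + complex_of_real t * (F (d(i := 1)) - F (d(i := 0)))"
  shows "\<exists>a. \<forall>d. (\<forall>j. 0 \<le> d j) \<longrightarrow> (\<forall>j. j \<notin> I \<longrightarrow> d j = 0) \<longrightarrow>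
    F d = (\<Sum>S\<in>Pow I. a S * (\<Prod>i\<in>S. complex_of_real (d i)))"
  using assms
proof (induction I arbitrary: F rule: finite_induct)
  case empty
  show ?case
  proof (intro exI[of _ "\<lambda>S. F (\<lambda>i. 0)"] allI impI)
    fix d :: "'n \<Rightarrow> real" assume "\<forall>j. j \<notin> {} \<longrightarrow> d j = 0"
    then have "d = (\<lambda>i. 0)" by auto
    then show "F d = (\<Sum>S\<in>Pow {}. F (\<lambda>i. 0) * (\<Prod>i\<in>S. complex_of_real (d i)))" by simp
  qed
next
  case (insert i I)
  have IH: "\<exists>a. \<forall>d. (\<forall>j. 0 \<le> d j) \<longrightarrow> (\<forall>j. j \<notin> I \<longrightarrow> d j = 0) \<longrightarrow>
      F (d(i := s)) = (\<Sum>S\<in>Pow I. a S * (\<Prod>i\<in>S. complex_of_real (d i)))" if s: "0 \<le> s" for s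
  proof (rule insert.IH)
    fix d :: "'n \<Rightarrow> real" and j :: 'n and t :: real assume d: "\<And>j. 0 \<le> d j" and j: "j \<in> I" and t: "0 \<le> t"
    have "j \<noteq> i" using j insert.hyps by auto
    then have sw: "(d(j := u))(i := s) = (d(i := s))(j := u)" for u by (rule fun_upd_twist)
    show "F ((d(j := t))(i := s)) = F ((d(j := 0))(i := s)) +
        complex_of_real t * (F ((d(j := 1))(i := s)) - F ((d(j := 0))(i := s)))"
      unfolding sw using d j t s by (intro insert.prems) auto
  qed
  obtain a0 where a0: "\<And>d. (\<forall>j. 0 \<le> d j) \<Longrightarrow> (\<forall>j. j \<notin> I \<longrightarrow> d j = 0) \<Longrightarrow>
      F (d(i := 0)) = (\<Sum>S\<in>Pow I. a0 S * (\<Prod>i\<in>S. complex_of_real (d i)))" using IH[of 0] by auto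
  obtain a1 where a1: "\<And>d. (\<forall>j. 0 \<le> d j) \<Longrightarrow> (\<forall>j. j \<notin> I \<longrightarrow> d j = 0) \<Longrightarrow>
      F (d(i := 1)) = (\<Sum>S\<in>Pow I. a1 S * (\<Prod>i\<in>S. complex_of_real (d i)))" using IH[of 1] by auto
  \<comment> \<open>A set containing \<open>i\<close> takes its coefficient from the slope in the
    variable \<open>i\<close>, any other set from the value at 0.\<close>
  define a where "a = (\<lambda>S. if i \<in> S then a1 (S - {i}) - a0 (S - {i}) else a0 S)"
  have "F d = (\<Sum>S\<in>Pow (insert i I). a S * (\<Prod>i\<in>S. complex_of_real (d i)))"
    if d: "\<forall>j. 0 \<le> d j" "\<forall>j. j \<notin> insert i I \<longrightarrow> d j = 0" for d
  proof -
    define e where "e = d(i := 0)"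
    have e: "\<forall>j. 0 \<le> e j" "\<forall>j. j \<notin> I \<longrightarrow> e j = 0" using d by (auto simp: e_def)
    have ei: "e(i := 0) = e" "e(i := 1) = d(i := 1)" "d(i := 0) = e" by (auto simp: e_def)
    have pe: "(\<Prod>j\<in>S. complex_of_real (e j)) = (\<Prod>j\<in>S. complex_of_real (d j))" if "S \<in> Pow I" for S
      using that insert.hyps by (intro prod.cong) (auto simp: e_def)
    have "F d = F (d(i := 0)) + complex_of_real (d i) * (F (d(i := 1)) - F (d(i := 0)))"
    proof -
      have "F (d(i := d i)) = F (d(i := 0)) + complex_of_real (d i) * (F (d(i := 1)) - F (d(i := 0)))"
        using d by (intro insert.prems) auto
      then show ?thesis by (simp only: fun_upd_triv)
    qed
    also have "\<dots> = (\<Sum>S\<in>Pow I. a0 S * (\<Prod>j\<in>S. complex_of_real (d j))) +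
        complex_of_real (d i) * (\<Sum>S\<in>Pow I. (a1 S - a0 S) * (\<Prod>j\<in>S. complex_of_real (d j)))"
      using a0[OF e] a1[OF e] pe unfolding ei by (simp add: sum_subtractf left_diff_distrib)
    also have "(\<Sum>S\<in>Pow I. a0 S * (\<Prod>j\<in>S. complex_of_real (d j))) = (\<Sum>S\<in>Pow I. a S * (\<Prod>j\<in>S. complex_of_real (d j)))"
      using insert.hyps by (intro sum.cong) (auto simp: a_def)
    also have "complex_of_real (d i) * (\<Sum>S\<in>Pow I. (a1 S - a0 S) * (\<Prod>j\<in>S. complex_of_real (d j)))
        = (\<Sum>S\<in>insert i ` Pow I. a S * (\<Prod>j\<in>S. complex_of_real (d j)))"
    proof -
      have inj: "inj_on (insert i) (Pow I)" using insert.hyps by (auto simp: inj_on_def)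
      have t: "a (insert i S) * (\<Prod>j\<in>insert i S. complex_of_real (d j))
          = complex_of_real (d i) * ((a1 S - a0 S) * (\<Prod>j\<in>S. complex_of_real (d j)))" if "S \<in> Pow I" for S
      proof -
        have "i \<notin> S" "finite S" using that insert.hyps finite_subset by auto
        then show ?thesis by (simp add: a_def)
      qed
      show ?thesis unfolding sum.reindex[OF inj] sum_distrib_left o_def using t by (intro sum.cong) auto
    qed
    also have "(\<Sum>S\<in>Pow I. a S * (\<Prod>j\<in>S. complex_of_real (d j))) + (\<Sum>S\<in>insert i ` Pow I. a S * (\<Prod>j\<in>S. complex_of_real (d j)))
        = (\<Sum>S\<in>Pow (insert i I). a S * (\<Prod>j\<in>S. complex_of_real (d j)))"
      unfolding Pow_insert using insert.hyps by (intro sum.union_disjoint[symmetric]) auto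
    finally show ?thesis .
  qed
  then show ?case by blast
qed

text \<open>In the multiaffine expansion homogeneity leaves only products of \<open>k\<close>
  variables, and permutations make their coefficients equal.\<close>

lemma homogeneous_symmetric_multiaffine:
  fixes F :: "('n::finite \<Rightarrow> real) \<Rightarrow> complex"
  assumes aff: "\<And>d i t. (\<And>j. 0 \<le> d j) \<Longrightarrow> 0 \<le> t \<Longrightarrow>
      F (d(i := t)) = F (d(i := 0)) + complex_of_real t * (F (d(i := 1)) - F (d(i := 0)))"
    and hom: "\<And>d t. (\<And>j. 0 \<le> d j) \<Longrightarrow> 0 < t \<Longrightarrow> F (\<lambda>i. t * d i) = complex_of_real (t ^ k) * F d"
    and perm: "\<And>d p. (\<And>j. 0 \<le> d j) \<Longrightarrow> bij p \<Longrightarrow> F (\<lambda>i. d (p i)) = F d"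
  shows "\<exists>c. \<forall>d. (\<forall>j. 0 \<le> d j) \<longrightarrow> F d = c * complex_of_real (elem_sym k d)"
proof -
  have "\<exists>a. \<forall>d. (\<forall>j. 0 \<le> d j) \<longrightarrow> (\<forall>j. j \<notin> UNIV \<longrightarrow> d j = 0) \<longrightarrow>
      F d = (\<Sum>S\<in>Pow UNIV. a S * (\<Prod>i\<in>S. complex_of_real (d i)))"
    by (rule multiaffine_expansion[OF finite], rule aff) blast+
  then obtain a where a: "\<And>d. (\<forall>j. 0 \<le> d j) \<Longrightarrow> F d = (\<Sum>S\<in>UNIV. a S * (\<Prod>i\<in>S. complex_of_real (d i)))"
    unfolding Pow_UNIV by blast
  \<comment> \<open>At multiples of the indicator of \<open>T\<close> only the coefficients of
    subsets of \<open>T\<close> remain.\<close>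
  have ind: "F (\<lambda>i. if i \<in> T then t else 0) = (\<Sum>S\<in>Pow T. a S * complex_of_real t ^ card S)" if "0 \<le> t" for T t
  proof -
    have "F (\<lambda>i. if i \<in> T then t else 0) = (\<Sum>S\<in>UNIV. a S * (\<Prod>i\<in>S. complex_of_real (if i \<in> T then t else 0)))"
      using that by (intro a) auto
    also have "\<dots> = (\<Sum>S\<in>Pow T. a S * (\<Prod>i\<in>S. complex_of_real (if i \<in> T then t else 0)))"
    proof (rule sum.mono_neutral_right)
      show "\<forall>S\<in>UNIV - Pow T. a S * (\<Prod>i\<in>S. complex_of_real (if i \<in> T then t else 0)) = 0"
      proof
        fix S assume "S \<in> UNIV - Pow T"
        then obtain i where "i \<in> S" "i \<notin> T" by auto
        then have "(\<Prod>i\<in>S. complex_of_real (if i \<in> T then t else 0)) = 0" by (intro prod_zero) auto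
        then show "a S * (\<Prod>i\<in>S. complex_of_real (if i \<in> T then t else 0)) = 0" by simp
      qed
    qed auto
    also have "\<dots> = (\<Sum>S\<in>Pow T. a S * complex_of_real t ^ card S)"
    proof (rule sum.cong)
      fix S assume "S \<in> Pow T"
      then have "(\<Prod>i\<in>S. complex_of_real (if i \<in> T then t else 0)) = (\<Prod>i\<in>S. complex_of_real t)"
        by (intro prod.cong) auto
      then show "a S * (\<Prod>i\<in>S. complex_of_real (if i \<in> T then t else 0)) = a S * complex_of_real t ^ card S" by simp
    qed simp
    finally show ?thesis .
  qed
  \<comment> \<open>By induction the proper subsets of \<open>T\<close> contribute only in degree
    \<open>k\<close>, so comparing the arguments 1 and 2 leaves
    \<open>a T * 2 ^ card T = a T * 2 ^ k\<close>.\<close>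
  have zero: "a T = 0" if "card T \<noteq> k" for T
    using that
  proof (induction "card T" arbitrary: T rule: less_induct)
    case less
    have IH: "a S = 0" if "S \<in> Pow T - {T}" "card S \<noteq> k" for S
      using that by (intro less.hyps psubset_card_mono) auto
    have split: "(\<Sum>S\<in>Pow T. a S * complex_of_real t ^ card S) =
       a T * complex_of_real t ^ card T + complex_of_real t ^ k * (\<Sum>S\<in>Pow T - {T}. a S)" for t
    proof -
      have "(\<Sum>S\<in>Pow T - {T}. a S * complex_of_real t ^ card S) = (\<Sum>S\<in>Pow T - {T}. complex_of_real t ^ k * a S)"
      proof (rule sum.cong)
        fix S assume "S \<in> Pow T - {T}"
        then show "a S * complex_of_real t ^ card S = complex_of_real t ^ k * a S"
          using IH[of S] by (cases "card S = k") auto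
      qed simp
      then show ?thesis by (subst sum.remove[of _ T]) (auto simp: sum_distrib_left)
    qed
    have "F (\<lambda>i. 2 * (if i \<in> T then 1 else 0)) = complex_of_real (2 ^ k) * F (\<lambda>i. if i \<in> T then 1 else 0)"
      by (rule hom) auto
    moreover have "(\<lambda>i. 2 * (if i \<in> T then 1 else 0)) = (\<lambda>i. if i \<in> T then 2 else (0::real))" by auto
    ultimately have "F (\<lambda>i. if i \<in> T then 2 else 0) = 2 ^ k * F (\<lambda>i. if i \<in> T then 1 else 0)" by simp
    moreover have "F (\<lambda>i. if i \<in> T then 2 else 0) = a T * 2 ^ card T + 2 ^ k * (\<Sum>S\<in>Pow T - {T}. a S)"
      using ind[of 2 T] split[of 2] by simp
    moreover have "F (\<lambda>i. if i \<in> T then 1 else 0) = a T + (\<Sum>S\<in>Pow T - {T}. a S)"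
      using ind[of 1 T] split[of 1] by simp
    ultimately have "a T * 2 ^ card T + 2 ^ k * (\<Sum>S\<in>Pow T - {T}. a S) = 2 ^ k * (a T + (\<Sum>S\<in>Pow T - {T}. a S))"
      by simp
    then have "a T * 2 ^ card T = a T * 2 ^ k" by (simp add: distrib_left mult.commute)
    moreover have "(2::complex) ^ card T \<noteq> 2 ^ k"
    proof
      assume "(2::complex) ^ card T = 2 ^ k"
      then have "of_nat (2 ^ card T) = (of_nat (2 ^ k) :: complex)" by simp
      then have "(2::nat) ^ card T = 2 ^ k" unfolding of_nat_eq_iff .
      then show False using less.prems by simp
    qed
    ultimately show ?case by simp
  qed
  have same: "a S = a T" if c: "card S = k" "card T = k" for S T
  proof -
    have val: "F (\<lambda>i. if i \<in> S then 1 else 0) = a S" if c: "card S = k" for S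
    proof -
      have "(\<Sum>S'\<in>Pow S. a S' * complex_of_real 1 ^ card S') = (\<Sum>S'\<in>{S}. a S' * complex_of_real 1 ^ card S')"
      proof (rule sum.mono_neutral_right)
        show "\<forall>S'\<in>Pow S - {S}. a S' * complex_of_real 1 ^ card S' = 0"
        proof
          fix S' assume "S' \<in> Pow S - {S}"
          then have "card S' < card S" by (intro psubset_card_mono) auto
          then show "a S' * complex_of_real 1 ^ card S' = 0" using zero c by simp
        qed
      qed auto
      then show ?thesis using ind[of 1 S] by simp
    qed
    obtain f where f: "bij_betw f S T" using c by (metis finite_same_card_bij finite)
    \<comment> \<open>Complements of equal size allow the bijection from \<open>S\<close> to
      \<open>T\<close> to be extended to a permutation of all indices.\<close>
    have "card (- S) = card (- T)" using c by (simp add: Compl_eq_Diff_UNIV card_Diff_subset)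
    then obtain g where g: "bij_betw g (- S) (- T)" by (metis finite_same_card_bij finite)
    define p where "p = (\<lambda>i. if i \<in> S then f i else g i)"
    have "bij_betw p (S \<union> - S) (T \<union> - T)"
      unfolding p_def by (rule bij_betw_disjoint_Un[OF f g]) auto
    then have "bij p" by simp
    from perm[OF _ this, of "\<lambda>i. if i \<in> T then 1 else 0"]
    have "F (\<lambda>i. if p i \<in> T then 1 else 0) = F (\<lambda>i. if i \<in> T then 1 else 0)" by simp
    moreover have "p i \<in> T \<longleftrightarrow> i \<in> S" for i
      using f g unfolding p_def bij_betw_def by (cases "i \<in> S") auto
    ultimately show ?thesis using val c by simp
  qed
  \<comment> \<open>If no set has \<open>k\<close> elements, the choice is arbitrary and the sums
    below are empty.\<close>
  define c where "c = a (SOME S. card S = k)"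
  have "F d = c * complex_of_real (elem_sym k d)" if d: "\<forall>j. 0 \<le> d j" for d
  proof -
    have "F d = (\<Sum>S\<in>UNIV. a S * (\<Prod>i\<in>S. complex_of_real (d i)))" by (rule a[OF d])
    also have "\<dots> = (\<Sum>S\<in>{S. card S = k}. a S * (\<Prod>i\<in>S. complex_of_real (d i)))"
      by (rule sum.mono_neutral_right) (auto simp: zero)
    also have "\<dots> = (\<Sum>S\<in>{S. card S = k}. c * complex_of_real (\<Prod>i\<in>S. d i))"
    proof (rule sum.cong)
      fix S assume "S \<in> {S::'n set. card S = k}"
      then have "a S = c" unfolding c_def by (intro same) (auto intro: someI)
      then show "a S * (\<Prod>i\<in>S. complex_of_real (d i)) = c * complex_of_real (\<Prod>i\<in>S. d i)" by simp
    qed simp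
    finally show ?thesis by (simp add: elem_sym_def sum_distrib_left)
  qed
  then show ?thesis by blast
qed

text \<open>Otherwise \<open>cradon_vanish\<close> would give the unit cube volume 0. One such test
  function suffices to recover \<open>quad_val\<close> from integrals.\<close>

lemma Cc_integral_nonzero: "\<exists>\<phi>\<in>Cc. (LINT x|lborel. \<phi> x) \<noteq> (0::complex)"
proof (rule ccontr)
  assume none: "\<not> ?thesis"
  have c: "continuous_on UNIV (\<lambda>x::'a. 1::complex)" by simp
  have "density_measure (\<lambda>x::'a. 1) (cbox 0 One) = 0"
  proof (rule cradon_vanish[OF cradon_density_measure[OF c]])
    show "cint (density_measure (\<lambda>x. 1)) \<phi> = 0" if "\<phi> \<in> Cc" for \<phi> :: "'a \<Rightarrow> complex"
      using none that cint_density_measure[OF c bbf_Cc[OF that]] by auto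
  qed (auto simp: bborel_def)
  moreover have "density_measure (\<lambda>x::'a. 1) (cbox 0 One) = 1"
    by (simp add: density_measure_def bborel_def set_lebesgue_integral_def)
  ultimately show False by simp
qed

section \<open>Quadratic forms under the valuation\<close>

context ma_valuation
begin

lemma Conv_quad1: "quad1 e \<in> Conv"
proof -
  have "convex_on UNIV (\<lambda>u::real. u\<^sup>2 / 2)"
    by (rule f''_ge0_imp_convex[where f'="\<lambda>u. u" and f''="\<lambda>u. 1"]) (auto intro!: derivative_eq_intros)
  from Conv_ridge[OF this, of e] show ?thesis by (simp add: quad1_def[abs_def])
qed

text \<open>\<open>cint_ridge\<close> for a ridge of constant second derivative \<open>t\<close>,
  where the weighted test function is a multiple of \<open>\<phi>\<close>; equality of the integrals
  passes to the measures.\<close>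

lemma val_quad1_affine:
  assumes h: "h \<in> Conv" and t: "0 \<le> t"
  shows "\<Psi> (\<lambda>x. h x + t * quad1 e x) B = \<Psi> h B + complex_of_real t * (\<Psi> (\<lambda>x. h x + quad1 e x) B - \<Psi> h B)"
proof (cases "B \<in> bborel")
  case True
  have c1: "(\<lambda>x. h x + t * quad1 e x) \<in> Conv" "(\<lambda>x. h x + quad1 e x) \<in> Conv"
    using h t by (auto intro!: Conv_add Conv_cmult Conv_quad1)
  define \<nu> where "\<nu> = (\<lambda>B. complex_of_real (1 - t) * \<Psi> h B + complex_of_real t * \<Psi> (\<lambda>x. h x + quad1 e x) B)"
  have \<nu>: "cradon \<nu>" unfolding \<nu>_def using h c1 by (intro cradon_lincomb cradon_val)
  have "\<Psi> (\<lambda>x. h x + t * quad1 e x) B = \<nu> B"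
  proof (rule cradon_eqI[OF cradon_val[OF c1(1)] \<nu> _ True])
    fix \<phi> :: "'a \<Rightarrow> complex" assume \<phi>: "\<phi> \<in> Cc"
    have "convex_on UNIV (\<lambda>u::real. t * (u\<^sup>2 / 2))"
      using t by (intro f''_ge0_imp_convex[where f'="\<lambda>u. t * u" and f''="\<lambda>u. t"]) (auto intro!: derivative_eq_intros)
    then have "cint (\<Psi> (\<lambda>x. h x + t * ((e \<bullet> x)\<^sup>2 / 2))) \<phi> = cint (\<Psi> h) \<phi> +
      (cint (\<Psi> (\<lambda>x. h x + quad1 e x)) (\<lambda>x. \<phi> x * complex_of_real t) - cint (\<Psi> h) (\<lambda>x. \<phi> x * complex_of_real t))"
      using t \<phi> by (intro cint_ridge[OF h, where g="\<lambda>u. t * (u\<^sup>2 / 2)" and g'="\<lambda>u. t * u" and d="\<lambda>u. t"])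
        (auto intro!: derivative_eq_intros)
    then have "cint (\<Psi> (\<lambda>x. h x + t * quad1 e x)) \<phi> = cint (\<Psi> h) \<phi> +
      complex_of_real t * (cint (\<Psi> (\<lambda>x. h x + quad1 e x)) \<phi> - cint (\<Psi> h) \<phi>)"
      using cint_mult[OF cradon_val[OF h] bbf_Cc[OF \<phi>], of t] cint_mult[OF cradon_val[OF c1(2)] bbf_Cc[OF \<phi>], of t]
      by (simp add: quad1_def mult.commute algebra_simps)
    also have "\<dots> = cint \<nu> \<phi>"
      unfolding \<nu>_def cint_lincomb_measure[OF cradon_val[OF h] cradon_val[OF c1(2)] bbf_Cc[OF \<phi>]]
      by (simp add: algebra_simps)
    finally show "cint (\<Psi> (\<lambda>x. h x + t * quad1 e x)) \<phi> = cint \<nu> \<phi>" .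
  qed
  then show ?thesis by (simp add: \<nu>_def algebra_simps)
next
  case False
  have "(\<lambda>x. h x + t * quad1 e x) \<in> Conv" "(\<lambda>x. h x + quad1 e x) \<in> Conv"
    using h t by (auto intro!: Conv_add Conv_cmult Conv_quad1)
  then have "\<Psi> (\<lambda>x. h x + t * quad1 e x) B = 0" "\<Psi> (\<lambda>x. h x + quad1 e x) B = 0" "\<Psi> h B = 0"
    using False h cradon_val unfolding cradon_def by blast+
  then show ?thesis by simp
qed

lemmas val_translate = MA_conj[THEN conjunct2, THEN conjunct2, THEN conjunct2, THEN conjunct2, THEN conjunct2, THEN conjunct1, rule_format]
lemmas val_homogeneous = MA_conj[THEN conjunct2, THEN conjunct2, THEN conjunct2, THEN conjunct2, THEN conjunct2, THEN conjunct2, rule_format]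

end

locale so_valuation = ma_valuation k \<Psi> for k and \<Psi> :: "(real^'n \<Rightarrow> real) \<Rightarrow> (real^'n) set \<Rightarrow> complex" +
  assumes SO: "SO_equivariant \<Psi>"
begin

text \<open>The measure of a quadratic form is translation invariant, hence a multiple of Lebesgue measure;
  the multiple is read off on a cube of volume 1.\<close>

definition quad_val :: "real^'n^'n \<Rightarrow> complex" where
  "quad_val A = \<Psi> (quad A) (cbox (- One) 0)"

lemma val_quad:
  assumes A: "psd A" and B: "B \<in> bborel"
  shows "\<Psi> (quad A) B = quad_val A * measure lborel B"
  unfolding quad_val_def
proof (rule translation_invariant_cradon[OF cradon_val[OF Conv_quad[OF A]] _ B])
  fix B :: "(real^'n) set" and y assume B: "B \<in> bborel"
  have "\<Psi> (quad A) ((\<lambda>z. z + y) ` B) = \<Psi> (\<lambda>x. quad A (x + y)) B"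
    by (rule val_translate[symmetric, OF Conv_quad[OF A] B])
  also have "\<Psi> (\<lambda>x. quad A (x + y)) = \<Psi> (quad A)"
    by (rule val_affine[OF Conv_quad[OF A] quad_translate]) (use A in \<open>simp add: psd_def\<close>)
  finally show "\<Psi> (quad A) ((\<lambda>z. z + y) ` B) = \<Psi> (quad A) B" .
qed

lemma cint_val_quad:
  assumes A: "psd A" and \<phi>: "\<phi> \<in> Cc"
  shows "cint (\<Psi> (quad A)) \<phi> = (LINT x|lborel. \<phi> x * quad_val A)"
proof -
  have c: "continuous_on UNIV (\<lambda>x::real^'n. quad_val A)" by simp
  have "\<Psi> (quad A) = density_measure (\<lambda>x. quad_val A)"
  proof (rule cradon_ext[OF cradon_val[OF Conv_quad[OF A]] cradon_density_measure[OF c]])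
    fix B :: "(real^'n) set" assume B: "B \<in> bborel"
    have [measurable]: "B \<in> sets borel" using B by (rule bborel_borel)
    show "\<Psi> (quad A) B = density_measure (\<lambda>x. quad_val A) B"
      using val_quad[OF A B] B emeasure_bounded_finite[OF bborel_bounded[OF B]]
      by (simp add: density_measure_def set_lebesgue_integral_def scaleR_conv_of_real mult.commute)
  qed
  then show ?thesis using cint_density_measure[OF c bbf_Cc[OF \<phi>]] by simp
qed

lemma quad_val_outer:
  assumes A: "psd A" and t: "0 \<le> t"
  shows "quad_val (A + t *\<^sub>R outer e) = quad_val A + complex_of_real t * (quad_val (A + outer e) - quad_val A)"
proof -
  have "quad (A + t *\<^sub>R outer e) = (\<lambda>x. quad A x + t * quad1 e x)" for t
    by (simp add: fun_eq_iff quad_add quad_scale quad_outer quad1_def)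
  from this[of t] this[of 1] show ?thesis
    using val_quad1_affine[OF Conv_quad[OF A] t, of e] by (simp add: quad_val_def)
qed

lemma quad_val_scale:
  assumes A: "psd A" and t: "0 < t"
  shows "quad_val (t *\<^sub>R A) = complex_of_real (t ^ k) * quad_val A"
proof -
  have "quad (t *\<^sub>R A) = (\<lambda>x. t * quad A x)" by (simp add: fun_eq_iff quad_scale)
  then show ?thesis using val_homogeneous[OF Conv_quad[OF A] t, of "cbox (- One) 0"]
    by (simp add: quad_val_def bborel_def)
qed

text \<open>The two measures are compared on the unit ball, which rotations preserve and whose
  volume is positive.\<close>

lemma quad_val_rotate:
  assumes A: "psd A" and g: "g \<in> SOn"
  shows "quad_val (transpose g ** A ** g) = quad_val A"
proof -
  have o: "orthogonal_transformation ((*v) g)"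
    using g by (simp add: SOn_def orthogonal_transformation_matrix)
  have b: "{x. g *v x \<in> ball 0 1} = ball 0 1"
    using orthogonal_transformation_norm[OF o] by auto
  have "\<Psi> (\<lambda>x. quad A (g *v x)) {x. g *v x \<in> ball 0 1} = \<Psi> (quad A) (ball 0 1)"
    using SO g Conv_quad[OF A] bborel_ball unfolding SO_equivariant_def by blast
  then have "quad_val (transpose g ** A ** g) * measure lborel (ball (0::real^'n) 1) = quad_val A * measure lborel (ball (0::real^'n) 1)"
    unfolding b quad_congruence using val_quad[OF psd_congruence[OF A]] val_quad[OF A] by simp
  moreover have "measure lborel (ball (0::real^'n) 1) > 0" by (rule content_ball_pos) simp
  ultimately show ?thesis by simp
qed

text \<open>For determinant -1 the matrix \<open>Q\<close> is multiplied by a coordinate reflection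
  \<open>D\<close>. This makes it a rotation, and \<open>D\<close> drops out because
  \<open>D ** diagm d ** D = diagm d\<close>.\<close>

lemma quad_val_diagonal:
  assumes Q: "orthogonal_matrix Q" and d: "\<And>i. 0 \<le> d i"
  shows "quad_val (Q ** diagm d ** transpose Q) = quad_val (diagm d)"
proof -
  define R :: "real^'n^'n" where "R = (if det Q = 1 then Q else Q ** diagm (\<lambda>i. if i = (SOME i. True) then - 1 else 1))"
  define D :: "real^'n^'n" where "D = diagm (\<lambda>i. if i = (SOME i. True) then - 1 else 1)"
  have dd: "diagm a ** diagm b = diagm (\<lambda>i. a i * b i)" for a b :: "'n \<Rightarrow> real"
  proof -
    have "(diagm a ** diagm b) $ i $ j = (\<Sum>l\<in>UNIV. (if i = l then a i else 0) * (if l = j then b l else 0))" for i j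
      by (simp add: matrix_matrix_mult_def diagm_def)
    also have "\<dots> i j = (\<Sum>l\<in>UNIV. if l = i then (if i = j then a i * b i else 0) else 0)" for i j
      by (intro sum.cong) auto
    finally have "(diagm a ** diagm b) $ i $ j = (if i = j then a i * b i else 0)" for i j by simp
    then show ?thesis by (simp add: vec_eq_iff diagm_def)
  qed
  have tD: "transpose D = D" by (auto simp: D_def diagm_def transpose_def vec_eq_iff)
  have DD: "D ** D = mat 1" unfolding D_def dd by (auto simp: diagm_def mat_def vec_eq_iff)
  have DdD: "D ** diagm d ** D = diagm d"
    unfolding D_def dd by (intro arg_cong[where f=diagm]) auto
  have "det D = (\<Prod>i\<in>(UNIV::'n set). if i = (SOME i. True) then - 1 else 1)"
    by (subst det_diagonal) (auto simp: D_def diagm_def)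
  then have detD: "det D = - 1"
    using prod.delta[of UNIV "SOME i::'n. True" "\<lambda>_. - 1 :: real"] by simp
  have oD: "orthogonal_matrix D" using tD DD by (simp add: orthogonal_matrix_def)
  have RQ: "R = (if det Q = 1 then Q else Q ** D)" by (simp add: R_def D_def)
  have oR: "orthogonal_matrix R" unfolding RQ using Q oD by (simp add: orthogonal_matrix_mul)
  have "det Q = 1 \<or> det Q = - 1" by (rule det_orthogonal_matrix[OF Q])
  then have detR: "det R = 1" unfolding RQ by (auto simp: det_mul detD)
  have "Q ** diagm d ** transpose Q = R ** diagm d ** transpose R"
  proof (cases "det Q = 1")
    case False
    then have "R ** diagm d ** transpose R = Q ** (D ** diagm d ** D) ** transpose Q"
      by (simp add: RQ matrix_transpose_mul tD matrix_mul_assoc)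
    then show ?thesis by (simp add: DdD)
  qed (simp add: RQ)
  moreover have "transpose R \<in> SOn" using oR detR by (simp add: SOn_def orthogonal_matrix_def)
  ultimately show ?thesis using quad_val_rotate[OF psd_diagm[of d], of "transpose R"] d by simp
qed

lemma quad_val_eq_sigma: "\<exists>c. \<forall>A. psd A \<longrightarrow> quad_val A = c * complex_of_real (sigma_eig k A)"
proof -
  have "\<exists>c. \<forall>d. (\<forall>j. 0 \<le> d j) \<longrightarrow> quad_val (diagm d) = c * complex_of_real (elem_sym k d)"
  proof (rule homogeneous_symmetric_multiaffine)
    fix d :: "'n \<Rightarrow> real" and i and t :: real assume d: "\<And>j. 0 \<le> d j" and t: "0 \<le> t"
    have "psd (diagm (d(i := 0)))" using d by (intro psd_diagm) auto
    from quad_val_outer[OF this, of _ "axis i 1"] show "quad_val (diagm (d(i := t))) = quad_val (diagm (d(i := 0))) +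
        complex_of_real t * (quad_val (diagm (d(i := 1))) - quad_val (diagm (d(i := 0))))"
      using t diagm_upd[of d i t] diagm_upd[of d i 1] by simp
  next
    fix d :: "'n \<Rightarrow> real" and t :: real assume d: "\<And>j. 0 \<le> d j" and t: "0 < t"
    have "diagm (\<lambda>i. t * d i) = t *\<^sub>R diagm d" by (simp add: diagm_def vec_eq_iff)
    then show "quad_val (diagm (\<lambda>i. t * d i)) = complex_of_real (t ^ k) * quad_val (diagm d)"
      using quad_val_scale[OF psd_diagm t, of d] d by simp
  next
    fix d :: "'n \<Rightarrow> real" and p assume d: "\<And>j. 0 \<le> d j" and p: "bij (p :: 'n \<Rightarrow> 'n)"
    show "quad_val (diagm (\<lambda>i. d (p i))) = quad_val (diagm d)"
      unfolding permutation_matrix_orthogonal(2)[OF p refl]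
      by (rule quad_val_diagonal[OF permutation_matrix_orthogonal(1)[OF p refl] d])
  qed
  then obtain c where c: "\<And>d. (\<And>j. 0 \<le> d j) \<Longrightarrow> quad_val (diagm d) = c * complex_of_real (elem_sym k d)" by blast
  \<comment> \<open>This holds for every diagonalisation of \<open>A\<close>, which yields the
    uniqueness asked for by \<open>sigma_eig_eqI\<close>.\<close>
  have val: "quad_val A = c * complex_of_real (elem_sym k d)"
    if A: "psd A" "orthogonal_matrix Q" "A = Q ** diagm d ** transpose Q" for A Q d
    using quad_val_diagonal[OF A(2), of d] c[of d] eigenvalue_nonneg[OF A] A(3) by metis
  have "quad_val A = c * complex_of_real (sigma_eig k A)" if A: "psd A" for A
  proof -
    obtain Q d where Q: "orthogonal_matrix Q" "A = Q ** diagm d ** transpose Q"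
      using symmetric_diagonalisation[of A] A unfolding psd_def by blast
    show ?thesis
    proof (cases "c = 0")
      \<comment> \<open>For \<open>c = 0\<close> nothing about \<open>elem_sym\<close> can be
        inferred from \<open>quad_val\<close>, but both sides are 0.\<close>
      case True then show ?thesis using val[OF A Q] by simp
    next
      case False
      have "sigma_eig k A = elem_sym k d"
      proof (rule sigma_eig_eqI[OF Q])
        fix Q' d' assume "orthogonal_matrix Q'" "A = Q' ** diagm d' ** transpose Q'"
        then have "c * complex_of_real (elem_sym k d') = c * complex_of_real (elem_sym k d)"
          using val[OF A] Q by metis
        then show "elem_sym k d' = elem_sym k d" using False by simp
      qed
      then show ?thesis using val[OF A Q] by simp
    qed
  qed
  then show ?thesis by blast
qed

text \<open>For a test function of nonzero integral, integration against
  \<open>\<Psi> (quad A)\<close> gives a fixed nonzero multiple of \<open>quad_val A\<close>, so the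
  continuity of \<open>\<Psi>\<close> is inherited.\<close>

lemma continuous_quad_val: "continuous_on {A. psd A} quad_val"
  unfolding continuous_on_sequentially
proof (intro allI ballI impI, elim conjE)
  fix As :: "nat \<Rightarrow> real^'n^'n" and A
  assume A: "A \<in> {A. psd A}" "\<forall>n. As n \<in> {A. psd A}" "As \<longlonglongrightarrow> A"
  obtain \<phi> :: "real^'n \<Rightarrow> complex" where \<phi>: "\<phi> \<in> Cc" "(LINT x|lborel. \<phi> x) \<noteq> 0"
    using Cc_integral_nonzero by blast
  have "(\<lambda>j. cint (\<Psi> (quad (As j))) \<phi>) \<longlonglongrightarrow> cint (\<Psi> (quad A)) \<phi>"
    using A by (intro val_continuous Conv_quad loc_unif_conv_quad \<phi>) auto
  then have "(\<lambda>j. (LINT x|lborel. \<phi> x) * quad_val (As j)) \<longlonglongrightarrow> (LINT x|lborel. \<phi> x) * quad_val A"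
    using A cint_val_quad[OF _ \<phi>(1)] by simp
  then have "(\<lambda>j. (1 / (LINT x|lborel. \<phi> x)) * ((LINT x|lborel. \<phi> x) * quad_val (As j)))
      \<longlonglongrightarrow> (1 / (LINT x|lborel. \<phi> x)) * ((LINT x|lborel. \<phi> x) * quad_val A)"
    by (rule tendsto_mult_left)
  then show "(quad_val \<circ> As) \<longlonglongrightarrow> quad_val A" using \<phi>(2) by (simp add: o_def)
qed

end

section \<open>Functions of class C2\<close>

lemma C2_hessian_gradient:
  assumes "C2_hessian f H"
  obtains G where "\<And>x. (f has_derivative (\<lambda>v. G x \<bullet> v)) (at x)" "\<And>x. (G has_derivative (\<lambda>v. H x *v v)) (at x)"
    "continuous_on UNIV H"
  using assms unfolding C2_hessian_def by blast

lemma continuous_on_bilinear_form: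
  fixes M :: "'a::topological_space \<Rightarrow> real^'n^'n"
  assumes "continuous_on S M" shows "continuous_on S (\<lambda>x. v \<bullet> (M x *v w))"
  unfolding inner_vec_def matrix_vector_mult_def
  by (simp, intro continuous_intros continuous_on_component assms)

lemma C2_hessian_line:
  fixes f :: "real^'n \<Rightarrow> real" and H :: "real^'n \<Rightarrow> real^'n^'n"
  assumes G: "\<And>x. (f has_derivative (\<lambda>v. G x \<bullet> v)) (at x)" "\<And>x. (G has_derivative (\<lambda>v. H x *v v)) (at x)"
  shows "((\<lambda>t. f (x + t *\<^sub>R v)) has_real_derivative G (x + t *\<^sub>R v) \<bullet> v) (at t)"
    and "((\<lambda>t. G (x + t *\<^sub>R v) \<bullet> w) has_real_derivative w \<bullet> (H (x + t *\<^sub>R v) *v v)) (at t)"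
proof -
  have l: "((\<lambda>t. x + t *\<^sub>R v) has_derivative (\<lambda>s. s *\<^sub>R v)) (at t)" for t :: real
    by (auto intro!: derivative_eq_intros)
  have "((\<lambda>t. f (x + t *\<^sub>R v)) has_derivative (\<lambda>s. G (x + t *\<^sub>R v) \<bullet> (s *\<^sub>R v))) (at t)"
    using has_derivative_compose[OF l G(1)] .
  then show "((\<lambda>t. f (x + t *\<^sub>R v)) has_real_derivative G (x + t *\<^sub>R v) \<bullet> v) (at t)"
    unfolding has_field_derivative_def by (rule has_derivative_eq_rhs) (auto simp: mult.commute)
  have "((\<lambda>t. G (x + t *\<^sub>R v)) has_derivative (\<lambda>s. H (x + t *\<^sub>R v) *v (s *\<^sub>R v))) (at t)"
    using has_derivative_compose[OF l G(2)] .
  then have "((\<lambda>t. G (x + t *\<^sub>R v) \<bullet> w) has_derivative (\<lambda>s. (H (x + t *\<^sub>R v) *v (s *\<^sub>R v)) \<bullet> w)) (at t)"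
    by (rule has_derivative_inner_left)
  then show "((\<lambda>t. G (x + t *\<^sub>R v) \<bullet> w) has_real_derivative w \<bullet> (H (x + t *\<^sub>R v) *v v)) (at t)"
    unfolding has_field_derivative_def
    by (rule has_derivative_eq_rhs) (auto simp: matrix_vector_mult_scaleR inner_commute mult.commute)
qed

lemma C2_taylor:
  fixes f :: "real^'n \<Rightarrow> real" and H :: "real^'n \<Rightarrow> real^'n^'n"
  assumes G: "\<And>x. (f has_derivative (\<lambda>v. G x \<bullet> v)) (at x)" "\<And>x. (G has_derivative (\<lambda>v. H x *v v)) (at x)"
    and t: "0 < t"
  shows "\<exists>s. 0 < s \<and> s < t \<and> f (x + t *\<^sub>R v) = f x + t * (G x \<bullet> v) + t\<^sup>2 / 2 * (v \<bullet> (H (x + s *\<^sub>R v) *v v))"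
proof -
  define D where "D = (\<lambda>(m::nat) s. if m = 0 then f (x + s *\<^sub>R v) else if m = 1 then G (x + s *\<^sub>R v) \<bullet> v
    else v \<bullet> (H (x + s *\<^sub>R v) *v v))"
  have "\<exists>s. 0 < s \<and> s < t \<and> f (x + t *\<^sub>R v) = (\<Sum>m<2. D m 0 / fact m * t ^ m) + D 2 s / fact 2 * t ^ 2"
  proof (rule Maclaurin[OF t])
    show "\<forall>m s. m < 2 \<and> 0 \<le> s \<and> s \<le> t \<longrightarrow> (D m has_real_derivative D (Suc m) s) (at s)"
      using C2_hessian_line[OF G, of x v] by (auto simp: D_def less_2_cases_iff)
  qed (auto simp: D_def)
  then show ?thesis by (auto simp: D_def numeral_2_eq_2 mult_ac)
qed

text \<open>Taylor's formula in the directions \<open>v\<close> and \<open>- v\<close>, where the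
  first order terms cancel. The exact form serves twice: for the limit at 0 and for a bound uniform
  in \<open>t\<close>.\<close>

lemma second_difference:
  fixes f :: "real^'n \<Rightarrow> real" and H :: "real^'n \<Rightarrow> real^'n^'n"
  assumes G: "\<And>x. (f has_derivative (\<lambda>v. G x \<bullet> v)) (at x)" "\<And>x. (G has_derivative (\<lambda>v. H x *v v)) (at x)"
    and t: "0 < t"
  shows "\<exists>s s'. \<bar>s\<bar> \<le> t \<and> \<bar>s'\<bar> \<le> t \<and> (f (x + t *\<^sub>R v) + f (x - t *\<^sub>R v) - 2 * f x) / t\<^sup>2
    = (v \<bullet> (H (x + s *\<^sub>R v) *v v) + v \<bullet> (H (x + s' *\<^sub>R v) *v v)) / 2"
proof -
  obtain s where s: "0 < s" "s < t" "f (x + t *\<^sub>R v) = f x + t * (G x \<bullet> v) + t\<^sup>2 / 2 * (v \<bullet> (H (x + s *\<^sub>R v) *v v))"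
    using C2_taylor[OF G t, of x v] by blast
  obtain s' where s': "0 < s'" "s' < t"
    "f (x + t *\<^sub>R (- v)) = f x + t * (G x \<bullet> (- v)) + t\<^sup>2 / 2 * ((- v) \<bullet> (H (x + s' *\<^sub>R (- v)) *v (- v)))"
    using C2_taylor[OF G t, of x "- v"] by blast
  have "H (x + s' *\<^sub>R (- v)) *v (- v) = - (H (x + (- s') *\<^sub>R v) *v v)"
    using matrix_vector_mult_scaleR[of "H (x + (- s') *\<^sub>R v)" "-1" v] by simp
  then have s'': "f (x - t *\<^sub>R v) = f x - t * (G x \<bullet> v) + t\<^sup>2 / 2 * (v \<bullet> (H (x + (- s') *\<^sub>R v) *v v))"
    using s'(3) by simp
  have "f (x + t *\<^sub>R v) + f (x - t *\<^sub>R v) - 2 * f x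
    = t\<^sup>2 * ((v \<bullet> (H (x + s *\<^sub>R v) *v v) + v \<bullet> (H (x + (- s') *\<^sub>R v) *v v)) / 2)"
    unfolding s(3) s'' by (simp add: algebra_simps)
  then show ?thesis using s s' t by (intro exI[of _ s] exI[of _ "- s'"]) simp
qed

lemma second_difference_limit:
  fixes f :: "real^'n \<Rightarrow> real" and H :: "real^'n \<Rightarrow> real^'n^'n"
  assumes G: "\<And>x. (f has_derivative (\<lambda>v. G x \<bullet> v)) (at x)" "\<And>x. (G has_derivative (\<lambda>v. H x *v v)) (at x)"
    and H: "continuous_on UNIV H"
  shows "((\<lambda>t. (f (x + t *\<^sub>R v) + f (x - t *\<^sub>R v) - 2 * f x) / t\<^sup>2) \<longlongrightarrow> v \<bullet> (H x *v v)) (at_right 0)"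
proof (rule tendstoI)
  fix e :: real assume e: "e > 0"
  have "isCont (\<lambda>s. v \<bullet> (H (x + s *\<^sub>R v) *v v)) 0"
  proof -
    have "continuous_on UNIV (\<lambda>s. v \<bullet> (H (x + s *\<^sub>R v) *v v))"
      by (intro continuous_on_bilinear_form continuous_on_compose2[OF H] continuous_intros) auto
    then show ?thesis by (simp add: continuous_on_eq_continuous_at)
  qed
  then obtain d where d: "d > 0" "\<And>s. \<bar>s\<bar> < d \<Longrightarrow> \<bar>v \<bullet> (H (x + s *\<^sub>R v) *v v) - v \<bullet> (H x *v v)\<bar> < e"
    using e unfolding continuous_at_eps_delta by (force simp: dist_real_def)
  show "\<forall>\<^sub>F t in at_right 0. dist ((f (x + t *\<^sub>R v) + f (x - t *\<^sub>R v) - 2 * f x) / t\<^sup>2) (v \<bullet> (H x *v v)) < e"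
    unfolding eventually_at_right_field
  proof (intro exI[of _ d] conjI allI impI)
    fix t assume t: "0 < t" "t < d"
    obtain s s' where s: "\<bar>s\<bar> \<le> t" "\<bar>s'\<bar> \<le> t" and eq: "(f (x + t *\<^sub>R v) + f (x - t *\<^sub>R v) - 2 * f x) / t\<^sup>2
      = (v \<bullet> (H (x + s *\<^sub>R v) *v v) + v \<bullet> (H (x + s' *\<^sub>R v) *v v)) / 2"
      using second_difference[OF G t(1), of x v] by blast
    have "\<bar>v \<bullet> (H (x + s *\<^sub>R v) *v v) - v \<bullet> (H x *v v)\<bar> < e" "\<bar>v \<bullet> (H (x + s' *\<^sub>R v) *v v) - v \<bullet> (H x *v v)\<bar> < e"
      using s t by (auto intro!: d(2))
    then show "dist ((f (x + t *\<^sub>R v) + f (x - t *\<^sub>R v) - 2 * f x) / t\<^sup>2) (v \<bullet> (H x *v v)) < e"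
      unfolding eq dist_real_def by (simp add: abs_less_iff field_simps)
  qed (rule d(1))
qed

text \<open>Schwarz's theorem. The mixed second difference is symmetric in \<open>v\<close> and
  \<open>w\<close>, and two applications of the mean value theorem express it by the Hessian near
  \<open>x\<close> in either order.\<close>

lemma C2_hessian_bilinear_symmetric:
  fixes f :: "real^'n \<Rightarrow> real" and H :: "real^'n \<Rightarrow> real^'n^'n"
  assumes G: "\<And>x. (f has_derivative (\<lambda>v. G x \<bullet> v)) (at x)" "\<And>x. (G has_derivative (\<lambda>v. H x *v v)) (at x)"
    and H: "continuous_on UNIV H"
  shows "v \<bullet> (H x *v w) = w \<bullet> (H x *v v)"
proof -
  have mvt: "\<exists>\<xi> \<eta>. 0 \<le> \<xi> \<and> \<xi> \<le> t \<and> 0 \<le> \<eta> \<and> \<eta> \<le> t \<and>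
    (f (x + t *\<^sub>R v + t *\<^sub>R w) - f (x + t *\<^sub>R v)) - (f (x + t *\<^sub>R w) - f x) = t * (t * (v \<bullet> (H (x + \<xi> *\<^sub>R v + \<eta> *\<^sub>R w) *v w)))"
    if t: "0 < t" for t v w
  proof -
    define F where "F = (\<lambda>s. f ((x + t *\<^sub>R w) + s *\<^sub>R v) - f (x + s *\<^sub>R v))"
    have "(F has_real_derivative G ((x + t *\<^sub>R w) + s *\<^sub>R v) \<bullet> v - G (x + s *\<^sub>R v) \<bullet> v) (at s)" for s
      unfolding F_def by (intro DERIV_diff C2_hessian_line[OF G])
    then obtain \<xi> where \<xi>: "0 < \<xi>" "\<xi> < t" "F t - F 0 = (t - 0) * (G ((x + t *\<^sub>R w) + \<xi> *\<^sub>R v) \<bullet> v - G (x + \<xi> *\<^sub>R v) \<bullet> v)"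
      using MVT2[OF t, of F "\<lambda>s. G ((x + t *\<^sub>R w) + s *\<^sub>R v) \<bullet> v - G (x + s *\<^sub>R v) \<bullet> v"] by blast
    have "((\<lambda>t. G ((x + \<xi> *\<^sub>R v) + t *\<^sub>R w) \<bullet> v) has_real_derivative v \<bullet> (H ((x + \<xi> *\<^sub>R v) + t *\<^sub>R w) *v w)) (at t)" for t
      by (rule C2_hessian_line[OF G])
    then obtain \<eta> where \<eta>: "0 < \<eta>" "\<eta> < t"
      "G ((x + \<xi> *\<^sub>R v) + t *\<^sub>R w) \<bullet> v - G ((x + \<xi> *\<^sub>R v) + 0 *\<^sub>R w) \<bullet> v = (t - 0) * (v \<bullet> (H ((x + \<xi> *\<^sub>R v) + \<eta> *\<^sub>R w) *v w))"
      using MVT2[OF t, of "\<lambda>t. G ((x + \<xi> *\<^sub>R v) + t *\<^sub>R w) \<bullet> v" "\<lambda>t. v \<bullet> (H ((x + \<xi> *\<^sub>R v) + t *\<^sub>R w) *v w)"]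
      by blast
    have "(f (x + t *\<^sub>R v + t *\<^sub>R w) - f (x + t *\<^sub>R v)) - (f (x + t *\<^sub>R w) - f x) = F t - F 0"
      by (simp add: F_def algebra_simps)
    also have "\<dots> = t * (t * (v \<bullet> (H (x + \<xi> *\<^sub>R v + \<eta> *\<^sub>R w) *v w)))"
      using \<xi>(3) \<eta>(3) by (simp add: add_ac)
    finally show ?thesis using \<xi> \<eta> by (intro exI[of _ \<xi>] exI[of _ \<eta>]) auto
  qed
  have close: "\<exists>d>0. \<forall>\<xi> \<eta>. \<bar>\<xi>\<bar> \<le> d \<longrightarrow> \<bar>\<eta>\<bar> \<le> d \<longrightarrow> \<bar>v \<bullet> (H (x + \<xi> *\<^sub>R v' + \<eta> *\<^sub>R w') *v w) - v \<bullet> (H x *v w)\<bar> < e"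
    if e: "0 < e" for e v w v' w'
  proof -
    have "continuous_on UNIV (\<lambda>p::real\<times>real. v \<bullet> (H (x + fst p *\<^sub>R v' + snd p *\<^sub>R w') *v w))"
      by (intro continuous_on_bilinear_form continuous_on_compose2[OF H] continuous_intros) auto
    then have "isCont (\<lambda>p::real\<times>real. v \<bullet> (H (x + fst p *\<^sub>R v' + snd p *\<^sub>R w') *v w)) (0, 0)"
      by (simp add: continuous_on_eq_continuous_at)
    then obtain d where d: "d > 0" "\<And>p. dist p (0, 0) < d \<Longrightarrow>
        \<bar>v \<bullet> (H (x + fst p *\<^sub>R v' + snd p *\<^sub>R w') *v w) - v \<bullet> (H x *v w)\<bar> < e"
      using e unfolding continuous_at_eps_delta by (force simp: dist_real_def)
    show ?thesis
    \<comment> \<open>Two offsets of at most \<open>d / 3\<close> have a sum below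
      \<open>d\<close>.\<close>
    proof (intro exI[of _ "d / 3"] conjI allI impI)
      fix \<xi> \<eta> assume "\<bar>\<xi>\<bar> \<le> d / 3" "\<bar>\<eta>\<bar> \<le> d / 3"
      then have "dist (\<xi>, \<eta>) (0, 0) < d"
        using d(1) sqrt_sum_squares_le_sum_abs[of \<xi> \<eta>] by (simp add: dist_Pair_Pair dist_real_def)
      from d(2)[OF this] show "\<bar>v \<bullet> (H (x + \<xi> *\<^sub>R v' + \<eta> *\<^sub>R w') *v w) - v \<bullet> (H x *v w)\<bar> < e" by simp
    qed (use d in simp)
  qed
  have "\<bar>v \<bullet> (H x *v w) - w \<bullet> (H x *v v)\<bar> \<le> e" if e: "0 < e" for e
  proof -
    obtain d1 where d1: "d1 > 0" "\<And>\<xi> \<eta>. \<bar>\<xi>\<bar> \<le> d1 \<Longrightarrow> \<bar>\<eta>\<bar> \<le> d1 \<Longrightarrow> \<bar>v \<bullet> (H (x + \<xi> *\<^sub>R v + \<eta> *\<^sub>R w) *v w) - v \<bullet> (H x *v w)\<bar> < e / 2"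
      using close[of "e / 2" v v w w] e by auto
    obtain d2 where d2: "d2 > 0" "\<And>\<xi> \<eta>. \<bar>\<xi>\<bar> \<le> d2 \<Longrightarrow> \<bar>\<eta>\<bar> \<le> d2 \<Longrightarrow> \<bar>w \<bullet> (H (x + \<xi> *\<^sub>R w + \<eta> *\<^sub>R v) *v v) - w \<bullet> (H x *v v)\<bar> < e / 2"
      using close[of "e / 2" w w v v] e by auto
    define t where "t = min d1 d2"
    have t: "0 < t" "t \<le> d1" "t \<le> d2" using d1 d2 by (auto simp: t_def)
    obtain a b where ab: "0 \<le> a" "a \<le> t" "0 \<le> b" "b \<le> t"
      "(f (x + t *\<^sub>R v + t *\<^sub>R w) - f (x + t *\<^sub>R v)) - (f (x + t *\<^sub>R w) - f x) = t * (t * (v \<bullet> (H (x + a *\<^sub>R v + b *\<^sub>R w) *v w)))"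
      using mvt[OF t(1), of v w] by blast
    obtain a' b' where ab': "0 \<le> a'" "a' \<le> t" "0 \<le> b'" "b' \<le> t"
      "(f (x + t *\<^sub>R w + t *\<^sub>R v) - f (x + t *\<^sub>R w)) - (f (x + t *\<^sub>R v) - f x) = t * (t * (w \<bullet> (H (x + a' *\<^sub>R w + b' *\<^sub>R v) *v v)))"
      using mvt[OF t(1), of w v] by blast
    have sw: "x + t *\<^sub>R w + t *\<^sub>R v = x + t *\<^sub>R v + t *\<^sub>R w" by simp
    have "t * (t * (v \<bullet> (H (x + a *\<^sub>R v + b *\<^sub>R w) *v w))) = t * (t * (w \<bullet> (H (x + a' *\<^sub>R w + b' *\<^sub>R v) *v v)))"
      using ab(5) ab'(5)[unfolded sw] by linarith
    then have "v \<bullet> (H (x + a *\<^sub>R v + b *\<^sub>R w) *v w) = w \<bullet> (H (x + a' *\<^sub>R w + b' *\<^sub>R v) *v v)"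
      using t by simp
    moreover have "\<bar>v \<bullet> (H (x + a *\<^sub>R v + b *\<^sub>R w) *v w) - v \<bullet> (H x *v w)\<bar> < e / 2"
      using ab t by (intro d1(2)) auto
    moreover have "\<bar>w \<bullet> (H (x + a' *\<^sub>R w + b' *\<^sub>R v) *v v) - w \<bullet> (H x *v v)\<bar> < e / 2"
      using ab' t by (intro d2(2)) auto
    ultimately show ?thesis by linarith
  qed
  then have "\<bar>v \<bullet> (H x *v w) - w \<bullet> (H x *v v)\<bar> \<le> 0" by (rule field_le_epsilon[of _ 0, simplified])
  then show ?thesis by simp
qed

lemma C2_hessian_symmetric:
  assumes "C2_hessian f H" shows "transpose (H x) = H x"
proof -
  obtain G where G: "\<And>x. (f has_derivative (\<lambda>v. G x \<bullet> v)) (at x)" "\<And>x. (G has_derivative (\<lambda>v. H x *v v)) (at x)"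
    "continuous_on UNIV H" using C2_hessian_gradient[OF assms] by blast
  have "H x $ i $ j = axis i 1 \<bullet> (H x *v axis j 1)" for i j
    by (simp add: inner_axis' matrix_vector_mult_basis column_def)
  then show ?thesis
    using C2_hessian_bilinear_symmetric[OF G] by (simp add: vec_eq_iff transpose_def)
qed

text \<open>Midpoint convexity makes second differences nonnegative, and the Hessian form is their
  limit.\<close>

lemma C2_convex_hessian_psd:
  assumes f: "f \<in> Conv" and H: "C2_hessian f H"
  shows "psd (H x)"
  unfolding psd_def
proof (intro conjI allI)
  show "transpose (H x) = H x" by (rule C2_hessian_symmetric[OF H])
  fix v
  obtain G where G: "\<And>x. (f has_derivative (\<lambda>v. G x \<bullet> v)) (at x)" "\<And>x. (G has_derivative (\<lambda>v. H x *v v)) (at x)"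
    "continuous_on UNIV H" using C2_hessian_gradient[OF H] by blast
  show "0 \<le> v \<bullet> (H x *v v)"
  proof (rule tendsto_lowerbound[OF second_difference_limit[OF G]])
    have "0 \<le> (f (x + t *\<^sub>R v) + f (x - t *\<^sub>R v) - 2 * f x) / t\<^sup>2" for t
    proof -
      have "f ((1 - 1/2) *\<^sub>R (x + t *\<^sub>R v) + (1/2) *\<^sub>R (x - t *\<^sub>R v)) \<le> (1 - 1/2) * f (x + t *\<^sub>R v) + (1/2) * f (x - t *\<^sub>R v)"
        using f by (intro convex_onD[of UNIV f]) (auto simp: Conv_def)
      moreover have "(1 - 1/2) *\<^sub>R (x + t *\<^sub>R v) + (1/2) *\<^sub>R (x - t *\<^sub>R v) = x"
        by (simp add: algebra_simps flip: scaleR_add_left)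
      ultimately show ?thesis by simp
    qed
    then show "\<forall>\<^sub>F t in at_right 0. 0 \<le> (f (x + t *\<^sub>R v) + f (x - t *\<^sub>R v) - 2 * f x) / t\<^sup>2" by simp
  qed simp
qed

lemma C2_psd_Conv:
  assumes H: "C2_hessian f H" and nn: "\<And>x v. 0 \<le> v \<bullet> (H x *v v)"
  shows "f \<in> Conv"
  unfolding Conv_def mem_Collect_eq
proof (rule convex_onI)
  fix t x y assume t: "(0::real) < t" "t < 1"
  obtain G where G: "\<And>x. (f has_derivative (\<lambda>v. G x \<bullet> v)) (at x)" "\<And>x. (G has_derivative (\<lambda>v. H x *v v)) (at x)"
    "continuous_on UNIV H" using C2_hessian_gradient[OF H] by blast
  have "convex_on UNIV (\<lambda>s. f (x + s *\<^sub>R (y - x)))"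
    by (rule f''_ge0_imp_convex[where f'="\<lambda>s. G (x + s *\<^sub>R (y - x)) \<bullet> (y - x)"
          and f''="\<lambda>s. (y - x) \<bullet> (H (x + s *\<^sub>R (y - x)) *v (y - x))"])
       (auto intro: C2_hessian_line[OF G(1,2)] nn)
  then have "f (x + ((1 - t) *\<^sub>R 0 + t *\<^sub>R 1) *\<^sub>R (y - x)) \<le> (1 - t) * f (x + 0 *\<^sub>R (y - x)) + t * f (x + 1 *\<^sub>R (y - x))"
    using t by (intro convex_onD[of UNIV]) auto
  moreover have "x + t *\<^sub>R (y - x) = (1 - t) *\<^sub>R x + t *\<^sub>R y" by (simp add: algebra_simps)
  ultimately show "f ((1 - t) *\<^sub>R x + t *\<^sub>R y) \<le> (1 - t) * f x + t * f y" by simp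
qed auto

section \<open>Calculus of Hessians and the cutoff\<close>

lemma C2_hessian_add:
  assumes "C2_hessian f H" "C2_hessian g K" shows "C2_hessian (\<lambda>x. f x + g x) (\<lambda>x. H x + K x)"
proof -
  obtain G where G: "\<And>x. (f has_derivative (\<lambda>v. G x \<bullet> v)) (at x)" "\<And>x. (G has_derivative (\<lambda>v. H x *v v)) (at x)"
    "continuous_on UNIV H" using C2_hessian_gradient[OF assms(1)] by blast
  obtain G' where G': "\<And>x. (g has_derivative (\<lambda>v. G' x \<bullet> v)) (at x)" "\<And>x. (G' has_derivative (\<lambda>v. K x *v v)) (at x)"
    "continuous_on UNIV K" using C2_hessian_gradient[OF assms(2)] by blast
  show ?thesis unfolding C2_hessian_def
  proof (intro exI[of _ "\<lambda>x. G x + G' x"] conjI allI)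
    show "((\<lambda>x. f x + g x) has_derivative (\<lambda>v. (G x + G' x) \<bullet> v)) (at x)" for x
      by (rule has_derivative_eq_rhs[OF has_derivative_add[OF G(1) G'(1)]]) (simp add: inner_add_left)
    show "((\<lambda>x. G x + G' x) has_derivative (\<lambda>v. (H x + K x) *v v)) (at x)" for x
      by (rule has_derivative_eq_rhs[OF has_derivative_add[OF G(2) G'(2)]]) (simp add: matrix_vector_mult_add_rdistrib)
  qed (intro continuous_intros G G')
qed

text \<open>\<open>G\<close> is the gradient of \<open>g\<close>; it is quantified existentially
  because \<open>C2_hessian\<close> records only that there is one.\<close>

lemma C2_hessian_compose:
  assumes g: "C2_hessian g K" and \<theta>: "\<And>t. (\<theta> has_real_derivative \<theta>' t) (at t)" "\<And>t. (\<theta>' has_real_derivative \<theta>'' t) (at t)"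
    and c: "continuous_on UNIV \<theta>''"
  shows "\<exists>G. C2_hessian (\<lambda>x. \<theta> (g x)) (\<lambda>x. \<theta>' (g x) *\<^sub>R K x + \<theta>'' (g x) *\<^sub>R outer (G x))"
proof -
  obtain G where G: "\<And>x. (g has_derivative (\<lambda>v. G x \<bullet> v)) (at x)" "\<And>x. (G has_derivative (\<lambda>v. K x *v v)) (at x)"
    "continuous_on UNIV K" using C2_hessian_gradient[OF g] by blast
  have cont: "continuous_on UNIV g" "continuous_on UNIV G" "continuous_on UNIV \<theta>'"
    using G \<theta> by (auto intro!: has_derivative_continuous_on DERIV_continuous_on intro: has_derivative_at_withinI)
  have comp: "((\<lambda>x. \<alpha> (g x)) has_derivative (\<lambda>v. \<alpha>' (g x) * (G x \<bullet> v))) (at x)"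
    if "\<And>t. (\<alpha> has_real_derivative \<alpha>' t) (at t)" for \<alpha> \<alpha>' x
    using has_derivative_compose[OF G(1) that[unfolded has_field_derivative_def]] by simp
  have "C2_hessian (\<lambda>x. \<theta> (g x)) (\<lambda>x. \<theta>' (g x) *\<^sub>R K x + \<theta>'' (g x) *\<^sub>R outer (G x))"
    unfolding C2_hessian_def
  proof (intro exI[of _ "\<lambda>x. \<theta>' (g x) *\<^sub>R G x"] conjI allI)
    show "((\<lambda>x. \<theta> (g x)) has_derivative (\<lambda>v. (\<theta>' (g x) *\<^sub>R G x) \<bullet> v)) (at x)" for x
      using comp[OF \<theta>(1)] by simp
    show "((\<lambda>x. \<theta>' (g x) *\<^sub>R G x) has_derivative (\<lambda>v. (\<theta>' (g x) *\<^sub>R K x + \<theta>'' (g x) *\<^sub>R outer (G x)) *v v)) (at x)" for x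
      by (rule has_derivative_eq_rhs[OF has_derivative_scaleR[OF comp[OF \<theta>(2)] G(2)]])
         (simp add: matrix_vector_mult_add_rdistrib scaleR_matrix_vector outer_vector)
    have "continuous_on UNIV (\<lambda>x. outer (G x))"
      unfolding outer_def by (intro continuous_intros cont continuous_on_vec_lambda continuous_on_component)
    then show "continuous_on UNIV (\<lambda>x. \<theta>' (g x) *\<^sub>R K x + \<theta>'' (g x) *\<^sub>R outer (G x))"
      by (intro continuous_intros G(3) continuous_on_compose2[OF cont(3) cont(1)] continuous_on_compose2[OF c cont(1)]) auto
  qed
  then show ?thesis by blast
qed

lemma C2_hessian_affine: "C2_hessian (\<lambda>x. a \<bullet> x + b) (\<lambda>x. 0)"
  unfolding C2_hessian_def
  by (intro exI[of _ "\<lambda>x. a"]) (auto intro!: derivative_eq_intros)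

lemma C2_hessian_quad:
  assumes A: "transpose A = A" shows "C2_hessian (quad A) (\<lambda>x. A)"
  unfolding C2_hessian_def
proof (intro exI[of _ "\<lambda>x. A *v x"] conjI allI)
  have l: "((\<lambda>x. A *v x) has_derivative (\<lambda>v. A *v v)) (at x)" for x
    by (rule bounded_linear_imp_has_derivative) (simp add: linear_conv_bounded_linear[symmetric])
  then show "((\<lambda>x. A *v x) has_derivative (\<lambda>v. A *v v)) (at x)" for x .
  show "(quad A has_derivative (\<lambda>v. (A *v x) \<bullet> v)) (at x)" for x
    unfolding quad_def[abs_def]
  proof -
    have "((\<lambda>x. (1/2) *\<^sub>R (x \<bullet> (A *v x))) has_derivative (\<lambda>v. (1/2) *\<^sub>R (x \<bullet> (A *v v) + v \<bullet> (A *v x)))) (at x)"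
      by (intro has_derivative_scaleR_right has_derivative_inner has_derivative_ident l)
    moreover have "(1/2) *\<^sub>R (x \<bullet> (A *v v) + v \<bullet> (A *v x)) = (A *v x) \<bullet> v" for v
      using symmetric_dot[OF A, of x v] by (simp add: inner_commute)
    ultimately show "((\<lambda>x. x \<bullet> (A *v x) / 2) has_derivative (\<lambda>v. (A *v x) \<bullet> v)) (at x)" by simp
  qed
qed simp

text \<open>Away from the knot one of two polynomials is differentiated; at the knot the difference
  quotient is bounded by a positive power that vanishes there.\<close>

lemma truncated_power_deriv:
  "((\<lambda>t::real. (max 0 (t - a)) ^ Suc (Suc m)) has_real_derivative real (Suc (Suc m)) * (max 0 (t - a)) ^ Suc m) (at t)"
proof -
  consider "t < a" | "t > a" | "t = a" by linarith
  then show ?thesis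
  proof cases
    case 1
    have "((\<lambda>t. 0) has_real_derivative real (Suc (Suc m)) * (max 0 (t - a)) ^ Suc m) (at t)" using 1 by simp
    then show ?thesis
      by (rule has_field_derivative_transform_within_open[where S="{..<a}"]) (use 1 in auto)
  next
    case 2
    have "((\<lambda>t. (t - a) ^ Suc (Suc m)) has_real_derivative real (Suc (Suc m)) * (max 0 (t - a)) ^ Suc m) (at t)"
      using 2 by (auto intro!: derivative_eq_intros simp del: power_Suc of_nat_Suc)
    then show ?thesis
      by (rule has_field_derivative_transform_within_open[where S="{a<..}"]) (use 2 in auto)
  next
    case 3
    have "((\<lambda>s. (max 0 (s - a)) ^ Suc m) \<longlongrightarrow> (max 0 (a - a)) ^ Suc m) (at a)"
      by (intro tendsto_intros)
    then have "((\<lambda>s. (max 0 (s - a)) ^ Suc m) \<longlongrightarrow> 0) (at a)" by simp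
    then have "((\<lambda>s. (max 0 (s - a)) ^ Suc (Suc m) / (s - a)) \<longlongrightarrow> 0) (at a)"
      by (rule Lim_null_comparison[rotated])
         (auto simp: eventually_at_filter abs_mult power_abs divide_simps max_def intro!: always_eventually)
    then show ?thesis using 3 by (simp add: has_field_derivative_iff)
  qed
qed

text \<open>A C2 spline that is the identity up to 0 and constant from 2 on.\<close>

definition cut :: "real \<Rightarrow> real" where
  "cut t = t - (max 0 t) ^ 3 / 6 + (max 0 (t - 1)) ^ 3 / 3 - (max 0 (t - 2)) ^ 3 / 6"
definition cut' :: "real \<Rightarrow> real" where
  "cut' t = 1 - (max 0 t) ^ 2 / 2 + (max 0 (t - 1)) ^ 2 - (max 0 (t - 2)) ^ 2 / 2"
definition cut'' :: "real \<Rightarrow> real" where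
  "cut'' t = - max 0 t + 2 * max 0 (t - 1) - max 0 (t - 2)"

lemma cut_deriv: "(cut has_real_derivative cut' t) (at t)" "(cut' has_real_derivative cut'' t) (at t)"
proof -
  have d3: "((\<lambda>t. (max 0 (t - a)) ^ 3) has_real_derivative 3 * (max 0 (t - a)) ^ 2) (at t)" for a
    using truncated_power_deriv[of a 1 t] by (simp add: numeral_2_eq_2 numeral_3_eq_3)
  have d2: "((\<lambda>t. (max 0 (t - a)) ^ 2) has_real_derivative 2 * max 0 (t - a)) (at t)" for a
    using truncated_power_deriv[of a 0 t] by (simp add: numeral_2_eq_2)
  show "(cut has_real_derivative cut' t) (at t)"
    unfolding cut_def[abs_def] cut'_def
    by (rule DERIV_cong[OF DERIV_diff[OF DERIV_add[OF DERIV_diff[OF DERIV_ident DERIV_cdivide[OF d3[of 0, simplified]]]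
        DERIV_cdivide[OF d3[of 1]]] DERIV_cdivide[OF d3[of 2]]]]) simp
  show "(cut' has_real_derivative cut'' t) (at t)"
    unfolding cut'_def[abs_def] cut''_def
    by (rule DERIV_cong[OF DERIV_diff[OF DERIV_add[OF DERIV_diff[OF DERIV_const DERIV_cdivide[OF d2[of 0, simplified]]]
        d2[of 1]] DERIV_cdivide[OF d2[of 2]]]]) simp
qed

lemma cut_low: "t \<le> 0 \<Longrightarrow> cut t = t \<and> cut' t = 1 \<and> cut'' t = 0"
  by (simp add: cut_def cut'_def cut''_def)

lemma cut_high: "2 \<le> t \<Longrightarrow> cut t = 1 \<and> cut' t = 0 \<and> cut'' t = 0"
  by (simp add: cut_def cut'_def cut''_def power3_eq_cube power2_eq_square field_simps)

text \<open>The cutoff of a convex C2 function is obtained by composing with \<open>cut\<close>; subtracting a tangent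
  plane and adding the squared norm makes the sublevel sets bounded.\<close>

lemma C2_cutoff:
  fixes f :: "real^'n \<Rightarrow> real"
  assumes f: "f \<in> Conv" and H: "C2_hessian f H"
  shows "\<exists>u K a b r. C2_hessian u K \<and> r > 0 \<and> (\<forall>x. norm x > r \<longrightarrow> u x = 0 \<and> K x = 0) \<and>
    (\<forall>x\<in>cball 0 R. u x = f x + quad (mat 1) x + (a \<bullet> x + b) \<and> K x = H x + mat 1)"
proof -
  obtain G where G: "\<And>x. (f has_derivative (\<lambda>v. G x \<bullet> v)) (at x)" "\<And>x. (G has_derivative (\<lambda>v. H x *v v)) (at x)"
    "continuous_on UNIV H" using C2_hessian_gradient[OF H] by blast
  have q: "quad (mat 1) x = (norm x)\<^sup>2 / 2" for x :: "real^'n"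
    by (simp add: quad_def power2_norm_eq_inner)
  define g where "g = (\<lambda>x. f x + quad (mat 1) x + ((- G 0) \<bullet> x + (- f 0)))"
  have lower: "(norm x)\<^sup>2 / 2 \<le> g x" for x
  proof -
    obtain s where "f (0 + 1 *\<^sub>R x) = f 0 + 1 * (G 0 \<bullet> x) + 1\<^sup>2 / 2 * (x \<bullet> (H (0 + s *\<^sub>R x) *v x))"
      using C2_taylor[OF G(1,2), of 1 0 x] by auto
    moreover have "0 \<le> x \<bullet> (H (0 + s *\<^sub>R x) *v x)"
      using C2_convex_hessian_psd[OF f H] unfolding psd_def by blast
    ultimately show ?thesis by (simp add: g_def q)
  qed
  have gH: "C2_hessian g (\<lambda>x. H x + mat 1)"
    using C2_hessian_add[OF C2_hessian_add[OF H C2_hessian_quad[of "mat 1"]] C2_hessian_affine[of "- G 0" "- f 0"]]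
    by (simp add: g_def)
  then obtain G' where "\<And>x. (g has_derivative (\<lambda>v. G' x \<bullet> v)) (at x)" using C2_hessian_gradient by blast
  then have "continuous_on (cball 0 R) g" by (auto intro!: has_derivative_continuous_on intro: has_derivative_at_withinI)
  then have "compact (g ` cball 0 R)" by (intro compact_continuous_image compact_cball)
  then obtain c where c0: "c > 0" "\<forall>y\<in>g ` cball 0 R. norm y \<le> c"
    using compact_imp_bounded[of "g ` cball 0 R"] unfolding bounded_pos by blast
  have c: "c > 0" "\<And>x. x \<in> cball 0 R \<Longrightarrow> g x \<le> c" using c0 by (auto simp: abs_le_iff)
  have sh: "((\<lambda>t. \<theta> (t - c)) has_real_derivative \<theta>' (t - c)) (at t)"
    if "\<And>t. (\<theta> has_real_derivative \<theta>' t) (at t)" for \<theta> \<theta>' and t :: real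
    using DERIV_shift[of \<theta> "\<theta>' (t - c)" t "- c"] that by simp
  have "continuous_on UNIV (\<lambda>t. cut'' (t - c))" unfolding cut''_def by (intro continuous_intros)
  then obtain G' where G': "C2_hessian (\<lambda>x. cut (g x - c)) (\<lambda>x. cut' (g x - c) *\<^sub>R (H x + mat 1) + cut'' (g x - c) *\<^sub>R outer (G' x))"
    using C2_hessian_compose[OF gH sh[OF cut_deriv(1)] sh[OF cut_deriv(2)]] by blast
  \<comment> \<open>The plateau value of \<open>cut\<close> is 1; subtracting it gives compact
    support.\<close>
  define u where "u = (\<lambda>x. cut (g x - c) + (0 \<bullet> x + (- 1)))"
  define K where "K = (\<lambda>x. cut' (g x - c) *\<^sub>R (H x + mat 1) + cut'' (g x - c) *\<^sub>R outer (G' x) + 0)"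
  have 1: "C2_hessian u K" unfolding u_def K_def by (rule C2_hessian_add[OF G' C2_hessian_affine])
  \<comment> \<open>Beyond the radius \<open>c + 2\<close> the lower bound
    \<open>(norm x)\<^sup>2 / 2\<close> for \<open>g\<close> is at least \<open>c + 2\<close>, since
    \<open>c + 2 \<ge> 2\<close>, and \<open>cut\<close> has reached its plateau.\<close>
  define r where "r = c + 2"
  have 2: "u x = 0 \<and> K x = 0" if "norm x > r" for x
  proof -
    have "2 * (c + 2) \<le> (c + 2) * (c + 2)" using c by (intro mult_right_mono) auto
    also have "\<dots> \<le> norm x * norm x" using that c by (intro mult_mono) (auto simp: r_def)
    finally have "g x - c \<ge> 2" using lower[of x] by (simp add: power2_eq_square)
    from cut_high[OF this] show ?thesis by (simp add: u_def K_def)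
  qed
  have 3: "u x = f x + quad (mat 1) x + ((- G 0) \<bullet> x + (- f 0 - c - 1)) \<and> K x = H x + mat 1" if "x \<in> cball 0 R" for x
    using cut_low[of "g x - c"] c(2)[OF that] by (simp add: u_def K_def) (simp add: g_def)
  have "r > 0" using c by (simp add: r_def)
  with 1 2 3 show ?thesis by blast
qed

section \<open>Approximation by trigonometric polynomials\<close>

text \<open>The entries are amplitude, frequency and phase; the phase covers sines. The list is kept
  along with the function because \<open>trig_hess\<close> and \<open>trig_shift\<close> are
  computed from it.\<close>

definition trig_sum :: "(real \<times> 'a \<times> real) list \<Rightarrow> 'a::euclidean_space \<Rightarrow> real" where
  "trig_sum L x = (\<Sum>(c, a, b)\<leftarrow>L. c * cos (a \<bullet> x + b))"

lemma trig_sum_simps [simp]: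
  "trig_sum [] x = 0"
  "trig_sum ((c, a, b) # L) x = c * cos (a \<bullet> x + b) + trig_sum L x"
  "trig_sum (L @ L') x = trig_sum L x + trig_sum L' x"
  by (simp_all add: trig_sum_def)

lemma continuous_trig_sum: "continuous_on UNIV (trig_sum L)"
  unfolding continuous_on_eq_continuous_at[OF open_UNIV]
proof (induction L)
  case (Cons p L)
  obtain c a b where "p = (c, a, b)" by (cases p)
  then have "trig_sum (p # L) = (\<lambda>x. c * cos (a \<bullet> x + b) + trig_sum L x)" by auto
  then show ?case using Cons by (auto intro!: continuous_intros)
next
  case Nil
  have "trig_sum [] = (\<lambda>x::'a. 0)" by auto
  then show ?case by simp
qed

definition trig :: "('a::euclidean_space \<Rightarrow> real) set" where
  "trig = range trig_sum"

lemma trig_induct [consumes 1, case_names zero add]: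
  assumes "f \<in> trig" and "P (\<lambda>x. 0)"
    and "\<And>c a b g. g \<in> trig \<Longrightarrow> P g \<Longrightarrow> P (\<lambda>x. c * cos (a \<bullet> x + b) + g x)"
  shows "P f"
proof -
  have "P (trig_sum L)" for L
  proof (induction L)
    case Nil
    have "trig_sum [] = (\<lambda>x::'a. 0)" by auto
    then show ?case using assms(2) by simp
  next
    case (Cons p L)
    obtain c a b where "p = (c, a, b)" by (cases p)
    then have "trig_sum (p # L) = (\<lambda>x. c * cos (a \<bullet> x + b) + trig_sum L x)" by auto
    then show ?case using assms(3)[OF _ Cons] by (simp add: trig_def)
  qed
  then show ?thesis using assms(1) by (auto simp: trig_def)
qed

lemma trig_cos: "(\<lambda>x. c * cos (a \<bullet> x + b)) \<in> trig"
proof -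
  have "(\<lambda>x. c * cos (a \<bullet> x + b)) = trig_sum [(c, a, b)]" by auto
  then show ?thesis by (simp add: trig_def)
qed

lemma trig_zero: "(\<lambda>x::'a::euclidean_space. 0) \<in> trig"
proof -
  have "trig_sum [] = (\<lambda>x::'a. 0)" by auto
  then show ?thesis unfolding trig_def by (metis rangeI)
qed

lemma trig_add:
  assumes "f \<in> trig" "g \<in> trig" shows "(\<lambda>x. f x + g x) \<in> trig"
proof -
  obtain L L' where "f = trig_sum L" "g = trig_sum L'" using assms by (auto simp: trig_def)
  then have "(\<lambda>x. f x + g x) = trig_sum (L @ L')" by auto
  then show ?thesis by (simp add: trig_def)
qed

text \<open>The product-to-sum formula; it makes \<open>trig\<close> closed under products, in
  particular under the powers of \<open>peak\<close>.\<close>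

lemma trig_cos_mult: "g \<in> trig \<Longrightarrow> (\<lambda>x. c * cos (a \<bullet> x + b) * g x) \<in> trig"
proof (induction rule: trig_induct)
  case (add c' a' b' g)
  have "c * cos (a \<bullet> x + b) * (c' * cos (a' \<bullet> x + b')) =
    c * c' / 2 * cos ((a - a') \<bullet> x + (b - b')) + c * c' / 2 * cos ((a + a') \<bullet> x + (b + b'))" for x
  proof -
    have "(a - a') \<bullet> x + (b - b') = (a \<bullet> x + b) - (a' \<bullet> x + b')" "(a + a') \<bullet> x + (b + b') = (a \<bullet> x + b) + (a' \<bullet> x + b')"
      by (simp_all add: inner_diff_left inner_add_left)
    moreover have "c * cos s * (c' * cos t) = c * c' / 2 * cos (s - t) + c * c' / 2 * cos (s + t)" for s t
      by (simp add: cos_diff cos_add algebra_simps)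
    ultimately show ?thesis by (simp only:)
  qed
  then have "(\<lambda>x. c * cos (a \<bullet> x + b) * (c' * cos (a' \<bullet> x + b') + g x)) =
    (\<lambda>x. (c * c' / 2 * cos ((a - a') \<bullet> x + (b - b')) + c * c' / 2 * cos ((a + a') \<bullet> x + (b + b'))) + c * cos (a \<bullet> x + b) * g x)"
    by (simp add: distrib_left)
  also have "\<dots> \<in> trig" by (intro trig_add trig_cos add)
  finally show ?case .
qed (simp add: trig_zero)

lemma trig_mult:
  assumes g: "g \<in> trig" shows "f \<in> trig \<Longrightarrow> (\<lambda>x. f x * g x) \<in> trig"
proof (induction rule: trig_induct)
  case (add c a b f)
  show ?case unfolding distrib_right by (intro trig_add trig_cos_mult g add)
qed (simp add: trig_zero)

lemma trig_const: "(\<lambda>x. c) \<in> trig"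
  using trig_cos[of c 0 0] by simp

lemma trig_power: "f \<in> trig \<Longrightarrow> (\<lambda>x. f x ^ N) \<in> trig"
  by (induction N) (auto intro: trig_const trig_mult)

lemma trig_finite_sum: "finite I \<Longrightarrow> (\<And>i. i \<in> I \<Longrightarrow> f i \<in> trig) \<Longrightarrow> (\<lambda>x. \<Sum>i\<in>I. f i x) \<in> trig"
  by (induction I rule: finite_induct) (auto intro: trig_add trig_zero)

lemma continuous_trig: "f \<in> trig \<Longrightarrow> continuous_on UNIV f"
  using continuous_trig_sum by (auto simp: trig_def)

section \<open>Convolution and approximate identities\<close>

lemma integrable_compact_support:
  fixes w :: "'a::euclidean_space \<Rightarrow> real"
  assumes "continuous_on UNIV w" "\<And>x. norm x > r \<Longrightarrow> w x = 0"
  shows "integrable lborel w"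
proof -
  have "set_integrable lborel (cball 0 r) w" by (rule continuous_set_integrable[OF assms(1)]) simp
  moreover have "(\<lambda>x. indicator (cball 0 r) x *\<^sub>R w x) = w"
    using assms(2) by (force simp: indicator_def)
  ultimately show ?thesis by (simp add: set_integrable_def)
qed

text \<open>The addition theorem separates \<open>x\<close> from \<open>z\<close>: a convolved wave
  is a combination of \<open>cos (a \<bullet> x)\<close> and \<open>sin (a \<bullet> x)\<close>
  whose coefficients are integrals involving \<open>u\<close>.\<close>

lemma trig_convolution:
  fixes u :: "'a::euclidean_space \<Rightarrow> real"
  assumes u: "continuous_on UNIV u" "\<And>x. norm x > r \<Longrightarrow> u x = 0"
  shows "T \<in> trig \<Longrightarrow> (\<lambda>x. LINT z|lborel. u z * T (x - z)) \<in> trig"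
proof (induction rule: trig_induct)
  case (add c a b g)
  have int: "integrable lborel (\<lambda>z. u z * h z)" if "continuous_on UNIV h" for h
    by (rule integrable_compact_support[of _ r]) (use u that in \<open>auto intro!: continuous_intros\<close>)
  define C where "C = (LINT z|lborel. u z * cos (b - a \<bullet> z))"
  define S where "S = (LINT z|lborel. u z * sin (b - a \<bullet> z))"
  have "(LINT z|lborel. u z * (c * cos (a \<bullet> (x - z) + b) + g (x - z))) =
      (c * C * cos (a \<bullet> x + 0) + (- c * S) * cos (a \<bullet> x + (- pi / 2))) + (LINT z|lborel. u z * g (x - z))" for x
  proof -
    have e: "u z * (c * cos (a \<bullet> (x - z) + b) + g (x - z)) =
        (c * cos (a \<bullet> x)) * (u z * cos (b - a \<bullet> z)) + (- c * sin (a \<bullet> x)) * (u z * sin (b - a \<bullet> z)) + u z * g (x - z)" for z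
    proof -
      have "a \<bullet> (x - z) + b = a \<bullet> x + (b - a \<bullet> z)" by (simp add: inner_diff_right)
      then have *: "cos (a \<bullet> (x - z) + b) = cos (a \<bullet> x) * cos (b - a \<bullet> z) - sin (a \<bullet> x) * sin (b - a \<bullet> z)"
        by (simp only: cos_add)
      show ?thesis unfolding * by (simp add: algebra_simps)
    qed
    have i: "integrable lborel (\<lambda>z. u z * cos (b - a \<bullet> z))" "integrable lborel (\<lambda>z. u z * sin (b - a \<bullet> z))"
      "integrable lborel (\<lambda>z. u z * g (x - z))"
      by (intro int continuous_intros continuous_on_compose2[OF continuous_trig[OF add(1)]]; simp)+
    have "cos (a \<bullet> x + (- pi / 2)) = sin (a \<bullet> x)" by (simp add: cos_diff)
    moreover have lin: "(LINT z|lborel. \<alpha> * F z + \<beta> * G z + K z) = \<alpha> * (LINT z|lborel. F z) + \<beta> * (LINT z|lborel. G z) + (LINT z|lborel. K z)"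
      if "integrable lborel F" "integrable lborel G" "integrable lborel K" for \<alpha> \<beta> and F G K :: "'a \<Rightarrow> real"
      using that by simp
    ultimately show ?thesis unfolding e lin[OF i] by (simp add: C_def S_def mult_ac)
  qed
  then have "(\<lambda>x. LINT z|lborel. u z * (c * cos (a \<bullet> (x - z) + b) + g (x - z))) =
      (\<lambda>x. (c * C * cos (a \<bullet> x + 0) + (- c * S) * cos (a \<bullet> x + (- pi / 2))) + (LINT z|lborel. u z * g (x - z)))" by blast
  also have "\<dots> \<in> trig" by (intro trig_add trig_cos add)
  finally show ?case .
qed (simp add: trig_zero)

text \<open>On \<open>C\<close> away from 0 the peak is at most some \<open>\<eta> < 1\<close>,
  while it is at least a larger \<open>\<theta>\<close> on a small ball around 0; the ratio of the
  \<open>N\<close>th powers tends to 0.\<close>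

lemma peak_concentration:
  fixes k :: "'a::euclidean_space \<Rightarrow> real"
  assumes C: "compact C" and k: "continuous_on UNIV k" "\<And>y. 0 \<le> k y" "\<And>y. k y \<le> 1" "k 0 = 1"
    and peak: "\<And>y. y \<in> C \<Longrightarrow> y \<noteq> 0 \<Longrightarrow> k y < 1" and d0: "0 < d0" "cball 0 d0 \<subseteq> C"
    and \<delta>: "0 < \<delta>" and \<epsilon>: "0 < \<epsilon>"
  shows "\<forall>\<^sub>F N in sequentially. (LINT y:(C - ball 0 \<delta>)|lborel. k y ^ N) \<le> \<epsilon> * (LINT y:C|lborel. k y ^ N)"
proof -
  define C' where "C' = C - ball 0 \<delta>"
  have C': "compact C'" unfolding C'_def by (intro compact_diff C open_ball)
  have bb: "C \<in> bborel" "C' \<in> bborel" "cball 0 d \<in> bborel" for d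
    using C C' by (auto simp: bborel_def compact_imp_bounded borel_compact)
  have int: "set_integrable lborel B (\<lambda>y. k y ^ N)" if "B \<in> bborel" for B N
    by (rule continuous_set_integrable[OF _ that]) (intro continuous_intros k)
  obtain \<eta> where \<eta>: "0 \<le> \<eta>" "\<eta> < 1" "\<And>y. y \<in> C' \<Longrightarrow> k y \<le> \<eta>"
  proof (cases "C' = {}")
    case True with that[of 0] show ?thesis by auto
  next
    case False
    have "continuous_on C' k" using k(1) by (rule continuous_on_subset) simp
    then obtain y where y: "y \<in> C'" "\<And>z. z \<in> C' \<Longrightarrow> k z \<le> k y"
      using continuous_attains_sup[OF C' False] by blast
    moreover have "k y < 1" using y(1) \<delta> by (intro peak) (auto simp: C'_def)
    ultimately show ?thesis using that[of "k y"] k(2) by blast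
  qed
  define \<theta> where "\<theta> = (1 + \<eta>) / 2"
  have \<theta>: "\<eta> < \<theta>" "\<theta> < 1" "0 < \<theta>" using \<eta> by (auto simp: \<theta>_def)
  have "isCont k 0" using k(1) by (simp add: continuous_on_eq_continuous_at)
  then obtain d1 where d1: "d1 > 0" "\<And>y. dist y 0 < d1 \<Longrightarrow> dist (k y) (k 0) < 1 - \<theta>"
    using \<theta> unfolding continuous_at_eps_delta by (metis diff_gt_0_iff_gt)
  define d where "d = min d0 (d1 / 2)"
  have d: "0 < d" "d < d1" "cball 0 d \<subseteq> C" using d0 d1(1) by (auto simp: d_def)
  have low: "\<theta> \<le> k y" if "y \<in> cball 0 d" for y
    using d1(2)[of y] that d k(4) by (auto simp: dist_real_def)
  define V where "V = measure lborel (cball (0::'a) d)"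
  have V: "V > 0" unfolding V_def using d by (intro content_cball_pos)
  have lower: "\<theta> ^ N * V \<le> (LINT y:C|lborel. k y ^ N)" for N
  proof -
    have "\<theta> ^ N * V = (LINT y:cball (0::'a) d|lborel. \<theta> ^ N)"
      by (simp add: V_def set_lebesgue_integral_def mult.commute)
    also have "\<dots> \<le> (LINT y:cball 0 d|lborel. k y ^ N)"
      using low \<theta> by (intro set_integral_mono int bb continuous_set_integrable) (auto intro: power_mono)
    also have "\<dots> \<le> (LINT y:C|lborel. k y ^ N)"
      unfolding set_lebesgue_integral_def using int[OF bb(1)] int[OF bb(3)] d(3) k(2)
      by (intro integral_mono) (auto simp: set_integrable_def indicator_def)
    finally show ?thesis .
  qed
  have upper: "(LINT y:C'|lborel. k y ^ N) \<le> \<eta> ^ N * measure lborel C'" for N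
  proof -
    have "(LINT y:C'|lborel. k y ^ N) \<le> (LINT y:C'|lborel. \<eta> ^ N)"
      using \<eta>(3) k(2) by (intro set_integral_mono int bb continuous_set_integrable) (auto intro: power_mono)
    also have "\<dots> = \<eta> ^ N * measure lborel C'"
      using bb(2) bborel_borel by (simp add: set_lebesgue_integral_def mult.commute)
    finally show ?thesis .
  qed
  have "(\<lambda>N. (\<eta> / \<theta>) ^ N) \<longlonglongrightarrow> 0" using \<eta> \<theta> by (intro LIMSEQ_power_zero) auto
  then have "(\<lambda>N. (\<eta> / \<theta>) ^ N * measure lborel C') \<longlonglongrightarrow> 0 * measure lborel C'" by (intro tendsto_mult tendsto_const)
  then have "\<forall>\<^sub>F N in sequentially. (\<eta> / \<theta>) ^ N * measure lborel C' < \<epsilon> * V"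
    using \<epsilon> V by (intro order_tendstoD(2)) auto
  then show ?thesis
  proof eventually_elim
    case (elim N)
    have "\<eta> ^ N * measure lborel C' = \<theta> ^ N * ((\<eta> / \<theta>) ^ N * measure lborel C')"
      using \<theta> by (simp add: power_divide)
    also have "\<dots> \<le> \<theta> ^ N * (\<epsilon> * V)" using elim \<theta> by (intro mult_left_mono) auto
    also have "\<dots> = \<epsilon> * (\<theta> ^ N * V)" by simp
    also have "\<dots> \<le> \<epsilon> * (LINT y:C|lborel. k y ^ N)" using lower \<epsilon> by (intro mult_left_mono) auto
    finally show ?case using upper[of N] by (simp add: C'_def)
  qed
qed

lemma uniformly_continuous_compact_support:
  fixes w :: "'a::euclidean_space \<Rightarrow> real"
  assumes w: "continuous_on UNIV w" "\<And>x. norm x > r \<Longrightarrow> w x = 0" and e: "0 < e"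
  shows "\<exists>d>0. \<forall>x y. norm y < d \<longrightarrow> \<bar>w (x - y) - w x\<bar> < e"
proof -
  have "uniformly_continuous_on (cball 0 (r + 1)) w"
    using w(1) by (intro compact_uniformly_continuous) (auto intro: continuous_on_subset)
  then obtain d where d: "d > 0" "\<And>x y. x \<in> cball 0 (r + 1) \<Longrightarrow> y \<in> cball 0 (r + 1) \<Longrightarrow> dist y x < d \<Longrightarrow> dist (w y) (w x) < e"
    using e unfolding uniformly_continuous_on_def by metis
  show ?thesis
  \<comment> \<open>With shifts shorter than 1, either both points lie in the ball of radius
    \<open>r + 1\<close> or both lie outside the support.\<close>
  proof (intro exI[of _ "min d 1"] conjI allI impI)
    fix x y :: 'a assume y: "norm y < min d 1"
    have n: "norm x \<le> norm (x - y) + norm y" "norm (x - y) \<le> norm x + norm y"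
      by (metis diff_add_cancel norm_triangle_ineq) (rule norm_triangle_ineq4)
    show "\<bar>w (x - y) - w x\<bar> < e"
    proof (cases "norm x \<le> r + 1 \<and> norm (x - y) \<le> r + 1")
      case True then show ?thesis using d(2)[of x "x - y"] y by (simp add: dist_norm norm_minus_commute)
    next
      case False
      then have "norm x > r" "norm (x - y) > r" using n y by auto
      then show ?thesis using w(2) e by simp
    qed
  qed (use d in simp)
qed

lemma lborel_integral_translate_reflect:
  fixes f :: "'a::euclidean_space \<Rightarrow> real"
  assumes f: "continuous_on UNIV f"
  shows "(LINT y|lborel. f (y + c)) = (LINT y|lborel. f y)" and "(LINT y|lborel. f (c - y)) = (LINT y|lborel. f y)"
proof -
  have [measurable]: "f \<in> borel_measurable borel" using f by (rule borel_measurable_continuous_onI)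
  have "(LINT y|distr lborel borel ((+) c). f y) = (LINT y|lborel. f (c + y))" by (rule integral_distr) auto
  then show "(LINT y|lborel. f (y + c)) = (LINT y|lborel. f y)" by (simp add: lborel_distr_plus add.commute)
  have "distr lborel borel (\<lambda>y. c + (-1) *\<^sub>R y) = lborel"
    by (subst lborel_affine[of "-1" c]) (auto simp: density_1)
  moreover have "(LINT y|distr lborel borel (\<lambda>y. c + (-1) *\<^sub>R y). f y) = (LINT y|lborel. f (c + (-1) *\<^sub>R y))"
    by (rule integral_distr) auto
  ultimately show "(LINT y|lborel. f (c - y)) = (LINT y|lborel. f y)" by simp
qed

text \<open>Averaging over the coordinates gives a trigonometric polynomial of period \<open>2 * \<rho>\<close> in each
  coordinate that takes its maximum 1 exactly at the period lattice; its powers form an approximate identity.\<close>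

definition peak :: "real \<Rightarrow> 'a::euclidean_space \<Rightarrow> real" where
  "peak \<rho> y = (\<Sum>i\<in>Basis. (1 + cos (pi / \<rho> * (y \<bullet> i))) / 2) / DIM('a)"

text \<open>The representative of \<open>x\<close> modulo the period lattice of
  \<open>peak \<rho>\<close> whose coordinates are at most \<open>\<rho>\<close> in modulus.\<close>

definition period_reduce :: "real \<Rightarrow> 'a::euclidean_space \<Rightarrow> 'a" where
  "period_reduce \<rho> x = (\<Sum>i\<in>Basis. (x \<bullet> i - 2 * \<rho> * round (x \<bullet> i / (2 * \<rho>))) *\<^sub>R i)"

lemma trig_peak: "peak \<rho> \<in> trig"
proof -
  have "(\<lambda>y. \<Sum>i\<in>Basis. (1 / (2 * DIM('a)) + 1 / (2 * DIM('a)) * cos (((pi / \<rho>) *\<^sub>R i) \<bullet> y + 0))) \<in> (trig :: ('a \<Rightarrow> real) set)"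
    by (intro trig_finite_sum trig_add trig_const trig_cos) simp
  moreover have "(\<lambda>y. \<Sum>i\<in>Basis. (1 / (2 * DIM('a)) + 1 / (2 * DIM('a)) * cos (((pi / \<rho>) *\<^sub>R i) \<bullet> y + 0))) = (peak \<rho> :: 'a \<Rightarrow> real)"
    by (simp add: peak_def fun_eq_iff sum_divide_distrib add_divide_distrib inner_commute)
  ultimately show ?thesis by metis
qed

lemma peak_bounds:
  shows "0 \<le> peak \<rho> y" "peak \<rho> y \<le> 1" "peak \<rho> 0 = 1"
proof -
  have c: "0 \<le> (1 + cos t) / 2" for t :: real
    using add_left_mono[OF cos_ge_minus_one[of t], of 1] by simp
  have c': "(1 + cos t) / 2 \<le> 1" for t :: real
    using add_left_mono[OF cos_le_one[of t], of 1] by simp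
  show "0 \<le> peak \<rho> y" unfolding peak_def using c by (intro divide_nonneg_nonneg sum_nonneg) auto
  have "(\<Sum>i\<in>Basis. (1 + cos (pi / \<rho> * (y \<bullet> i))) / 2) \<le> (\<Sum>i\<in>(Basis::'a set). 1)"
    by (intro sum_mono c')
  then show "peak \<rho> y \<le> 1" by (simp add: peak_def)
  show "peak \<rho> 0 = 1" by (simp add: peak_def)
qed

text \<open>Among coordinates of modulus below \<open>2 * \<rho>\<close> the cosine reaches 1 only
  at 0, and one coordinate of \<open>y\<close> is nonzero.\<close>

lemma peak_less_1:
  assumes \<rho>: "0 < \<rho>" and y: "\<And>i. i \<in> Basis \<Longrightarrow> \<bar>y \<bullet> i\<bar> < 2 * \<rho>" and "y \<noteq> 0"
  shows "peak \<rho> y < 1"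
proof -
  obtain i where i: "i \<in> Basis" "y \<bullet> i \<noteq> 0" using \<open>y \<noteq> 0\<close> euclidean_all_zero_iff by blast
  have "cos (pi / \<rho> * (y \<bullet> i)) \<noteq> 1"
  proof
    assume "cos (pi / \<rho> * (y \<bullet> i)) = 1"
    then obtain n :: int where n: "pi / \<rho> * (y \<bullet> i) = real_of_int n * 2 * pi" using cos_one_2pi_int by blast
    then have eq: "y \<bullet> i = 2 * \<rho> * n" using \<rho> by (simp add: field_simps)
    then have "\<bar>real_of_int n\<bar> < 1" using y[OF i(1)] \<rho> by (simp add: abs_mult)
    then have "n = 0" by linarith
    then show False using eq i by simp
  qed
  then have "cos (pi / \<rho> * (y \<bullet> i)) < 1" using cos_le_one[of "pi / \<rho> * (y \<bullet> i)"] by linarith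
  then have "(\<Sum>i\<in>Basis. (1 + cos (pi / \<rho> * (y \<bullet> i))) / 2) < (\<Sum>i\<in>(Basis::'a set). 1)"
    using i(1) cos_le_one by (intro sum_strict_mono_ex1) (auto simp: field_simps)
  then show ?thesis by (simp add: peak_def)
qed

lemma period_reduce_inner:
  "i \<in> Basis \<Longrightarrow> period_reduce \<rho> x \<bullet> i = x \<bullet> i - 2 * \<rho> * round (x \<bullet> i / (2 * \<rho>))"
  by (simp add: period_reduce_def inner_sum_left inner_Basis if_distrib sum.delta' cong: if_cong)

lemma peak_periodic:
  assumes "0 < \<rho>" shows "peak \<rho> (period_reduce \<rho> x - z) = peak \<rho> (x - z)"
proof -
  have "cos (pi / \<rho> * ((period_reduce \<rho> x - z) \<bullet> i)) = cos (pi / \<rho> * ((x - z) \<bullet> i))" if "i \<in> Basis" for i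
  proof -
    define n where "n = round (x \<bullet> i / (2 * \<rho>))"
    have "pi / \<rho> * ((period_reduce \<rho> x - z) \<bullet> i) = pi / \<rho> * ((x - z) \<bullet> i) - 2 * pi * real_of_int n"
      using assms that by (simp add: inner_diff_left period_reduce_inner n_def field_simps)
    then show ?thesis by (simp add: cos_diff)
  qed
  then show ?thesis by (simp add: peak_def)
qed

lemma period_reduce_bound:
  assumes "0 < \<rho>" "i \<in> Basis" shows "\<bar>period_reduce \<rho> x \<bullet> i\<bar> \<le> \<rho>"
proof -
  have "period_reduce \<rho> x \<bullet> i = 2 * \<rho> * (x \<bullet> i / (2 * \<rho>) - round (x \<bullet> i / (2 * \<rho>)))"
    using assms by (simp add: period_reduce_inner right_diff_distrib)
  moreover have "\<bar>x \<bullet> i / (2 * \<rho>) - round (x \<bullet> i / (2 * \<rho>))\<bar> \<le> 1 / 2"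
    using of_int_round_abs_le[of "x \<bullet> i / (2 * \<rho>)"] by (simp add: abs_minus_commute)
  ultimately show ?thesis using assms(1) by (simp add: abs_mult)
qed

lemma period_reduce_id:
  assumes "norm x < \<rho>" shows "period_reduce \<rho> x = x"
proof (rule euclidean_eqI)
  fix i :: 'a assume i: "i \<in> Basis"
  have "\<bar>x \<bullet> i\<bar> < \<rho>" using Basis_le_norm[OF i, of x] assms by simp
  then have "\<bar>x \<bullet> i / (2 * \<rho>) - of_int 0\<bar> < 1 / 2" by (simp add: abs_divide field_simps)
  then have "round (x \<bullet> i / (2 * \<rho>)) = 0" by (rule round_unique')
  then show "period_reduce \<rho> x \<bullet> i = x \<bullet> i" using i by (simp add: period_reduce_inner)
qed

section \<open>Hessians of trigonometric polynomials and matrix bounds\<close>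

definition trig_hess :: "(real \<times> (real^'n) \<times> real) list \<Rightarrow> real^'n \<Rightarrow> real^'n^'n" where
  "trig_hess L x = (\<Sum>(c, a, b)\<leftarrow>L. (- c * cos (a \<bullet> x + b)) *\<^sub>R outer a)"

lemma trig_hess_simps [simp]:
  "trig_hess [] x = 0"
  "trig_hess ((c, a, b) # L) x = (- c * cos (a \<bullet> x + b)) *\<^sub>R outer a + trig_hess L x"
  by (simp_all add: trig_hess_def)

lemma C2_hessian_ridge:
  assumes \<theta>: "\<And>t. (\<theta> has_real_derivative \<theta>' t) (at t)" "\<And>t. (\<theta>' has_real_derivative \<theta>'' t) (at t)"
    and c: "continuous_on UNIV \<theta>''"
  shows "C2_hessian (\<lambda>x. \<theta> (a \<bullet> x)) (\<lambda>x. \<theta>'' (a \<bullet> x) *\<^sub>R outer a)"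
  unfolding C2_hessian_def
proof (intro exI[of _ "\<lambda>x. \<theta>' (a \<bullet> x) *\<^sub>R a"] conjI allI)
  have comp: "((\<lambda>x. \<alpha> (a \<bullet> x)) has_derivative (\<lambda>v. \<alpha>' (a \<bullet> x) * (a \<bullet> v))) (at x)"
    if "\<And>t. (\<alpha> has_real_derivative \<alpha>' t) (at t)" for \<alpha> \<alpha>' x
    by (rule has_derivative_compose[OF bounded_linear_imp_has_derivative[OF bounded_linear_inner_right] that[unfolded has_field_derivative_def]])
  show "((\<lambda>x. \<theta> (a \<bullet> x)) has_derivative (\<lambda>v. (\<theta>' (a \<bullet> x) *\<^sub>R a) \<bullet> v)) (at x)" for x
    using comp[OF \<theta>(1)] by simp
  show "((\<lambda>x. \<theta>' (a \<bullet> x) *\<^sub>R a) has_derivative (\<lambda>v. (\<theta>'' (a \<bullet> x) *\<^sub>R outer a) *v v)) (at x)" for x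
    by (rule has_derivative_eq_rhs[OF has_derivative_scaleR_left[OF comp[OF \<theta>(2)]]])
       (simp add: scaleR_matrix_vector outer_vector)
qed (intro continuous_intros continuous_on_compose2[OF c]; simp)

lemma C2_hessian_trig_sum: "C2_hessian (trig_sum L) (trig_hess L)"
proof (induction L)
  case Nil
  have "trig_sum [] = (\<lambda>x::real^'n. 0 \<bullet> x + 0)" "trig_hess [] = (\<lambda>x::real^'n. 0)" by auto
  then show ?case using C2_hessian_affine[of "0::real^'n" 0] by simp
next
  case (Cons p L)
  obtain c a b where p: "p = (c, a, b)" by (cases p)
  have h: "C2_hessian (\<lambda>x. c * cos (a \<bullet> x + b)) (\<lambda>x. (- c * cos (a \<bullet> x + b)) *\<^sub>R outer a)"
    by (rule C2_hessian_ridge[where \<theta>="\<lambda>t. c * cos (t + b)" and \<theta>'="\<lambda>t. - c * sin (t + b)"])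
       (auto intro!: derivative_eq_intros continuous_intros)
  have "trig_sum (p # L) = (\<lambda>x. c * cos (a \<bullet> x + b) + trig_sum L x)"
    and "trig_hess (p # L) = (\<lambda>x. (- c * cos (a \<bullet> x + b)) *\<^sub>R outer a + trig_hess L x)"
    by (auto simp: p)
  then show ?case by (simp only: C2_hessian_add[OF h Cons])
qed

text \<open>Polarisation at pairs of basis vectors expresses the entries by values of the quadratic
  form.\<close>

lemma tendsto_matrix_of_quadratic:
  fixes M :: "'b \<Rightarrow> real^'n^'n"
  assumes s: "\<And>i. transpose (M i) = M i" "transpose A = A"
    and lim: "\<And>v. ((\<lambda>i. v \<bullet> (M i *v v)) \<longlongrightarrow> v \<bullet> (A *v v)) F"
  shows "(M \<longlongrightarrow> A) F"
proof (intro vec_tendstoI)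
  fix i j :: 'n
  define e f where "e = (axis i 1 :: real^'n)" and "f = (axis j 1 :: real^'n)"
  have ent: "B $ i $ j = ((e + f) \<bullet> (B *v (e + f)) - e \<bullet> (B *v e) - f \<bullet> (B *v f)) / 2"
    if "transpose B = B" for B :: "real^'n^'n"
  proof -
    have "B $ i $ j = e \<bullet> (B *v f)" by (simp add: e_def f_def inner_axis' matrix_vector_mult_basis column_def)
    moreover have "f \<bullet> (B *v e) = e \<bullet> (B *v f)" using symmetric_dot[OF that, of f e] by (simp add: inner_commute)
    ultimately show ?thesis by (simp add: matrix_vector_right_distrib inner_add_left inner_add_right)
  qed
  show "((\<lambda>x. M x $ i $ j) \<longlongrightarrow> A $ i $ j) F"
    unfolding ent[OF s(1)] ent[OF s(2)] by (intro tendsto_intros lim) simp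
qed

text \<open>Polarisation bounds an entry by \<open>(4 + 1 + 1) * \<Lambda> / 2\<close>, the sum of
  two unit vectors having squared norm at most 4; the norm is then estimated by the sum of the
  moduli of all entries.\<close>

lemma symmetric_matrix_bound:
  fixes B :: "real^'n^'n"
  assumes s: "transpose B = B" and b: "\<And>v. \<bar>v \<bullet> (B *v v)\<bar> \<le> \<Lambda> * (v \<bullet> v)"
  shows "norm B \<le> real CARD('n) * (real CARD('n) * (3 * \<Lambda>))"
proof -
  have ent: "\<bar>B $ i $ j\<bar> \<le> 3 * \<Lambda>" for i j
  proof -
    define e f where "e = (axis i 1 :: real^'n)" and "f = (axis j 1 :: real^'n)"
    have "B $ i $ j = e \<bullet> (B *v f)" by (simp add: e_def f_def inner_axis' matrix_vector_mult_basis column_def)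
    moreover have "f \<bullet> (B *v e) = e \<bullet> (B *v f)" using symmetric_dot[OF s, of f e] by (simp add: inner_commute)
    ultimately have "B $ i $ j = ((e + f) \<bullet> (B *v (e + f)) - e \<bullet> (B *v e) - f \<bullet> (B *v f)) / 2"
      by (simp add: matrix_vector_right_distrib inner_add_left inner_add_right)
    moreover have n: "e \<bullet> e = 1" "f \<bullet> f = 1" by (simp_all add: e_def f_def inner_axis')
    have "0 \<le> \<Lambda>" using b[of e] n by simp
    have "norm e = 1" "norm f = 1" using n by (simp_all add: norm_eq_1)
    then have "\<bar>e \<bullet> f\<bar> \<le> 1" using Cauchy_Schwarz_ineq2[of e f] by simp
    then have "(e + f) \<bullet> (e + f) \<le> 4" using n by (simp add: inner_add_left inner_add_right inner_commute)
    then have "\<Lambda> * ((e + f) \<bullet> (e + f)) \<le> \<Lambda> * 4" using \<open>0 \<le> \<Lambda>\<close> by (rule mult_left_mono)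
    moreover note b[of e] b[of f] b[of "e + f"]
    ultimately show ?thesis using n by (simp add: abs_le_iff)
  qed
  have "norm B \<le> (\<Sum>i\<in>UNIV. norm (B $ i))" unfolding norm_vec_def by (rule L2_set_le_sum) simp
  also have "\<dots> \<le> (\<Sum>i\<in>(UNIV::'n set). real CARD('n) * (3 * \<Lambda>))"
  proof (rule sum_mono)
    fix i
    have "norm (B $ i) \<le> (\<Sum>j\<in>UNIV. \<bar>B $ i $ j\<bar>)" by (rule norm_le_l1_cart)
    also have "\<dots> \<le> (\<Sum>j\<in>(UNIV::'n set). 3 * \<Lambda>)" by (intro sum_mono ent)
    finally show "norm (B $ i) \<le> real CARD('n) * (3 * \<Lambda>)" by simp
  qed
  finally show ?thesis by simp
qed

text \<open>\<open>r\<close> is the radius of a support and \<open>\<rho>\<close> half the period;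
  \<open>r < \<rho>\<close> keeps the periodic copies of the support apart. The parameter
  \<open>ty\<close> fixes the space.\<close>

locale peak_convolution =
  fixes \<rho> r :: real and ty :: "'a::euclidean_space itself"
  assumes r: "0 < r" "r < \<rho>"
begin

lemma \<rho>: "0 < \<rho>" using r by simp

text \<open>It contains every difference of a reduced point, with coordinates up to
  \<open>\<rho>\<close>, and a point of the support, with coordinates up to \<open>r\<close>. As
  \<open>\<rho> + r < 2 * \<rho>\<close>, the only maximum of the peak inside is the one at
  0.\<close>

definition cube :: "'a set" where "cube = cbox (- (\<rho> + r) *\<^sub>R One) ((\<rho> + r) *\<^sub>R One)"

definition mass :: "nat \<Rightarrow> real" where "mass N = (LINT y:cube|lborel. peak \<rho> y ^ N)"

definition conv :: "nat \<Rightarrow> ('a \<Rightarrow> real) \<Rightarrow> 'a \<Rightarrow> real" where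
  "conv N w x = (LINT z|lborel. w z * peak \<rho> (x - z) ^ N) / mass N"

lemma mem_cube: "y \<in> cube \<longleftrightarrow> (\<forall>i\<in>Basis. \<bar>y \<bullet> i\<bar> \<le> \<rho> + r)"
  by (auto simp: cube_def mem_box abs_le_iff minus_le_iff)

lemma cube_bborel: "cube \<in> bborel"
  by (auto simp: cube_def bborel_def)

lemma continuous_peak: "continuous_on UNIV (peak \<rho> :: 'a \<Rightarrow> real)"
  by (rule continuous_trig[OF trig_peak])

lemma cball_cube: "cball 0 r \<subseteq> cube"
proof
  fix y :: 'a assume "y \<in> cball 0 r"
  then have "norm y \<le> r" by simp
  then have "\<bar>y \<bullet> i\<bar> \<le> \<rho> + r" if "i \<in> Basis" for i
    using Basis_le_norm[OF that, of y] \<rho> by linarith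
  then show "y \<in> cube" by (simp add: mem_cube)
qed

lemma peak_power_integrable: "B \<in> bborel \<Longrightarrow> continuous_on UNIV w \<Longrightarrow> set_integrable lborel B (\<lambda>y::'a. w y * peak \<rho> y ^ N)"
  by (intro continuous_set_integrable continuous_intros continuous_peak)

lemma mass_pos: "0 < mass N"
proof -
  have "isCont (peak \<rho>) (0::'a)" using continuous_peak by (simp add: continuous_on_eq_continuous_at)
  then obtain d1 where d1: "d1 > 0" "\<And>y::'a. dist y 0 < d1 \<Longrightarrow> dist (peak \<rho> y) (peak \<rho> (0::'a)) < 1 / 2"
    unfolding continuous_at_eps_delta by (metis half_gt_zero zero_less_one)
  define d where "d = min r (d1 / 2)"
  have d: "0 < d" "d < d1" "d \<le> r" using d1(1) r by (auto simp: d_def)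
  have low: "1 / 2 \<le> peak \<rho> y" if "y \<in> cball 0 d" for y :: 'a
  proof -
    have "dist (peak \<rho> y) 1 < 1 / 2" using d1(2)[of y] that d by (simp add: peak_bounds(3))
    then show ?thesis unfolding dist_real_def by linarith
  qed
  have i: "set_integrable lborel B (\<lambda>y::'a. peak \<rho> y ^ N)" if "B \<in> bborel" for B
    using peak_power_integrable[OF that, of "\<lambda>_. 1" N] by simp
  have sub: "cball 0 d \<subseteq> cube" using cball_cube d(3) by force
  have p: "0 \<le> peak \<rho> y ^ N" for y :: 'a by (simp add: peak_bounds(1))
  have "0 < (1 / 2) ^ N * measure lborel (cball (0::'a) d)" using d content_cball_pos by simp
  also have "\<dots> = (LINT y:cball (0::'a) d|lborel. (1 / 2) ^ N)"
    by (simp add: set_lebesgue_integral_def mult.commute)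
  also have "\<dots> \<le> (LINT y:cball (0::'a) d|lborel. peak \<rho> y ^ N)"
    using low by (intro set_integral_mono i continuous_set_integrable) (auto intro: power_mono)
  also have "\<dots> \<le> mass N"
    unfolding mass_def set_lebesgue_integral_def
    using i[of "cball 0 d"] i[OF cube_bborel] sub p
    by (intro integral_mono) (auto simp: set_integrable_def indicator_def subset_iff)
  finally show ?thesis .
qed

text \<open>The peak is periodic, so \<open>x\<close> may be replaced by its reduced representative;
  after the substitution \<open>y = period_reduce \<rho> x - z\<close> the integrand vanishes off
  \<open>cube\<close>.\<close>

lemma conv_eq:
  assumes w: "continuous_on UNIV w" "\<And>x. norm x > r \<Longrightarrow> w x = 0"
  shows "conv N w x = (LINT y:cube|lborel. w (period_reduce \<rho> x - y) * peak \<rho> y ^ N) / mass N"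
proof -
  define x' where "x' = period_reduce \<rho> x"
  have "(LINT z|lborel. w z * peak \<rho> (x - z) ^ N) = (LINT z|lborel. w z * peak \<rho> (x' - z) ^ N)"
    by (simp add: x'_def peak_periodic[OF \<rho>])
  also have "\<dots> = (LINT y|lborel. (\<lambda>z. w z * peak \<rho> (x' - z) ^ N) (x' - y))"
    by (rule lborel_integral_translate_reflect(2)[symmetric])
       (intro continuous_intros w continuous_on_compose2[OF continuous_peak]; simp)
  also have "\<dots> = (LINT y|lborel. w (x' - y) * peak \<rho> y ^ N)" by simp
  also have "\<dots> = (LINT y:cube|lborel. w (x' - y) * peak \<rho> y ^ N)"
    unfolding set_lebesgue_integral_def
  proof (rule Bochner_Integration.integral_cong)
    fix y
    show "w (x' - y) * peak \<rho> y ^ N = indicator cube y *\<^sub>R (w (x' - y) * peak \<rho> y ^ N)"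
    proof (cases "y \<in> cube")
      case False
      then obtain i where i: "i \<in> Basis" "\<bar>y \<bullet> i\<bar> > \<rho> + r" by (auto simp: mem_cube not_le)
      have "\<bar>(x' - y) \<bullet> i\<bar> > r"
        using i(2) period_reduce_bound[OF \<rho> i(1), of x] by (simp add: x'_def inner_diff_left)
      then have "norm (x' - y) > r" using Basis_le_norm[OF i(1), of "x' - y"] by linarith
      then show ?thesis using w(2) by simp
    qed simp
  qed simp
  finally show ?thesis by (simp add: conv_def x'_def)
qed

text \<open>By \<open>conv_eq\<close> the convolution integrates values of \<open>w\<close> with
  nonnegative weights of total mass 1. Applied to second derivatives, this bounds the Hessians of
  all approximants at once.\<close>

lemma conv_bounds:
  assumes w: "continuous_on UNIV w" "\<And>x. norm x > r \<Longrightarrow> w x = 0" and b: "\<And>x. \<bar>w x\<bar> \<le> b"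
  shows "\<bar>conv N w x\<bar> \<le> b"
proof -
  let ?x = "period_reduce \<rho> x"
  have i: "set_integrable lborel cube (\<lambda>y. w (?x - y) * peak \<rho> y ^ N)"
    by (intro peak_power_integrable cube_bborel continuous_on_compose2[OF w(1)] continuous_intros) simp
  have i1: "set_integrable lborel cube (\<lambda>y. b * peak \<rho> y ^ N)"
    by (intro peak_power_integrable cube_bborel continuous_intros)
  have "\<bar>LINT y:cube|lborel. w (?x - y) * peak \<rho> y ^ N\<bar> \<le> (LINT y:cube|lborel. \<bar>w (?x - y) * peak \<rho> y ^ N\<bar>)"
    using set_integral_norm_bound[OF i] by simp
  also have "\<dots> \<le> (LINT y:cube|lborel. b * peak \<rho> y ^ N)"
  proof (intro set_integral_mono set_integrable_abs i i1)
    fix y :: 'a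
    have p: "0 \<le> peak \<rho> y ^ N" by (simp add: peak_bounds(1))
    have "\<bar>w (?x - y) * peak \<rho> y ^ N\<bar> = \<bar>w (?x - y)\<bar> * peak \<rho> y ^ N"
      unfolding abs_mult abs_of_nonneg[OF p] ..
    also have "\<dots> \<le> b * peak \<rho> y ^ N" by (rule mult_right_mono[OF b p])
    finally show "\<bar>w (?x - y) * peak \<rho> y ^ N\<bar> \<le> b * peak \<rho> y ^ N" .
  qed
  also have "\<dots> = b * mass N" by (simp add: mass_def)
  finally show ?thesis using mass_pos[of N] by (simp add: conv_eq[OF w] abs_divide divide_le_eq)
qed

text \<open>Close to 0 uniform continuity gives an error \<open>e / 2\<close>; elsewhere the
  increment is at most \<open>2 * b\<close> and the mass at most the fraction
  \<open>e / (4 * b)\<close> of the total. None of these bounds depends on \<open>x\<close>.\<close>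

lemma conv_approx:
  assumes w: "continuous_on UNIV w" "\<And>x. norm x > r \<Longrightarrow> w x = 0" and e: "0 < e"
  shows "\<forall>\<^sub>F N in sequentially. \<forall>x. \<bar>conv N w x - w (period_reduce \<rho> x)\<bar> \<le> e"
proof -
  have "compact (w ` cball 0 r)" using w(1) by (intro compact_continuous_image) (auto intro: continuous_on_subset)
  then obtain b where b0: "b > 0" "\<forall>y\<in>w ` cball 0 r. norm y \<le> b"
    using compact_imp_bounded[of "w ` cball 0 r"] unfolding bounded_pos by blast
  have b: "\<bar>w x\<bar> \<le> b" for x using b0 w(2)[of x] by (cases "norm x \<le> r") auto
  obtain d where d: "d > 0" "\<And>x y. norm y < d \<Longrightarrow> \<bar>w (x - y) - w x\<bar> < e / 2"
    using uniformly_continuous_compact_support[OF w half_gt_zero[OF e]] by blast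
  have "\<forall>\<^sub>F N in sequentially. (LINT y:(cube - ball 0 d)|lborel. peak \<rho> y ^ N) \<le> (e / (4 * b)) * (LINT y:cube|lborel. peak \<rho> y ^ N)"
  proof (rule peak_concentration[OF _ continuous_peak peak_bounds])
    show "compact cube" by (simp add: cube_def)
    show "peak \<rho> y < 1" if "y \<in> cube" "y \<noteq> 0" for y
      using that r by (intro peak_less_1[OF \<rho>]) (auto simp: mem_cube intro: order.strict_trans1)
    show "cball 0 r \<subseteq> cube" by (rule cball_cube)
  qed (use r d b0 e in auto)
  then show ?thesis
  proof eventually_elim
    case (elim N)
    show ?case
    proof
      fix x :: 'a
      let ?x = "period_reduce \<rho> x"
      have bb: "cube - ball 0 d \<in> bborel" by (intro bborel_Diff cube_bborel) simp
      have i1: "set_integrable lborel cube (\<lambda>y. w (?x - y) * peak \<rho> y ^ N)"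
        by (intro peak_power_integrable cube_bborel continuous_on_compose2[OF w(1)] continuous_intros) simp
      have i2: "set_integrable lborel cube (\<lambda>y. c * peak \<rho> y ^ N)" for c
        by (intro peak_power_integrable cube_bborel continuous_intros)
      have i3: "set_integrable lborel (cube - ball 0 d) (\<lambda>y. c * peak \<rho> y ^ N)" for c
        by (intro peak_power_integrable bb continuous_intros)
      have pt: "\<bar>indicator cube y *\<^sub>R ((w (?x - y) - w ?x) * peak \<rho> y ^ N)\<bar>
          \<le> indicator cube y *\<^sub>R (e / 2 * peak \<rho> y ^ N) + indicator (cube - ball 0 d) y *\<^sub>R (2 * b * peak \<rho> y ^ N)" for y :: 'a
      proof -
        have p: "0 \<le> peak \<rho> y ^ N" by (simp add: peak_bounds(1))
        have "\<bar>w (?x - y) - w ?x\<bar> \<le> 2 * b" using b[of "?x - y"] b[of ?x] by linarith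
        then have "\<bar>w (?x - y) - w ?x\<bar> * peak \<rho> y ^ N \<le> 2 * b * peak \<rho> y ^ N" using p by (rule mult_right_mono)
        moreover have "\<bar>w (?x - y) - w ?x\<bar> * peak \<rho> y ^ N \<le> e / 2 * peak \<rho> y ^ N" if "norm y < d"
          using d(2)[OF that, of ?x] p by (intro mult_right_mono) auto
        moreover have "0 \<le> e / 2 * peak \<rho> y ^ N" "0 \<le> 2 * b * peak \<rho> y ^ N" using p e b0 by auto
        ultimately show ?thesis using p by (auto simp: indicator_def abs_mult)
      qed
      have "(LINT y:cube|lborel. w (?x - y) * peak \<rho> y ^ N) - w ?x * mass N
          = (LINT y:cube|lborel. (w (?x - y) - w ?x) * peak \<rho> y ^ N)"
        using i1 i2[of "w ?x"] by (simp add: left_diff_distrib mass_def)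
      then have "\<bar>(LINT y:cube|lborel. w (?x - y) * peak \<rho> y ^ N) - w ?x * mass N\<bar>
          = \<bar>LINT y:cube|lborel. (w (?x - y) - w ?x) * peak \<rho> y ^ N\<bar>" by simp
      also have "\<dots> \<le> (LINT y|lborel. \<bar>indicator cube y *\<^sub>R ((w (?x - y) - w ?x) * peak \<rho> y ^ N)\<bar>)"
        unfolding set_lebesgue_integral_def by (rule integral_abs_bound)
      also have "\<dots> \<le> (LINT y|lborel. indicator cube y *\<^sub>R (e / 2 * peak \<rho> y ^ N) + indicator (cube - ball 0 d) y *\<^sub>R (2 * b * peak \<rho> y ^ N))"
      proof (rule integral_mono)
        have "set_integrable lborel cube (\<lambda>y. (w (?x - y) - w ?x) * peak \<rho> y ^ N)"
          unfolding left_diff_distrib by (intro set_integral_diff i1 i2)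
        then show "integrable lborel (\<lambda>y. \<bar>indicator cube y *\<^sub>R ((w (?x - y) - w ?x) * peak \<rho> y ^ N)\<bar>)"
          unfolding set_integrable_def by (rule integrable_abs)
      qed (use i2 i3 pt in \<open>auto simp: set_integrable_def\<close>)
      also have "\<dots> = e / 2 * mass N + 2 * b * (LINT y:(cube - ball 0 d)|lborel. peak \<rho> y ^ N)"
        using i2[of "e / 2"] i3[of "2 * b"] unfolding set_integrable_def
        by (subst Bochner_Integration.integral_add)
           (auto simp: mass_def set_lebesgue_integral_def[symmetric] simp del: real_scaleR_def)
      also have "\<dots> \<le> e / 2 * mass N + 2 * b * ((e / (4 * b)) * mass N)"
        using elim b0 by (intro add_left_mono mult_left_mono) (auto simp: mass_def)
      also have "\<dots> = e * mass N" using b0 by (simp add: field_simps)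
      finally have m: "\<bar>(LINT y:cube|lborel. w (?x - y) * peak \<rho> y ^ N) - w ?x * mass N\<bar> \<le> e * mass N" .
      have "conv N w x - w ?x = ((LINT y:cube|lborel. w (?x - y) * peak \<rho> y ^ N) - w ?x * mass N) / mass N"
        using mass_pos[of N] by (simp add: conv_eq[OF w] diff_divide_distrib)
      then show "\<bar>conv N w x - w ?x\<bar> \<le> e" using m mass_pos[of N] by (simp add: abs_divide divide_le_eq)
    qed
  qed
qed

lemma conv_trig: "continuous_on UNIV u \<Longrightarrow> (\<And>x. norm x > r \<Longrightarrow> u x = 0) \<Longrightarrow> conv N u \<in> trig"
proof -
  assume u: "continuous_on UNIV u" "\<And>x. norm x > r \<Longrightarrow> u x = 0"
  have "(\<lambda>x. LINT z|lborel. u z * peak \<rho> (x - z) ^ N) \<in> trig"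
    by (rule trig_convolution[OF u trig_power[OF trig_peak]])
  from trig_mult[OF this trig_const[of "1 / mass N"]] show ?thesis
    by (simp add: conv_def[abs_def])
qed

end

section \<open>Approximation together with the Hessian\<close>

lemma compact_support_bounded:
  fixes w :: "'a::euclidean_space \<Rightarrow> 'b::real_normed_vector"
  assumes "continuous_on UNIV w" "\<And>x. norm x > r \<Longrightarrow> w x = 0"
  obtains M where "0 < M" "\<And>x. norm (w x) \<le> M"
proof -
  have "compact (w ` cball 0 r)" using assms(1) by (intro compact_continuous_image) (auto intro: continuous_on_subset)
  then obtain M where M: "M > 0" "\<forall>y\<in>w ` cball 0 r. norm y \<le> M"
    using compact_imp_bounded[of "w ` cball 0 r"] unfolding bounded_pos by blast
  have "norm (w x) \<le> M" for x using M assms(2)[of x] by (cases "norm x \<le> r") auto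
  with M(1) show thesis by (rule that)
qed

lemma trig_hess_symmetric: "transpose (trig_hess L x) = trig_hess L x"
  by (rule C2_hessian_symmetric[OF C2_hessian_trig_sum])

text \<open>Second differences commute with convolution and can be put on \<open>u\<close>. There
  they converge to the Hessian form of \<open>K\<close> and are bounded by its maximum, so dominated
  convergence applies; on the trigonometric side they converge to the form of
  \<open>trig_hess\<close>.\<close>

lemma conv_hessian:
  fixes u :: "real^'n \<Rightarrow> real"
  assumes pc: "peak_convolution \<rho> r" and u: "C2_hessian u K"
    and supp: "\<And>x. norm x > r \<Longrightarrow> u x = 0" "\<And>x. norm x > r \<Longrightarrow> K x = 0"
    and L: "trig_sum L = peak_convolution.conv \<rho> r N u"
  shows "v \<bullet> (trig_hess L x *v v) = peak_convolution.conv \<rho> r N (\<lambda>z. v \<bullet> (K z *v v)) x"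
proof -
  interpret peak_convolution \<rho> r "TYPE(real^'n)" by (rule pc)
  obtain G where G: "\<And>x. (u has_derivative (\<lambda>v. G x \<bullet> v)) (at x)" "\<And>x. (G has_derivative (\<lambda>v. K x *v v)) (at x)"
    "continuous_on UNIV K" using C2_hessian_gradient[OF u] by blast
  have cu: "continuous_on UNIV u" using G(1) by (auto intro!: has_derivative_continuous_on intro: has_derivative_at_withinI)
  define w where "w = (\<lambda>z. v \<bullet> (K z *v v))"
  have cw: "continuous_on UNIV w" unfolding w_def by (rule continuous_on_bilinear_form[OF G(3)])
  have w0: "w x = 0" if "norm x > r" for x using supp(2)[OF that] by (simp add: w_def)
  obtain M where M: "0 < M" "\<And>x. norm (w x) \<le> M" using compact_support_bounded[OF cw w0] by blast
  define P where "P = (\<lambda>y::real^'n. peak \<rho> y ^ N)"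
  have cP: "continuous_on UNIV P" unfolding P_def by (intro continuous_intros continuous_peak)
  \<comment> \<open>A sequence, as dominated convergence requires; steps of at most 1 keep the
    supports of all second differences in one ball.\<close>
  define t where "t = (\<lambda>n. 1 / real (Suc n))"
  have t: "0 < t n" "t n \<le> 1" for n by (auto simp: t_def)
  have "t \<longlonglongrightarrow> 0" unfolding t_def using LIMSEQ_inverse_real_of_nat by (simp add: inverse_eq_divide)
  then have tr: "filterlim t (at_right 0) sequentially"
    using t(1) less_imp_neq[OF t(1)] by (auto simp: filterlim_at)
  define D where "D = (\<lambda>(g :: real^'n \<Rightarrow> real) n x. (g (x + t n *\<^sub>R v) + g (x - t n *\<^sub>R v) - 2 * g x) / (t n)\<^sup>2)"
  obtain G' where G': "\<And>x. (trig_sum L has_derivative (\<lambda>v. G' x \<bullet> v)) (at x)" "\<And>x. (G' has_derivative (\<lambda>v. trig_hess L x *v v)) (at x)"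
    "continuous_on UNIV (trig_hess L)" using C2_hessian_gradient[OF C2_hessian_trig_sum] by blast
  have A: "(\<lambda>n. D (trig_sum L) n x) \<longlonglongrightarrow> v \<bullet> (trig_hess L x *v v)"
    unfolding D_def by (rule filterlim_compose[OF second_difference_limit[OF G'] tr])
  have B: "D (trig_sum L) n x = (LINT z|lborel. D u n z * P (x - z)) / mass N" for n
  proof -
    have int: "integrable lborel (\<lambda>z. u (z + c) * P (x - z))" for c
    proof (rule integrable_compact_support[of _ "r + norm c"])
      show "continuous_on UNIV (\<lambda>z. u (z + c) * P (x - z))"
        by (intro continuous_intros continuous_on_compose2[OF cu] continuous_on_compose2[OF cP]) auto
      fix z :: "real^'n" assume "norm z > r + norm c"
      then have "norm (z + c) > r" using norm_triangle_ineq4[of "z + c" c] by simp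
      then show "u (z + c) * P (x - z) = 0" using supp(1) by simp
    qed
    have tr: "conv N u (x + c) = (LINT z|lborel. u (z + c) * P (x - z)) / mass N" for c
    proof -
      have "(LINT z|lborel. u z * P (x + c - z)) = (LINT z|lborel. (\<lambda>z. u z * P (x + c - z)) (z + c))"
        by (rule lborel_integral_translate_reflect(1)[symmetric])
           (intro continuous_intros cu continuous_on_compose2[OF cP]; simp)
      then show ?thesis by (simp add: conv_def P_def)
    qed
    have "D (trig_sum L) n x = ((LINT z|lborel. u (z + t n *\<^sub>R v) * P (x - z)) + (LINT z|lborel. u (z + (- t n) *\<^sub>R v) * P (x - z))
        - 2 * (LINT z|lborel. u (z + 0) * P (x - z))) / (t n)\<^sup>2 / mass N"
      using tr[of "t n *\<^sub>R v"] tr[of "(- t n) *\<^sub>R v"] tr[of 0] unfolding D_def L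
      by (simp add: add_divide_distrib diff_divide_distrib mult.commute)
    also have "\<dots> = (LINT z|lborel. (u (z + t n *\<^sub>R v) * P (x - z) + u (z + (- t n) *\<^sub>R v) * P (x - z)
        - 2 * (u (z + 0) * P (x - z))) / (t n)\<^sup>2) / mass N"
      using int[of "t n *\<^sub>R v"] int[of "(- t n) *\<^sub>R v"] int[of 0] by simp
    also have "(\<lambda>z. (u (z + t n *\<^sub>R v) * P (x - z) + u (z + (- t n) *\<^sub>R v) * P (x - z) - 2 * (u (z + 0) * P (x - z))) / (t n)\<^sup>2)
        = (\<lambda>z. D u n z * P (x - z))"
      by (simp add: D_def fun_eq_iff algebra_simps)
    finally show ?thesis .
  qed
  have C: "(\<lambda>n. LINT z|lborel. D u n z * P (x - z)) \<longlonglongrightarrow> (LINT z|lborel. w z * P (x - z))"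
  proof (rule integral_dominated_convergence)
    show "integrable lborel (\<lambda>z. M * indicator (cball (0::real^'n) (r + norm v)) z)"
      using emeasure_bounded_finite[OF bounded_cball[of "0::real^'n" "r + norm v"]]
      by (intro integrable_mult_right integrable_real_indicator) (simp_all add: infinity_ennreal_def)
    show "(\<lambda>z. w z * P (x - z)) \<in> borel_measurable lborel"
      using cw cP by (auto intro!: borel_measurable_continuous_onI continuous_intros continuous_on_compose2[OF cP])
    show "(\<lambda>z. D u n z * P (x - z)) \<in> borel_measurable lborel" for n
    proof -
      have "continuous_on UNIV (\<lambda>z. D u n z * P (x - z))" unfolding D_def using t(1)[of n]
        by (intro continuous_intros continuous_on_compose2[OF cP] continuous_on_compose2[OF cu]) auto
      then show ?thesis using borel_measurable_continuous_onI by auto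
    qed
    show "AE z in lborel. (\<lambda>n. D u n z * P (x - z)) \<longlonglongrightarrow> w z * P (x - z)"
      unfolding D_def w_def
      by (intro AE_I2 tendsto_mult tendsto_const filterlim_compose[OF second_difference_limit[OF G] tr])
    show "AE z in lborel. norm (D u n z * P (x - z)) \<le> M * indicator (cball 0 (r + norm v)) z" for n
    proof (rule AE_I2)
      fix z
      have P1: "\<bar>P y\<bar> \<le> 1" for y unfolding P_def using peak_bounds(1,2)[of \<rho> y] by (simp add: power_le_one)
      show "norm (D u n z * P (x - z)) \<le> M * indicator (cball 0 (r + norm v)) z"
      proof (cases "norm z \<le> r + norm v")
        case True
        obtain s s' where "D u n z = (w (z + s *\<^sub>R v) + w (z + s' *\<^sub>R v)) / 2"
          using second_difference[OF G(1,2) t(1), of n z v] unfolding D_def w_def by blast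
        then have "\<bar>D u n z\<bar> \<le> M" using M(2)[of "z + s *\<^sub>R v"] M(2)[of "z + s' *\<^sub>R v"] by (simp add: abs_le_iff)
        then have "\<bar>D u n z\<bar> * \<bar>P (x - z)\<bar> \<le> M * 1" using P1 M(1) by (intro mult_mono) auto
        then show ?thesis using True by (simp add: abs_mult)
      next
        case False
        have "norm (t n *\<^sub>R v) \<le> norm v" using t[of n] by (simp add: mult_left_le_one_le)
        then have "norm (z + t n *\<^sub>R v) > r \<and> norm (z - t n *\<^sub>R v) > r"
          using False norm_triangle_ineq4[of "z + t n *\<^sub>R v" "t n *\<^sub>R v"] norm_triangle_ineq[of "z - t n *\<^sub>R v" "t n *\<^sub>R v"]
          by simp
        moreover have "norm z > r" using False add_increasing2[OF norm_ge_zero[of v] order.refl, of r] by linarith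
        ultimately show ?thesis using supp(1) False by (simp add: D_def)
      qed
    qed
  qed
  have "(\<lambda>n. D (trig_sum L) n x) \<longlonglongrightarrow> conv N w x"
    unfolding B conv_def using C mass_pos[of N] by (intro tendsto_divide tendsto_const) (auto simp: P_def)
  with A show ?thesis unfolding w_def by (rule LIMSEQ_unique)
qed

text \<open>\<open>U\<close> is the periodic extension of \<open>u\<close>, to which the
  convolutions converge uniformly on the whole space. The bound \<open>\<Lambda>\<close> does not
  depend on \<open>N\<close>, so one quadratic form will make all approximants convex.\<close>

lemma trig_approximation:
  fixes u :: "real^'n \<Rightarrow> real"
  assumes u: "C2_hessian u K" and r: "0 < r" and supp: "\<And>x. norm x > r \<Longrightarrow> u x = 0" "\<And>x. norm x > r \<Longrightarrow> K x = 0"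
    and R: "0 < R"
  shows "\<exists>(L :: nat \<Rightarrow> (real \<times> (real^'n) \<times> real) list) U \<Lambda>. 0 < \<Lambda> \<and>
    (\<forall>e>0. \<forall>\<^sub>F N in sequentially. \<forall>x. \<bar>trig_sum (L N) x - U x\<bar> \<le> e) \<and>
    (\<forall>x. norm x < R \<longrightarrow> U x = u x) \<and>
    (\<forall>N x v. \<bar>v \<bullet> (trig_hess (L N) x *v v)\<bar> \<le> \<Lambda> * (v \<bullet> v)) \<and>
    (\<forall>x. norm x < R \<longrightarrow> (\<lambda>N. trig_hess (L N) x) \<longlonglongrightarrow> K x)"
proof -
  \<comment> \<open>Half the period exceeds both \<open>r\<close> and \<open>R\<close>: copies of
    the support stay apart, and points of norm below \<open>R\<close> are already reduced.\<close>
  define \<rho> where "\<rho> = r + R"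
  have pc: "peak_convolution \<rho> r" using r R by unfold_locales (auto simp: \<rho>_def)
  interpret peak_convolution \<rho> r "TYPE(real^'n)" by (rule pc)
  obtain G where G: "\<And>x. (u has_derivative (\<lambda>v. G x \<bullet> v)) (at x)" "\<And>x. (G has_derivative (\<lambda>v. K x *v v)) (at x)"
    "continuous_on UNIV K" using C2_hessian_gradient[OF u] by blast
  have cu: "continuous_on UNIV u" using G(1) by (auto intro!: has_derivative_continuous_on intro: has_derivative_at_withinI)
  have "\<exists>L. trig_sum L = conv N u" for N using conv_trig[OF cu supp(1), of N] by (auto simp: trig_def)
  then obtain L where L: "\<And>N. trig_sum (L N) = conv N u" by metis
  have hess: "v \<bullet> (trig_hess (L N) x *v v) = conv N (\<lambda>z. v \<bullet> (K z *v v)) x" for N x v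
    by (rule conv_hessian[OF pc u supp L])
  obtain \<Lambda> where \<Lambda>: "0 < \<Lambda>" "\<And>x. norm (K x) \<le> \<Lambda>" using compact_support_bounded[OF G(3) supp(2)] by blast
  have cw: "continuous_on UNIV (\<lambda>z. v \<bullet> (K z *v v))" for v by (rule continuous_on_bilinear_form[OF G(3)])
  have w0: "v \<bullet> (K x *v v) = 0" if "norm x > r" for x v using supp(2)[OF that] by simp
  have wb: "\<bar>v \<bullet> (K x *v v)\<bar> \<le> \<Lambda> * (v \<bullet> v)" for x v
  proof -
    have "\<bar>v \<bullet> (K x *v v)\<bar> \<le> norm v * (norm (K x) * norm v)"
      by (rule order.trans[OF Cauchy_Schwarz_ineq2]) (intro mult_left_mono norm_matrix_vector_le norm_ge_zero)
    also have "\<dots> = norm (K x) * (v \<bullet> v)" by (simp add: power2_norm_eq_inner[symmetric] power2_eq_square)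
    also have "\<dots> \<le> \<Lambda> * (v \<bullet> v)" by (intro mult_right_mono \<Lambda>) simp
    finally show ?thesis .
  qed
  have near: "period_reduce \<rho> x = x" if "norm x < R" for x :: "real^'n"
    using that r by (intro period_reduce_id) (simp add: \<rho>_def)
  have 1: "\<forall>\<^sub>F N in sequentially. \<forall>x. \<bar>trig_sum (L N) x - u (period_reduce \<rho> x)\<bar> \<le> e" if "0 < e" for e
    unfolding L by (rule conv_approx[OF cu supp(1) that])
  have 2: "\<bar>v \<bullet> (trig_hess (L N) x *v v)\<bar> \<le> \<Lambda> * (v \<bullet> v)" for N x v
    unfolding hess by (rule conv_bounds[OF cw w0 wb])
  have 3: "(\<lambda>N. trig_hess (L N) x) \<longlonglongrightarrow> K x" if x: "norm x < R" for x
  proof (rule tendsto_matrix_of_quadratic[OF trig_hess_symmetric C2_hessian_symmetric[OF u]])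
    fix v
    show "(\<lambda>N. v \<bullet> (trig_hess (L N) x *v v)) \<longlonglongrightarrow> v \<bullet> (K x *v v)"
    proof (rule tendstoI)
      fix e :: real assume e: "0 < e"
      have "\<forall>\<^sub>F N in sequentially. \<forall>x. \<bar>conv N (\<lambda>z. v \<bullet> (K z *v v)) x - v \<bullet> (K (period_reduce \<rho> x) *v v)\<bar> \<le> e / 2"
        by (rule conv_approx[OF cw w0 half_gt_zero[OF e]])
      then show "\<forall>\<^sub>F N in sequentially. dist (v \<bullet> (trig_hess (L N) x *v v)) (v \<bullet> (K x *v v)) < e"
      proof eventually_elim
        case (elim N)
        from spec[OF elim, of x] e show ?case unfolding hess near[OF x] dist_real_def by linarith
      qed
    qed
  qed
  show ?thesis
    using \<Lambda>(1) 1 2 3 near by (intro exI[of _ L] exI[of _ "\<lambda>x. u (period_reduce \<rho> x)"] exI[of _ \<Lambda>]) auto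
qed

section \<open>The density formula\<close>

lemma C2_hessian_continuous: "C2_hessian f H \<Longrightarrow> continuous_on UNIV H"
  unfolding C2_hessian_def by blast

text \<open>It makes bounded closed sets of positive semidefinite matrices compact, so that the
  continuous \<open>quad_val\<close> is bounded on them.\<close>

lemma closed_psd: "closed {A :: real^'n^'n. psd A}"
  unfolding closed_sequential_limits
proof (intro allI impI, elim conjE)
  fix As :: "nat \<Rightarrow> real^'n^'n" and A
  assume As: "\<forall>n. As n \<in> {A. psd A}" and lim: "As \<longlonglongrightarrow> A"
  have ent: "(\<lambda>n. As n $ i $ j) \<longlonglongrightarrow> A $ i $ j" for i j by (intro tendsto_vec_nth lim)
  have "A $ j $ i = A $ i $ j" for i j
  proof (rule LIMSEQ_unique[OF ent])
    have "As n $ i $ j = As n $ j $ i" for n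
    proof -
      have "transpose (As n) $ j $ i = As n $ j $ i" using As by (simp add: psd_def)
      then show ?thesis by (simp add: transpose_def)
    qed
    then show "(\<lambda>n. As n $ j $ i) \<longlonglongrightarrow> A $ i $ j" using ent[of i j] by simp
  qed
  moreover have "0 \<le> x \<bullet> (A *v x)" for x
  proof (rule LIMSEQ_le_const)
    show "(\<lambda>n. x \<bullet> (As n *v x)) \<longlonglongrightarrow> x \<bullet> (A *v x)"
      unfolding inner_vec_def matrix_vector_mult_def by (simp, intro tendsto_intros ent)
    show "\<exists>N. \<forall>n\<ge>N. 0 \<le> x \<bullet> (As n *v x)" using As by (auto simp: psd_def)
  qed
  ultimately show "A \<in> {A. psd A}" by (simp add: psd_def transpose_def vec_eq_iff)
qed

text \<open>The outer products of these vectors are \<open>\<bar>c\<bar>\<close> times those of the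
  frequencies; their sum makes each cosine convex by itself. A list of vectors allows the shift to
  be removed one rank one direction at a time.\<close>

definition trig_shift :: "(real \<times> (real^'n) \<times> real) list \<Rightarrow> (real^'n) list" where
  "trig_shift L = map (\<lambda>(c, a, b). sqrt \<bar>c\<bar> *\<^sub>R a) L"

lemma outer_sqrt: "0 \<le> t \<Longrightarrow> outer (sqrt t *\<^sub>R a) = t *\<^sub>R outer a"
  by (simp add: outer_def vec_eq_iff)

lemma psd_sum_outer: "psd (sum_list (map outer E))"
  by (induction E) (auto intro: psd_add psd_outer psd_zero)

section \<open>From ridges to trigonometric perturbations and C2 functions\<close>

context so_valuation
begin

definition has_density :: "(real^'n \<Rightarrow> complex) \<Rightarrow> (real^'n \<Rightarrow> real) \<Rightarrow> (real^'n \<Rightarrow> real^'n^'n) \<Rightarrow> bool" where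
  "has_density \<phi> h H \<longleftrightarrow> cint (\<Psi> h) \<phi> = (LINT x|lborel. \<phi> x * quad_val (H x))"

text \<open>The formula is required for every added form \<open>quad A\<close>: the ridge formula
  compares a function with the same function plus \<open>quad1 e\<close>, so that an induction over
  ridges must be free to change \<open>A\<close>.\<close>

definition stable_density :: "(real^'n \<Rightarrow> real) \<Rightarrow> (real^'n \<Rightarrow> real^'n^'n) \<Rightarrow> bool" where
  "stable_density h H \<longleftrightarrow> h \<in> Conv \<and> continuous_on UNIV H \<and> (\<forall>x. psd (H x)) \<and>
    (\<forall>A. psd A \<longrightarrow> (\<forall>\<phi>\<in>Cc. has_density \<phi> (\<lambda>x. quad A x + h x) (\<lambda>x. A + H x)))"

lemma continuous_quad_val_compose:
  "continuous_on S H \<Longrightarrow> (\<And>x. x \<in> S \<Longrightarrow> psd (H x)) \<Longrightarrow> continuous_on S (\<lambda>x. quad_val (H x))"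
  by (rule continuous_on_compose2[OF continuous_quad_val]) auto

lemma integrable_quad_val:
  assumes "continuous_on UNIV H" "\<And>x. psd (H x)" "\<phi> \<in> Cc"
  shows "integrable lborel (\<lambda>x. \<phi> x * quad_val (H x))"
  using radon_rep_integrable[OF radon_rep_density_measure bbf_Cc[OF assms(3)]] continuous_quad_val_compose assms(1,2)
  by blast

lemma stable_density_zero: "stable_density (\<lambda>x. 0) (\<lambda>x. 0)"
  by (simp add: stable_density_def has_density_def Conv_const psd_zero cint_val_quad)

text \<open>\<open>cint_ridge\<close> expresses the new integral by the old formula for
  \<open>A\<close> and for \<open>A + outer e\<close>, with the test functions \<open>\<phi>\<close>
  and \<open>\<phi>'\<close>. Pointwise the densities match because \<open>quad_val\<close> is
  affine along \<open>outer e\<close>.\<close>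

lemma stable_density_ridge:
  assumes s: "stable_density h H" and cg: "convex_on UNIV g"
    and g: "\<And>t. (g has_real_derivative g' t) (at t)" "\<And>t. (g' has_real_derivative d t) (at t)"
    and d: "continuous_on UNIV d" "\<And>t. 0 \<le> d t"
  shows "stable_density (\<lambda>x. h x + g (e \<bullet> x)) (\<lambda>x. H x + d (e \<bullet> x) *\<^sub>R outer e)"
  unfolding stable_density_def
proof (intro conjI allI ballI impI)
  have h: "h \<in> Conv" and H: "continuous_on UNIV H" "\<And>x. psd (H x)"
    and dens: "\<And>A \<phi>. psd A \<Longrightarrow> \<phi> \<in> Cc \<Longrightarrow> has_density \<phi> (\<lambda>x. quad A x + h x) (\<lambda>x. A + H x)"
    using s by (auto simp: stable_density_def)
  show "(\<lambda>x. h x + g (e \<bullet> x)) \<in> Conv" by (intro Conv_add Conv_ridge h cg)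
  have cd: "continuous_on UNIV (\<lambda>x. d (e \<bullet> x))" by (intro continuous_on_compose2[OF d(1)] continuous_intros) auto
  show "continuous_on UNIV (\<lambda>x. H x + d (e \<bullet> x) *\<^sub>R outer e)" by (intro continuous_intros H cd)
  show "psd (H x + d (e \<bullet> x) *\<^sub>R outer e)" for x by (intro psd_add psd_scale psd_outer H d)
  fix A :: "real^'n^'n" and \<phi> :: "real^'n \<Rightarrow> complex" assume A: "psd A" and \<phi>: "\<phi> \<in> Cc"
  define \<phi>' where "\<phi>' = (\<lambda>x. \<phi> x * complex_of_real (d (e \<bullet> x)))"
  have \<phi>': "\<phi>' \<in> Cc"
  proof -
    have "continuous_on UNIV \<phi>'" using \<phi> unfolding Cc_def \<phi>'_def by (intro continuous_intros cd) auto
    moreover have "{x. \<phi>' x \<noteq> 0} \<subseteq> {x. \<phi> x \<noteq> 0}" by (auto simp: \<phi>'_def)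
    ultimately show ?thesis using \<phi> bounded_subset unfolding Cc_def by blast
  qed
  have hA: "(\<lambda>x. quad A x + h x) \<in> Conv" by (intro Conv_add Conv_quad A h)
  have A': "psd (A + outer e)" by (intro psd_add A psd_outer)
  have i1: "continuous_on UNIV (\<lambda>x. A + H x)" "\<And>x. psd (A + H x)" by (intro continuous_intros H) (intro psd_add A H)
  have i2: "continuous_on UNIV (\<lambda>x. A + outer e + H x)" "\<And>x. psd (A + outer e + H x)"
    by (intro continuous_intros H) (intro psd_add A' H)
  have "(\<lambda>x. (quad A x + h x) + quad1 e x) = (\<lambda>x. quad (A + outer e) x + h x)"
    by (simp add: quad_add quad_outer quad1_def add_ac)
  then have "cint (\<Psi> (\<lambda>x. (quad A x + h x) + g (e \<bullet> x))) \<phi> = cint (\<Psi> (\<lambda>x. quad A x + h x)) \<phi> +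
      (cint (\<Psi> (\<lambda>x. quad (A + outer e) x + h x)) \<phi>' - cint (\<Psi> (\<lambda>x. quad A x + h x)) \<phi>')"
    using cint_ridge[OF hA cg g d \<phi>, of e] by (simp add: \<phi>'_def)
  also have "\<dots> = (LINT x|lborel. \<phi> x * quad_val (A + H x)) +
      ((LINT x|lborel. \<phi>' x * quad_val (A + outer e + H x)) - (LINT x|lborel. \<phi>' x * quad_val (A + H x)))"
    using dens[OF A \<phi>] dens[OF A' \<phi>'] dens[OF A \<phi>'] by (simp add: has_density_def)
  also have "\<dots> = (LINT x|lborel. \<phi> x * quad_val (A + H x) +
      (\<phi>' x * quad_val (A + outer e + H x) - \<phi>' x * quad_val (A + H x)))"
    using integrable_quad_val[OF i1 \<phi>] integrable_quad_val[OF i2 \<phi>'] integrable_quad_val[OF i1 \<phi>'] by simp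
  also have "\<dots> = (LINT x|lborel. \<phi> x * quad_val (A + (H x + d (e \<bullet> x) *\<^sub>R outer e)))"
  proof (rule Bochner_Integration.integral_cong)
    fix x
    have "quad_val (A + (H x + d (e \<bullet> x) *\<^sub>R outer e)) = quad_val ((A + H x) + d (e \<bullet> x) *\<^sub>R outer e)"
      by (simp add: add.assoc)
    also have "\<dots> = quad_val (A + H x) + complex_of_real (d (e \<bullet> x)) * (quad_val (A + H x + outer e) - quad_val (A + H x))"
      by (rule quad_val_outer[OF i1(2) d(2)])
    also have "A + H x + outer e = A + outer e + H x" by (simp add: add_ac)
    finally have *: "quad_val (A + (H x + d (e \<bullet> x) *\<^sub>R outer e)) =
      quad_val (A + H x) + complex_of_real (d (e \<bullet> x)) * (quad_val (A + outer e + H x) - quad_val (A + H x))" .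
    show "\<phi> x * quad_val (A + H x) + (\<phi>' x * quad_val (A + outer e + H x) - \<phi>' x * quad_val (A + H x))
      = \<phi> x * quad_val (A + (H x + d (e \<bullet> x) *\<^sub>R outer e))"
      unfolding * \<phi>'_def by (simp add: algebra_simps)
  qed simp
  finally show "has_density \<phi> (\<lambda>x. quad A x + (h x + g (e \<bullet> x))) (\<lambda>x. A + (H x + d (e \<bullet> x) *\<^sub>R outer e))"
    by (simp add: has_density_def add.assoc)
qed

text \<open>Both sides of the density formula are affine along a ridge direction, so that the formula
  at two points of a half line gives it at the endpoint.\<close>

lemma has_density_extrapolate:
  assumes h: "h \<in> Conv" and H: "continuous_on UNIV H" "\<And>x. psd (H x)" and \<phi>: "\<phi> \<in> Cc"
    and 1: "has_density \<phi> (\<lambda>x. h x + quad (outer e) x) (\<lambda>x. H x + outer e)"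
    and 2: "has_density \<phi> (\<lambda>x. h x + quad (2 *\<^sub>R outer e) x) (\<lambda>x. H x + 2 *\<^sub>R outer e)"
  shows "has_density \<phi> h H"
proof -
  have q: "quad (outer e) x = quad1 e x" for x by (simp add: quad_outer quad1_def)
  have c: "(\<lambda>x. h x + quad1 e x) \<in> Conv" "(\<lambda>x. h x + 2 * quad1 e x) \<in> Conv"
    using h by (auto intro!: Conv_add Conv_cmult Conv_quad1)
  have "\<Psi> h = (\<lambda>B. 2 * \<Psi> (\<lambda>x. h x + quad1 e x) B + (-1) * \<Psi> (\<lambda>x. h x + 2 * quad1 e x) B)"
    using val_quad1_affine[OF h, of 2 e] by (simp add: fun_eq_iff algebra_simps)
  then have "cint (\<Psi> h) \<phi> = cint (\<lambda>B. 2 * \<Psi> (\<lambda>x. h x + quad1 e x) B + (-1) * \<Psi> (\<lambda>x. h x + 2 * quad1 e x) B) \<phi>"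
    by (rule arg_cong[where f="\<lambda>\<mu>. cint \<mu> \<phi>"])
  also have "\<dots> = 2 * cint (\<Psi> (\<lambda>x. h x + quad1 e x)) \<phi> + (-1) * cint (\<Psi> (\<lambda>x. h x + 2 * quad1 e x)) \<phi>"
    by (rule cint_lincomb_measure[OF cradon_val[OF c(1)] cradon_val[OF c(2)] bbf_Cc[OF \<phi>]])
  also have "\<dots> = 2 * (LINT x|lborel. \<phi> x * quad_val (H x + outer e)) + (-1) * (LINT x|lborel. \<phi> x * quad_val (H x + 2 *\<^sub>R outer e))"
    using 1 2 by (simp add: has_density_def q quad_scale)
  also have "\<dots> = (LINT x|lborel. 2 * (\<phi> x * quad_val (H x + outer e)) + (-1) * (\<phi> x * quad_val (H x + 2 *\<^sub>R outer e)))"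
  proof -
    have "integrable lborel (\<lambda>x. \<phi> x * quad_val (H x + outer e))"
      by (intro integrable_quad_val continuous_intros H psd_add psd_outer \<phi>)
    moreover have "integrable lborel (\<lambda>x. \<phi> x * quad_val (H x + 2 *\<^sub>R outer e))"
      by (intro integrable_quad_val continuous_intros H psd_add psd_scale psd_outer \<phi>) simp
    ultimately show ?thesis by simp
  qed
  also have "\<dots> = (LINT x|lborel. \<phi> x * quad_val (H x))"
  proof (rule Bochner_Integration.integral_cong)
    fix x
    have *: "quad_val (H x + 2 *\<^sub>R outer e) = 2 * quad_val (H x + outer e) - quad_val (H x)"
      using quad_val_outer[OF H(2), of 2 x e] by simp
    show "2 * (\<phi> x * quad_val (H x + outer e)) + (-1) * (\<phi> x * quad_val (H x + 2 *\<^sub>R outer e)) = \<phi> x * quad_val (H x)"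
      unfolding * by (simp add: algebra_simps)
  qed simp
  finally show ?thesis by (simp add: has_density_def)
qed

text \<open>One vector of \<open>E\<close> is removed at a time by
  \<open>has_density_extrapolate\<close>. The premise ranges over all \<open>A\<close>, so that it
  covers the shifts by both \<open>outer e\<close> and \<open>2 *\<^sub>R outer e\<close>.\<close>

lemma has_density_descend:
  assumes h: "h \<in> Conv" and H: "continuous_on UNIV H" "\<And>x. psd (H x)" and \<phi>: "\<phi> \<in> Cc"
  shows "(\<And>A. psd A \<Longrightarrow> has_density \<phi> (\<lambda>x. h x + quad (sum_list (map outer E) + A) x) (\<lambda>x. H x + (sum_list (map outer E) + A)))
    \<Longrightarrow> psd A \<Longrightarrow> has_density \<phi> (\<lambda>x. h x + quad A x) (\<lambda>x. H x + A)"
proof (induction E arbitrary: A)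
  case (Cons e E)
  show ?case
  proof (rule Cons.IH[OF _ Cons.prems(2)])
    fix A :: "real^'n^'n" assume A: "psd A"
    define C where "C = sum_list (map outer E) + A"
    have C: "psd C" unfolding C_def by (intro psd_add psd_sum_outer A)
    have "has_density \<phi> (\<lambda>x. h x + quad C x) (\<lambda>x. H x + C)"
    proof (rule has_density_extrapolate[where e=e])
      show "(\<lambda>x. h x + quad C x) \<in> Conv" by (intro Conv_add h Conv_quad C)
      show "continuous_on UNIV (\<lambda>x. H x + C)" "\<And>x. psd (H x + C)" by (intro continuous_intros H) (intro psd_add H C)
      have e1: "sum_list (map outer (e # E)) + A = C + outer e" by (simp add: C_def add_ac)
      show "has_density \<phi> (\<lambda>x. h x + quad C x + quad (outer e) x) (\<lambda>x. H x + C + outer e)"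
        using Cons.prems(1)[OF A] unfolding e1 by (simp add: quad_add add.assoc)
      have e2: "sum_list (map outer (e # E)) + (A + outer e) = C + 2 *\<^sub>R outer e" by (simp add: C_def scaleR_2 add_ac)
      show "has_density \<phi> (\<lambda>x. h x + quad C x + quad (2 *\<^sub>R outer e) x) (\<lambda>x. H x + C + 2 *\<^sub>R outer e)"
        using Cons.prems(1)[OF psd_add[OF A psd_outer[of e]]] unfolding e2 by (simp add: quad_add add.assoc)
    qed (rule \<phi>)
    then show "has_density \<phi> (\<lambda>x. h x + quad (sum_list (map outer E) + A) x) (\<lambda>x. H x + (sum_list (map outer E) + A))"
      by (simp add: C_def)
  qed
qed simp

text \<open>A cosine of amplitude \<open>c\<close> plus \<open>\<bar>c\<bar>\<close> times half the
  square has nonnegative second derivative, so \<open>stable_density_ridge\<close> adds the terms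
  one by one.\<close>

lemma stable_density_trig:
  "stable_density (\<lambda>x. trig_sum L x + quad (sum_list (map outer (trig_shift L))) x)
    (\<lambda>x. trig_hess L x + sum_list (map outer (trig_shift L)))"
proof (induction L)
  case Nil
  then show ?case using stable_density_zero by (simp add: trig_shift_def quad_def)
next
  case (Cons p L)
  obtain c a b where p: "p = (c, a, b)" by (cases p)
  define S where "S = sum_list (map outer (trig_shift L))"
  define g where "g = (\<lambda>t. c * cos (t + b) + \<bar>c\<bar> * (t\<^sup>2 / 2))"
  define g' where "g' = (\<lambda>t. - c * sin (t + b) + \<bar>c\<bar> * t)"
  define d where "d = (\<lambda>t. - c * cos (t + b) + \<bar>c\<bar>)"
  have g: "(g has_real_derivative g' t) (at t)" "(g' has_real_derivative d t) (at t)" for t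
    unfolding g_def g'_def d_def by (auto intro!: derivative_eq_intros)
  have d: "0 \<le> d t" for t
  proof -
    have "\<bar>c * cos (t + b)\<bar> \<le> \<bar>c\<bar> * 1" unfolding abs_mult by (intro mult_left_mono abs_cos_le_one) simp
    then show ?thesis by (simp add: d_def abs_le_iff)
  qed
  have cg: "convex_on UNIV g" by (rule f''_ge0_imp_convex[OF convex_UNIV g d])
  have "continuous_on UNIV d" unfolding d_def by (intro continuous_intros)
  from stable_density_ridge[OF Cons cg g this d, of a]
  have "stable_density (\<lambda>x. trig_sum L x + quad S x + g (a \<bullet> x)) (\<lambda>x. trig_hess L x + S + d (a \<bullet> x) *\<^sub>R outer a)"
    by (simp add: S_def)
  moreover have e: "sum_list (map outer (trig_shift (p # L))) = \<bar>c\<bar> *\<^sub>R outer a + S"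
    by (simp add: trig_shift_def p S_def outer_sqrt)
  have "(\<lambda>x. trig_sum L x + quad S x + g (a \<bullet> x)) = (\<lambda>x. trig_sum (p # L) x + quad (sum_list (map outer (trig_shift (p # L)))) x)"
    unfolding e by (simp add: p g_def quad_add quad_scale quad_outer fun_eq_iff)
  moreover have "(\<lambda>x. trig_hess L x + S + d (a \<bullet> x) *\<^sub>R outer a) = (\<lambda>x. trig_hess (p # L) x + sum_list (map outer (trig_shift (p # L))))"
    unfolding e by (simp add: p d_def fun_eq_iff algebra_simps)
  ultimately show ?case by simp
qed

text \<open>Here convexity is asked of the whole sum and not of its single terms; the larger shift
  of \<open>stable_density_trig\<close> is removed by \<open>has_density_descend\<close>.\<close>

lemma has_density_trig:
  assumes A: "psd A" and conv: "\<And>x. psd (A + trig_hess L x)" and \<phi>: "\<phi> \<in> Cc"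
  shows "(\<lambda>x. quad A x + trig_sum L x) \<in> Conv"
    and "has_density \<phi> (\<lambda>x. quad A x + trig_sum L x) (\<lambda>x. A + trig_hess L x)"
proof -
  have tA: "transpose A = A" using A by (simp add: psd_def)
  have C2: "C2_hessian (\<lambda>x. quad A x + trig_sum L x) (\<lambda>x. A + trig_hess L x)"
    by (rule C2_hessian_add[OF C2_hessian_quad[OF tA] C2_hessian_trig_sum])
  show h: "(\<lambda>x. quad A x + trig_sum L x) \<in> Conv"
    using conv by (intro C2_psd_Conv[OF C2]) (auto simp: psd_def)
  define S where "S = sum_list (map outer (trig_shift L))"
  have "has_density \<phi> (\<lambda>x. (quad A x + trig_sum L x) + quad 0 x) (\<lambda>x. (A + trig_hess L x) + 0)"
  proof (rule has_density_descend[OF h _ conv \<phi>, where E="trig_shift L"])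
    show "continuous_on UNIV (\<lambda>x. A + trig_hess L x)" by (rule C2_hessian_continuous[OF C2])
    fix B :: "real^'n^'n" assume B: "psd B"
    have "has_density \<phi> (\<lambda>x. quad (A + B) x + (trig_sum L x + quad S x)) (\<lambda>x. (A + B) + (trig_hess L x + S))"
      using stable_density_trig[of L] psd_add[OF A B] \<phi> unfolding stable_density_def S_def by blast
    then show "has_density \<phi> (\<lambda>x. quad A x + trig_sum L x + quad (sum_list (map outer (trig_shift L)) + B) x)
        (\<lambda>x. A + trig_hess L x + (sum_list (map outer (trig_shift L)) + B))"
      by (simp add: S_def[symmetric] quad_add add_ac)
  qed (rule psd_zero)
  then show "has_density \<phi> (\<lambda>x. quad A x + trig_sum L x) (\<lambda>x. A + trig_hess L x)"
    by (simp add: quad_def)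
qed

text \<open>The witness is \<open>s = 1 + \<Lambda>\<close>: the 1 is the form
  \<open>quad (mat 1)\<close> added before the cutoff, and \<open>\<Lambda>\<close> bounds the
  Hessians of the approximants. Near the support of \<open>\<phi>\<close> the limit of the
  approximants is the shifted \<open>f\<close> up to an affine function.\<close>

lemma has_density_C2_shifted:
  assumes f: "f \<in> Conv" and H: "C2_hessian f H" and \<phi>: "\<phi> \<in> Cc"
  shows "\<exists>s\<ge>0. \<forall>A. psd A \<longrightarrow> has_density \<phi> (\<lambda>x. f x + quad (s *\<^sub>R mat 1 + A) x) (\<lambda>x. H x + (s *\<^sub>R mat 1 + A))"
proof -
  obtain R where R: "R > 0" "\<And>x. norm x > R \<Longrightarrow> \<phi> x = 0" using bbf_support[OF bbf_Cc[OF \<phi>]] by blast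
  obtain u K a b r where cut: "C2_hessian u K \<and> r > 0 \<and> (\<forall>x. norm x > r \<longrightarrow> u x = 0 \<and> K x = 0) \<and>
    (\<forall>x\<in>cball 0 (R + 1). u x = f x + quad (mat 1) x + (a \<bullet> x + b) \<and> K x = H x + mat 1)"
    using C2_cutoff[OF f H, of "R + 1"] by (elim exE) (erule that)
  then have u: "C2_hessian u K" and r: "r > 0" "\<And>x. norm x > r \<Longrightarrow> u x = 0" "\<And>x. norm x > r \<Longrightarrow> K x = 0"
    and loc: "\<And>x. x \<in> cball 0 (R + 1) \<Longrightarrow> u x = f x + quad (mat 1) x + (a \<bullet> x + b)"
      "\<And>x. x \<in> cball 0 (R + 1) \<Longrightarrow> K x = H x + mat 1"
    by simp_all
  have R1: "0 < R + 1" using R by simp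
  obtain L U \<Lambda> where approx: "0 < \<Lambda> \<and>
    (\<forall>e>0. \<forall>\<^sub>F N in sequentially. \<forall>x. \<bar>trig_sum (L N) x - U x\<bar> \<le> e) \<and>
    (\<forall>x. norm x < R + 1 \<longrightarrow> U x = u x) \<and>
    (\<forall>N x v. \<bar>v \<bullet> (trig_hess (L N) x *v v)\<bar> \<le> \<Lambda> * (v \<bullet> v)) \<and>
    (\<forall>x. norm x < R + 1 \<longrightarrow> (\<lambda>N. trig_hess (L N) x) \<longlonglongrightarrow> K x)"
    by (rule exE[OF trig_approximation[OF u r(1) r(2) r(3) R1]]) (assumption, assumption, elim exE, erule that)
  then have \<Lambda>: "0 < \<Lambda>"
    and unif: "\<And>e. 0 < e \<Longrightarrow> \<forall>\<^sub>F N in sequentially. \<forall>x. \<bar>trig_sum (L N) x - U x\<bar> \<le> e"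
    and U: "\<And>x. norm x < R + 1 \<Longrightarrow> U x = u x"
    and bound: "\<And>N x v. \<bar>v \<bullet> (trig_hess (L N) x *v v)\<bar> \<le> \<Lambda> * (v \<bullet> v)"
    and hess: "\<And>x. norm x < R + 1 \<Longrightarrow> (\<lambda>N. trig_hess (L N) x) \<longlonglongrightarrow> K x"
    by blast+
  have psd1: "psd (mat 1)" by (simp add: psd_def)
  have "has_density \<phi> (\<lambda>x. f x + quad ((1 + \<Lambda>) *\<^sub>R mat 1 + A) x) (\<lambda>x. H x + ((1 + \<Lambda>) *\<^sub>R mat 1 + A))" if A: "psd A" for A
  proof -
    define D where "D = \<Lambda> *\<^sub>R mat 1 + A"
    have D: "psd D" unfolding D_def using \<Lambda> by (intro psd_add psd_scale psd1 A) simp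
    have pN: "psd (D + trig_hess (L N) x)" for N x
    proof -
      have "0 \<le> v \<bullet> ((D + trig_hess (L N) x) *v v)" for v
      proof -
        have "v \<bullet> ((D + trig_hess (L N) x) *v v) = \<Lambda> * (v \<bullet> v) + v \<bullet> (A *v v) + v \<bullet> (trig_hess (L N) x *v v)"
          by (simp add: D_def matrix_vector_mult_add_rdistrib scaleR_matrix_vector inner_add_right)
        moreover have "0 \<le> v \<bullet> (A *v v)" using A by (simp add: psd_def)
        ultimately show ?thesis using bound[of v N x] by linarith
      qed
      then show ?thesis using D by (simp add: psd_def transpose_add trig_hess_symmetric)
    qed
    define h where "h = (\<lambda>N x. quad D x + trig_sum (L N) x)"
    define hU where "hU = (\<lambda>x. quad D x + U x)"
    have hN: "h N \<in> Conv" "has_density \<phi> (h N) (\<lambda>x. D + trig_hess (L N) x)" for N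
      unfolding h_def using has_density_trig[OF D pN \<phi>] by blast+
    have luc: "loc_unif_conv h hU"
      unfolding loc_unif_conv_def
    proof (intro allI impI uniform_limitI)
      fix C :: "(real^'n) set" and e :: real assume e: "0 < e"
      from unif[OF half_gt_zero[OF e]] show "\<forall>\<^sub>F N in sequentially. \<forall>x\<in>C. dist (h N x) (hU x) < e"
      proof eventually_elim
        case (elim N)
        show ?case
        proof
          fix x
          from spec[OF elim, of x] e show "dist (h N x) (hU x) < e" unfolding h_def hU_def dist_real_def by linarith
        qed
      qed
    qed
    have pt: "(\<lambda>N. h N x) \<longlonglongrightarrow> hU x" for x
    proof -
      have "uniform_limit {x} h hU sequentially" by (rule luc[unfolded loc_unif_conv_def, rule_format]) simp
      then show ?thesis by (rule tendsto_uniform_limitI) simp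
    qed
    \<comment> \<open>\<open>U\<close> is known only as a uniform limit; convexity of
      \<open>hU\<close> on the whole space comes from the approximants.\<close>
    have hU: "hU \<in> Conv" by (rule Conv_limit[OF hN(1) pt])
    have lim1: "(\<lambda>N. cint (\<Psi> (h N)) \<phi>) \<longlonglongrightarrow> cint (\<Psi> hU) \<phi>"
      by (rule val_continuous[OF hN(1) hU luc \<phi>])
    have Hc: "continuous_on UNIV H" by (rule C2_hessian_continuous[OF H])
    have psdH: "psd (H x)" for x by (rule C2_convex_hessian_psd[OF f H])
    have mat: "(1 + \<Lambda>) *\<^sub>R mat 1 + A = mat 1 + D" by (simp add: D_def scaleR_add_left add.assoc)
    have cf: "(\<lambda>x. f x + quad (mat 1 + D) x) \<in> Conv" by (intro Conv_add f Conv_quad psd_add psd1 D)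
    \<comment> \<open>\<open>\<phi>\<close> vanishes beyond the radius \<open>R\<close>; the 1 in
      \<open>R + 1\<close> provides an open ball around its support in which the cutoff has not
      changed \<open>f\<close>.\<close>
    have loc_eq: "cint (\<Psi> hU) \<phi> = cint (\<Psi> (\<lambda>x. f x + quad (mat 1 + D) x)) \<phi>"
    proof (rule cint_local[OF cf hU open_ball[of 0 "R + 1"], of a b])
      show "hU x = f x + quad (mat 1 + D) x + (a \<bullet> x + b)" if "x \<in> ball 0 (R + 1)" for x
        using U[of x] loc(1)[of x] that by (simp add: hU_def quad_add)
      show "{x. \<phi> x \<noteq> 0} \<subseteq> ball 0 (R + 1)" using R(2) by (force simp: not_less[symmetric])
    qed (rule bbf_Cc[OF \<phi>])
    \<comment> \<open>All matrices \<open>D + trig_hess (L N) x\<close> lie in one compact set of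
      positive semidefinite matrices, which bounds the integrands for dominated convergence.\<close>
    obtain Q where Q: "\<And>N x. norm (D + trig_hess (L N) x) \<le> Q"
    proof -
      have "norm (D + trig_hess (L N) x) \<le> norm D + real CARD('n) * (real CARD('n) * (3 * \<Lambda>))" for N x
        using symmetric_matrix_bound[OF trig_hess_symmetric bound, of N x] norm_triangle_ineq[of D "trig_hess (L N) x"] by linarith
      then show thesis by (rule that)
    qed
    have "compact ({M. psd M} \<inter> cball 0 Q)" by (intro closed_Int_compact closed_psd compact_cball)
    then have "compact (quad_val ` ({M. psd M} \<inter> cball 0 Q))"
      by (intro compact_continuous_image continuous_on_subset[OF continuous_quad_val]) auto
    then obtain B where B: "B > 0" "\<forall>z\<in>quad_val ` ({M. psd M} \<inter> cball 0 Q). norm z \<le> B"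
      using compact_imp_bounded[of "quad_val ` ({M. psd M} \<inter> cball 0 Q)"] unfolding bounded_pos by blast
    have Bq: "norm (quad_val (D + trig_hess (L N) x)) \<le> B" for N x
      using B(2) pN[of N x] Q[of N x] by auto
    have cont: "continuous_on UNIV (\<lambda>x. D + trig_hess (L N) x)" for N
      by (intro continuous_on_add continuous_on_const C2_hessian_continuous[OF C2_hessian_trig_sum])
    have contH: "continuous_on UNIV (\<lambda>x. H x + (mat 1 + D))" by (intro continuous_intros Hc)
    have psdHD: "psd (H x + (mat 1 + D))" for x by (intro psd_add psdH psd1 D)
    have lim2: "(\<lambda>N. LINT x|lborel. \<phi> x * quad_val (D + trig_hess (L N) x)) \<longlonglongrightarrow> (LINT x|lborel. \<phi> x * quad_val (H x + (mat 1 + D)))"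
    proof (rule integral_dominated_convergence)
      have "integrable lborel (\<lambda>x. \<phi> x * 1)"
        by (rule radon_rep_integrable[OF radon_rep_density_measure bbf_Cc[OF \<phi>]]) simp
      then show "integrable lborel (\<lambda>x. norm (\<phi> x) * B)" by (intro integrable_mult_left integrable_norm) simp
      show "(\<lambda>x. \<phi> x * quad_val (H x + (mat 1 + D))) \<in> borel_measurable lborel"
        using integrable_quad_val[OF contH psdHD \<phi>] by auto
      show "(\<lambda>x. \<phi> x * quad_val (D + trig_hess (L N) x)) \<in> borel_measurable lborel" for N
        using integrable_quad_val[OF cont pN \<phi>] by auto
      show "AE x in lborel. norm (\<phi> x * quad_val (D + trig_hess (L N) x)) \<le> norm (\<phi> x) * B" for N
        unfolding norm_mult by (intro AE_I2 mult_left_mono Bq norm_ge_zero)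
      show "AE x in lborel. (\<lambda>N. \<phi> x * quad_val (D + trig_hess (L N) x)) \<longlonglongrightarrow> \<phi> x * quad_val (H x + (mat 1 + D))"
      proof (rule AE_I2)
        fix x
        show "(\<lambda>N. \<phi> x * quad_val (D + trig_hess (L N) x)) \<longlonglongrightarrow> \<phi> x * quad_val (H x + (mat 1 + D))"
        proof (cases "norm x < R + 1")
          case True
          then have "(\<lambda>N. D + trig_hess (L N) x) \<longlonglongrightarrow> D + K x" by (intro tendsto_intros hess)
          moreover have "D + K x = H x + (mat 1 + D)" using loc(2)[of x] True by (simp add: add_ac)
          ultimately have "(\<lambda>N. D + trig_hess (L N) x) \<longlonglongrightarrow> H x + (mat 1 + D)" by simp
          then have "(\<lambda>N. quad_val (D + trig_hess (L N) x)) \<longlonglongrightarrow> quad_val (H x + (mat 1 + D))"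
            by (rule continuous_on_tendsto_compose[OF continuous_quad_val]) (simp_all add: psdHD pN)
          then show ?thesis by (intro tendsto_mult tendsto_const)
        next
          case False
          then have "\<phi> x = 0" using R(2)[of x] by simp
          then show ?thesis by simp
        qed
      qed
    qed
    have "cint (\<Psi> hU) \<phi> = (LINT x|lborel. \<phi> x * quad_val (H x + (mat 1 + D)))"
      by (rule LIMSEQ_unique[OF lim1 lim2[folded hN(2)[unfolded has_density_def]]])
    then show ?thesis unfolding mat has_density_def using loc_eq by simp
  qed
  then show ?thesis using \<Lambda> by (intro exI[of _ "1 + \<Lambda>"]) auto
qed

text \<open>The shift \<open>s *\<^sub>R mat 1\<close> is the sum of the outer products of the basis
  vectors scaled by \<open>sqrt s\<close>, so \<open>has_density_descend\<close> removes it.\<close>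

lemma has_density_C2:
  assumes f: "f \<in> Conv" and H: "C2_hessian f H" and \<phi>: "\<phi> \<in> Cc"
  shows "has_density \<phi> f H"
proof -
  obtain s where s: "s \<ge> 0" and dens: "\<And>A. psd A \<Longrightarrow> has_density \<phi> (\<lambda>x. f x + quad (s *\<^sub>R mat 1 + A) x) (\<lambda>x. H x + (s *\<^sub>R mat 1 + A))"
    using has_density_C2_shifted[OF assms] by blast
  obtain l :: "'n list" where l: "set l = UNIV" "distinct l" using finite_distinct_list[of "UNIV :: 'n set"] by auto
  define E where "E = map (\<lambda>i. sqrt s *\<^sub>R (axis i 1 :: real^'n)) l"
  have "sum_list (map outer E) = (\<Sum>i\<in>UNIV. s *\<^sub>R outer (axis i 1))"
    using s l by (simp add: E_def o_def outer_sqrt sum_list_distinct_conv_sum_set)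
  also have "\<dots> = s *\<^sub>R mat 1"
    unfolding diagm_eq_sum[of "\<lambda>i. s", symmetric] by (simp add: diagm_def mat_def vec_eq_iff)
  finally have E: "sum_list (map outer E) = s *\<^sub>R mat 1" .
  have "has_density \<phi> (\<lambda>x. f x + quad 0 x) (\<lambda>x. H x + 0)"
    by (rule has_density_descend[OF f _ _ \<phi>, where E=E])
       (use dens C2_hessian_continuous[OF H] C2_convex_hessian_psd[OF f H] psd_zero E in auto)
  then show ?thesis by (simp add: quad_def)
qed

lemma val_C2:
  assumes f: "f \<in> Conv" and H: "C2_hessian f H" and B: "B \<in> bborel"
  shows "\<Psi> f B = (LINT x:B|lborel. quad_val (H x))"
proof -
  have c: "continuous_on UNIV (\<lambda>x. quad_val (H x))"
    by (intro continuous_quad_val_compose C2_hessian_continuous[OF H] C2_convex_hessian_psd[OF f H])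
  have "\<Psi> f B = density_measure (\<lambda>x. quad_val (H x)) B"
    by (rule cradon_eqI[OF cradon_val[OF f] cradon_density_measure[OF c] _ B])
       (use has_density_C2[OF f H] cint_density_measure[OF c bbf_Cc] in \<open>simp add: has_density_def\<close>)
  then show ?thesis using B by (simp add: density_measure_def)
qed

end

theorem theorem1p5:
  fixes \<Psi> :: "(real^'n \<Rightarrow> real) \<Rightarrow> ((real^'n) set \<Rightarrow> complex)"
    and k :: nat
  assumes "MAVal k \<Psi>"
    and "SO_equivariant \<Psi>"
  shows "\<exists>c::complex. \<forall>f H. f \<in> Conv \<longrightarrow> C2_hessian f H \<longrightarrow>
           (\<forall>B\<in>bborel. \<Psi> f B = c * complex_of_real (LINT x:B|lborel. sigma_eig k (H x)))"
proof -
  interpret so_valuation k \<Psi> using assms by unfold_locales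
  obtain c where c: "\<And>A. psd A \<Longrightarrow> quad_val A = c * complex_of_real (sigma_eig k A)"
    using quad_val_eq_sigma by blast
  have "\<Psi> f B = c * complex_of_real (LINT x:B|lborel. sigma_eig k (H x))"
    if f: "f \<in> Conv" and H: "C2_hessian f H" and B: "B \<in> bborel" for f H B
  proof -
    have "\<Psi> f B = (LINT x:B|lborel. c * complex_of_real (sigma_eig k (H x)))"
      using val_C2[OF f H B] c[OF C2_convex_hessian_psd[OF f H]] by simp
    \<comment> \<open>A constant factor of a field leaves the Bochner integral whether or not the
      integrand is integrable, the integral being 0 in the latter case; so integrability of
      \<open>sigma_eig k (H x)\<close> is not at issue, even for \<open>c = 0\<close>.\<close>
    also have "\<dots> = c * (LINT x|lborel. complex_of_real (indicator B x * sigma_eig k (H x)))"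
      by (simp add: set_lebesgue_integral_def scaleR_conv_of_real mult_ac)
    also have "(LINT x|lborel. complex_of_real (indicator B x * sigma_eig k (H x)))
        = complex_of_real (LINT x:B|lborel. sigma_eig k (H x))"
      unfolding set_lebesgue_integral_def real_scaleR_def by (rule integral_complex_of_real)
    finally show ?thesis .
  qed
  then show ?thesis by blast
qed

end
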